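(* Let $\sigma=\sum_{j=1}^n c_j^2\delta_{p_j}\in\Sigma_0$ and $u=\psi(P^\sigma)\in\Xi_0$ (a function on $\mathbf{R}$). Let $\{B(y)\}_{y\ge0}$ be an $n$-dimensional Brownian motion on a probability space $(\Omega,\mathcal{F},P)$, extended to $y\le0$ by $B(y)=B(-y)$. Let $D_\sigma$ be the $n\times n$ diagonal matrix with diagonal entries $p_1,\dots,p_n$, let $\mathbf{c}={}^t(c_1,\dots,c_n)$, and define, for all $y\in\mathbf{R}$, $$\xi_\sigma(y)=e^{yD_\sigma}\int_0^ye^{-zD_\sigma}\,dB(z),\qquad X_\sigma(y)=\langle\mathbf{c},\xi_\sigma(y)\rangle .$$ Then $$u(x)=4\Bigl(\frac{d}{dx}\Bigr)^2\log\Bigl(\int_\Omega\exp\Bigl(-\frac12\int_{\min\{0,x\}}^{\max\{0,x\}}X_\sigma(y)^2dy\Bigr)dP\Bigr),\qquad x\in\mathbf{R}.$$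
   Context: Stochastic integrals are It\^o integrals. For $y\le0$, $\int_0^ye^{-zD_\sigma}dB(z)=-\int_y^0e^{-zD_\sigma}dB(z)$ is understood with respect to the reflected path $B(z)=B(-z)$, i.e. as $\int_0^{-y}e^{zD_\sigma}dB(z)$, the It\^o integral with respect to $\{B(z)\}_{z\ge0}$. $\langle\cdot,\cdot\rangle$ is the inner product of $\mathbf{R}^n$. $\mathcal{W}$ is the space of continuous functions $w:[0,\infty)\to\mathbf{R}$ with $w(0)=0$, with the topology of uniform convergence on compacts and its Borel $\sigma$-field; $X(x,w)=w(x)$ is the coordinate process. $\Sigma_0$ is the set of measures on $\mathbf{R}$ of the form $\sum_{j=1}^n c_j^2\delta_{p_j}$ with $n\in\mathbf{N}$ ($n\ge1$), $c_j>0$, $p_j\in\mathbf{R}$, $p_i\ne p_j$ for $i\neq j$. For $\sigma\in\Sigma_0$ let $$R_\sigma(x,y)=\int_{\mathbf{R}}\frac{e^{\zeta(x+y)}-e^{\zeta|x-y|}}{2\zeta}\,\sigma(d\zeta),\quad x,y\ge0$$ (the integrand at $\zeta=0$ is its limit $\min\{x,y\}$), and let $P^\sigma$ be the probability measure on $\mathcal{W}$ under which $\{X(x)\}_{x\ge0}$ is a centered Gaussian process with covariance function $R_\sigma$. Reflectionless potentials: $\mathcal{S}$ is the set of all finite sequences $\mathbf{s}=\{\eta_j,m_j\}_{1\le j\le n}$, $n=1,2,\dots$, of positive real numbers with $\eta_1<\dots<\eta_n$. For $\mathbf{s}\in\mathcal{S}$, $$u_{\mathbf{s}}(x)=-2\Bigl(\frac{d}{dx}\Bigr)^2\log\det(I+G_{\mathbf{s}}(x)),\quad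 x\in\mathbf{R},\qquad G_{\mathbf{s}}(x)=\Bigl(\frac{\sqrt{m_im_j}\,e^{-(\eta_i+\eta_j)x}}{\eta_i+\eta_j}\Bigr)_{1\le i,j\le n}.$$ $\Xi_0=\{u_{\mathbf{s}}\mid\mathbf{s}\in\mathcal{S}\}$. For $\sigma\in\Sigma_0$ put $$\psi(P^\sigma)(x)=4\Bigl(\frac{d}{dx}\Bigr)^2\log\Bigl(\int_{\mathcal{W}}\exp\Bigl(-\frac12\int_0^xX(y)^2dy\Bigr)dP^\sigma\Bigr),\quad x\ge0.$$ It is known (earlier work of Ikeda and Taniguchi) that this is well defined and equals on $[0,\infty)$ the restriction of an element of $\Xi_0$; since elements of $\Xi_0$ are real analytic on $\mathbf{R}$, that element is unique, and $\psi(P^\sigma)$ is identified with it. *)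

theory Defs
  imports "HOL-Probability.Probability" "Jordan_Normal_Form.Determinant"
begin

text \<open>From here on, \<open>$\<close> is the component of a vector in \<open>real ^ 'n\<close>.\<close>
no_notation Matrix.vec_index (infixl \<open>$\<close> 100)

text \<open>Point masses count as Gaussian, since \<open>X 0 = 0\<close> for the processes below.\<close>
definition gaussian_rv :: "'a measure \<Rightarrow> ('a \<Rightarrow> real) \<Rightarrow> bool" where
  "gaussian_rv M Y \<longleftrightarrow>
     Y \<in> borel_measurable M \<and>
     ((\<exists>m. AE \<omega> in M. Y \<omega> = m) \<or>
      (\<exists>m s. s > 0 \<and> distributed M lborel Y (\<lambda>y. ennreal (normal_density m s y))))"

definition gaussian_process :: "'a measure \<Rightarrow> 't set \<Rightarrow> ('t \<Rightarrow> 'a \<Rightarrow> real) \<Rightarrow> bool" where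
  "gaussian_process M T X \<longleftrightarrow>
     prob_space M \<and>
     (\<forall>J a. finite J \<and> J \<subseteq> T \<longrightarrow> gaussian_rv M (\<lambda>\<omega>. \<Sum>t\<in>J. a t * X t \<omega>))"

definition centered_gaussian_process ::
    "'a measure \<Rightarrow> 't set \<Rightarrow> ('t \<Rightarrow> 'a \<Rightarrow> real) \<Rightarrow> ('t \<Rightarrow> 't \<Rightarrow> real) \<Rightarrow> bool" where
  "centered_gaussian_process M T X R \<longleftrightarrow>
     gaussian_process M T X \<and>
     (\<forall>t\<in>T. (LINT \<omega>|M. X t \<omega>) = 0) \<and>
     (\<forall>s\<in>T. \<forall>t\<in>T. (LINT \<omega>|M. X s \<omega> * X t \<omega>) = R s t)"

text \<open>Functions on \<open>[0,\<infinity>)\<close> are represented by extensional functions, so that two paths are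
  equal if and only if they agree on \<open>{0..}\<close>.\<close>
definition path_space :: "(real \<Rightarrow> real) set" where
  "path_space = {w \<in> extensional {0..}. continuous_on {0..} w \<and> w 0 = 0}"

text \<open>The topology of uniform convergence on compacts; the intervals \<open>{0..T}\<close> are cofinal among
  the compact subsets of \<open>{0..}\<close>.\<close>
definition path_topology :: "(real \<Rightarrow> real) topology" where
  "path_topology = topology (\<lambda>U. U \<subseteq> path_space \<and>
     (\<forall>w\<in>U. \<exists>T\<ge>0. \<exists>e>0. {v \<in> path_space. \<forall>x\<in>{0..T}. \<bar>v x - w x\<bar> < e} \<subseteq> U))"

lemma openin_path_topology:
  "openin path_topology U \<longleftrightarrow> U \<subseteq> path_space \<and>
     (\<forall>w\<in>U. \<exists>T\<ge>0. \<exists>e>0. {v \<in> path_space. \<forall>x\<in>{0..T}. \<bar>v x - w x\<bar> < e} \<subseteq> U)"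
proof -
  let ?N = "\<lambda>w (T::real) (e::real). {v \<in> path_space. \<forall>x\<in>{0..T}. \<bar>v x - w x\<bar> < e}"
  let ?L = "\<lambda>U. U \<subseteq> path_space \<and> (\<forall>w\<in>U. \<exists>T\<ge>0. \<exists>e>0. ?N w T e \<subseteq> U)"
  have "istopology ?L"
    unfolding istopology_def
  proof (intro conjI allI impI)
    fix S T assume S: "?L S" and T: "?L T"
    show "S \<inter> T \<subseteq> path_space" using S by blast
    show "\<forall>w\<in>S \<inter> T. \<exists>t\<ge>0. \<exists>e>0. ?N w t e \<subseteq> S \<inter> T"
    proof
      fix w assume w: "w \<in> S \<inter> T"
      obtain t1 e1 where 1: "t1 \<ge> 0" "e1 > 0" "?N w t1 e1 \<subseteq> S"
        using S w by blast
      obtain t2 e2 where 2: "t2 \<ge> 0" "e2 > 0" "?N w t2 e2 \<subseteq> T"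
        using T w by blast
      have "?N w (max t1 t2) (min e1 e2) \<subseteq> ?N w t1 e1 \<inter> ?N w t2 e2"
        by auto
      then have "?N w (max t1 t2) (min e1 e2) \<subseteq> S \<inter> T"
        using 1(3) 2(3) by blast
      moreover have "max t1 t2 \<ge> 0" "min e1 e2 > 0" using 1 2 by auto
      ultimately show "\<exists>t\<ge>0. \<exists>e>0. ?N w t e \<subseteq> S \<inter> T" by blast
    qed
  next
    fix K assume K: "\<forall>U\<in>K. ?L U"
    then show "\<Union>K \<subseteq> path_space" by blast
    show "\<forall>w\<in>\<Union>K. \<exists>t\<ge>0. \<exists>e>0. ?N w t e \<subseteq> \<Union>K"
    proof
      fix w assume "w \<in> \<Union>K"
      then obtain U where U: "U \<in> K" "w \<in> U" by blast
      obtain t e where "t \<ge> 0" "e > 0" "?N w t e \<subseteq> U"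
        using K U by blast
      then show "\<exists>t\<ge>0. \<exists>e>0. ?N w t e \<subseteq> \<Union>K" using U(1) by blast
    qed
  qed
  then show ?thesis unfolding path_topology_def by simp
qed

definition path_borel :: "(real \<Rightarrow> real) measure" where
  "path_borel = sigma path_space {U. openin path_topology U}"

definition coord :: "real \<Rightarrow> (real \<Rightarrow> real) \<Rightarrow> real" where
  "coord x w = w x"

text \<open>The measure \<open>\<Sum>\<^sub>j c\<^sub>j\<^sup>2 \<delta>\<^bsub>p\<^sub>j\<^esub>\<close>. The number of atoms is \<open>CARD('n)\<close>.\<close>
definition atomic_measure :: "real ^ 'n \<Rightarrow> real ^ 'n \<Rightarrow> real measure" where
  "atomic_measure c p = measure_of UNIV (sets borel)
     (\<lambda>A. \<Sum>j\<in>UNIV. ennreal ((c $ j)\<^sup>2) * emeasure (return borel (p $ j)) A)"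

lemma sets_atomic_measure [simp]: "sets (atomic_measure c p) = sets borel"
  using sets.sigma_sets_eq[of "borel :: real measure"]
  by (simp add: atomic_measure_def)

lemma space_atomic_measure [simp]: "space (atomic_measure c p) = UNIV"
  by (simp add: atomic_measure_def space_measure_of_conv)

lemma emeasure_atomic_measure:
  assumes A: "A \<in> sets borel"
  shows "emeasure (atomic_measure c p) A = (\<Sum>j\<in>UNIV. ennreal ((c $ j)\<^sup>2) * indicator A (p $ j))"
proof -
  let ?\<mu> = "\<lambda>A. \<Sum>j\<in>UNIV. ennreal ((c $ j)\<^sup>2) * emeasure (return borel (p $ j)) A"
  have "emeasure (atomic_measure c p) A = ?\<mu> A"
  proof (rule emeasure_measure_of[OF atomic_measure_def])
    show "A \<in> sets (atomic_measure c p)" using A by simp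
    show "positive (sets (atomic_measure c p)) ?\<mu>" by (simp add: positive_def)
    show "countably_additive (sets (atomic_measure c p)) ?\<mu>"
    proof (rule countably_additiveI)
      fix F :: "nat \<Rightarrow> real set"
      assume F: "range F \<subseteq> sets (atomic_measure c p)" "disjoint_family F"
        "\<Union> (range F) \<in> sets (atomic_measure c p)"
      have "(\<Sum>i. ?\<mu> (F i)) = (\<Sum>j\<in>UNIV. \<Sum>i. ennreal ((c $ j)\<^sup>2) * emeasure (return borel (p $ j)) (F i))"
        by (rule suminf_sum) simp
      also have "\<dots> = ?\<mu> (\<Union> (range F))"
        using F by (intro sum.cong refl) (simp add: suminf_indicator)
      finally show "(\<Sum>i. ?\<mu> (F i)) = ?\<mu> (\<Union> (range F))" .
    qed
  qed simp
  then show ?thesis using A by simp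
qed

definition cov_kernel :: "real \<Rightarrow> real \<Rightarrow> real \<Rightarrow> real" where
  "cov_kernel x y \<zeta> =
     (if \<zeta> = 0 then min x y else (exp (\<zeta> * (x + y)) - exp (\<zeta> * \<bar>x - y\<bar>)) / (2 * \<zeta>))"

definition R_cov :: "real measure \<Rightarrow> real \<Rightarrow> real \<Rightarrow> real" where
  "R_cov \<sigma> x y = (LINT \<zeta>|\<sigma>. cov_kernel x y \<zeta>)"

text \<open>\<open>P\<close> is the measure \<open>P\<^sup>\<sigma>\<close>; the conditions determine \<open>P\<close> uniquely.\<close>
definition is_P :: "real measure \<Rightarrow> (real \<Rightarrow> real) measure \<Rightarrow> bool" where
  "is_P \<sigma> P \<longleftrightarrow>
     sets P = sets path_borel \<and> prob_space P \<and>
     centered_gaussian_process P {0..} coord (R_cov \<sigma>)"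

text \<open>\<open>log \<integral> exp(-1/2 \<integral>\<^sub>a\<^sup>b Y(y)\<^sup>2 dy) dM\<close>\<close>
definition log_laplace :: "'a measure \<Rightarrow> (real \<Rightarrow> 'a \<Rightarrow> real) \<Rightarrow> real \<Rightarrow> real \<Rightarrow> real" where
  "log_laplace M Y a b =
     ln (LINT \<omega>|M. exp (- (1 / 2) * (LBINT y:{a..b}. (Y y \<omega>)\<^sup>2)))"

text \<open>The derivative of a function on \<open>S\<close>; it is one-sided at the endpoints of \<open>S\<close>.\<close>
definition deriv_within :: "real set \<Rightarrow> (real \<Rightarrow> real) \<Rightarrow> real \<Rightarrow> real" where
  "deriv_within S f x = vector_derivative f (at x within S)"

text \<open>Meaningful for \<open>x \<ge> 0\<close> only.\<close>
definition psi :: "(real \<Rightarrow> real) measure \<Rightarrow> real \<Rightarrow> real" where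
  "psi P x = 4 * (deriv_within {0..} ^^ 2) (\<lambda>x. log_laplace P coord 0 x) x"

text \<open>A sequence \<open>{\<eta>\<^sub>j, m\<^sub>j}\<close> is the list of the pairs \<open>(\<eta>\<^sub>j, m\<^sub>j)\<close>.\<close>
definition scattering_data :: "(real \<times> real) list set" where
  "scattering_data =
     {s. s \<noteq> [] \<and> (\<forall>(\<eta>, m) \<in> set s. \<eta> > 0 \<and> m > 0) \<and> sorted_wrt (<) (map fst s)}"

definition G_mat :: "(real \<times> real) list \<Rightarrow> real \<Rightarrow> real mat" where
  "G_mat s x = Matrix.mat (length s) (length s) (\<lambda>(i, j).
     sqrt (snd (s ! i) * snd (s ! j)) * exp (- (fst (s ! i) + fst (s ! j)) * x)
       / (fst (s ! i) + fst (s ! j)))"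

definition potential :: "(real \<times> real) list \<Rightarrow> real \<Rightarrow> real" where
  "potential s x =
     - 2 * (deriv ^^ 2) (\<lambda>x. ln (Determinant.det (1\<^sub>m (length s) + G_mat s x))) x"

definition Xi0 :: "(real \<Rightarrow> real) set" where
  "Xi0 = potential ` scattering_data"

text \<open>Processes are indexed by \<open>real\<close>, and only their values at times \<open>t \<ge> 0\<close> are relevant.\<close>

definition natural_filtration ::
    "'a measure \<Rightarrow> (real \<Rightarrow> 'a \<Rightarrow> 'b::topological_space) \<Rightarrow> real \<Rightarrow> 'a measure" where
  "natural_filtration M B t =
     sigma (space M) {B r -` S \<inter> space M | r S. 0 \<le> r \<and> r \<le> t \<and> S \<in> sets borel}"

definition brownian_motion :: "'a measure \<Rightarrow> (real \<Rightarrow> 'a \<Rightarrow> real ^ 'n) \<Rightarrow> bool" where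
  "brownian_motion M B \<longleftrightarrow>
     prob_space M \<and>
     (\<forall>t\<ge>0. B t \<in> borel_measurable M) \<and>
     (AE \<omega> in M. B 0 \<omega> = 0) \<and>
     (AE \<omega> in M. continuous_on {0..} (\<lambda>t. B t \<omega>)) \<and>
     (\<forall>s t. 0 \<le> s \<and> s < t \<longrightarrow>
        prob_space.indep_set M
          (sets (natural_filtration M B s))
          (sets (vimage_algebra (space M) (\<lambda>\<omega>. B t \<omega> - B s \<omega>) borel)) \<and>
        distributed M lborel (\<lambda>\<omega>. B t \<omega> - B s \<omega>)
          (\<lambda>x. ennreal (\<Prod>j\<in>UNIV. normal_density 0 (sqrt (t - s)) (x $ j))))"

text \<open>Simple processes \<open>\<Sum>\<^bsub>k<N\<^esub> H\<^sub>k 1\<^bsub>(t\<^sub>k, t\<^sub>k\<^sub>+\<^sub>1]\<^esub>\<close> with bounded matrix-valued \<open>H\<^sub>k\<close> that are measurable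
  with respect to the past of \<open>B\<close> up to time \<open>t\<^sub>k\<close>.\<close>
definition simple_integrand ::
    "'a measure \<Rightarrow> (real \<Rightarrow> 'a \<Rightarrow> real ^ 'n) \<Rightarrow>
     nat \<Rightarrow> (nat \<Rightarrow> real) \<Rightarrow> (nat \<Rightarrow> 'a \<Rightarrow> real ^ 'n ^ 'm) \<Rightarrow> bool" where
  "simple_integrand M B N t H \<longleftrightarrow>
     0 \<le> t 0 \<and> (\<forall>k<N. t k < t (Suc k)) \<and>
     (\<forall>k<N. H k \<in> borel_measurable (natural_filtration M B (t k)) \<and>
            (\<exists>C. \<forall>\<omega>\<in>space M. norm (H k \<omega>) \<le> C))"

definition simple_value ::
    "nat \<Rightarrow> (nat \<Rightarrow> real) \<Rightarrow> (nat \<Rightarrow> 'a \<Rightarrow> real ^ 'n ^ 'm) \<Rightarrow> real \<Rightarrow> 'a \<Rightarrow> real ^ 'n ^ 'm" where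
  "simple_value N t H s \<omega> = (\<Sum>k<N. indicator {t k<..t (Suc k)} s *\<^sub>R H k \<omega>)"

definition simple_integral ::
    "(real \<Rightarrow> 'a \<Rightarrow> real ^ 'n) \<Rightarrow>
     nat \<Rightarrow> (nat \<Rightarrow> real) \<Rightarrow> (nat \<Rightarrow> 'a \<Rightarrow> real ^ 'n ^ 'm) \<Rightarrow> real \<Rightarrow> 'a \<Rightarrow> real ^ 'm" where
  "simple_integral B N t H T \<omega> =
     (\<Sum>k<N. H k \<omega> *v (B (min T (t (Suc k))) \<omega> - B (min T (t k)) \<omega>))"

text \<open>\<open>Y\<close> is (a version of) the Ito integral \<open>\<integral>\<^sub>0\<^sup>T \<Phi>(s) dB(s)\<close>: the mean square limit of integrals
  of simple processes which converge to \<open>\<Phi>\<close> in \<open>L\<^sup>2([0,T] \<times> \<Omega>)\<close>.\<close>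
definition is_ito_integral ::
    "'a measure \<Rightarrow> (real \<Rightarrow> 'a \<Rightarrow> real ^ 'n) \<Rightarrow> (real \<Rightarrow> 'a \<Rightarrow> real ^ 'n ^ 'm) \<Rightarrow> real \<Rightarrow>
     ('a \<Rightarrow> real ^ 'm) \<Rightarrow> bool" where
  "is_ito_integral M B \<Phi> T Y \<longleftrightarrow>
     Y \<in> borel_measurable M \<and>
     (\<lambda>(s, \<omega>). \<Phi> s \<omega>) \<in> borel_measurable (restrict_space borel {0..T} \<Otimes>\<^sub>M M) \<and>
     (\<exists>N t H.
        (\<forall>i. simple_integrand M B (N i) (t i) (H i)) \<and>
        (\<lambda>i. \<integral>\<^sup>+\<omega>. (\<integral>\<^sup>+s\<in>{0..T}.
           ennreal ((norm (simple_value (N i) (t i) (H i) s \<omega> - \<Phi> s \<omega>))\<^sup>2) \<partial>lborel) \<partial>M)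
          \<longlonglongrightarrow> 0 \<and>
        (\<lambda>i. \<integral>\<^sup>+\<omega>. ennreal ((norm (simple_integral B (N i) (t i) (H i) T \<omega> - Y \<omega>))\<^sup>2) \<partial>M)
          \<longlonglongrightarrow> 0)"

text \<open>The Ito integral as a process, that is, a version with continuous paths.\<close>
definition is_ito_process ::
    "'a measure \<Rightarrow> (real \<Rightarrow> 'a \<Rightarrow> real ^ 'n) \<Rightarrow> (real \<Rightarrow> 'a \<Rightarrow> real ^ 'n ^ 'm) \<Rightarrow>
     (real \<Rightarrow> 'a \<Rightarrow> real ^ 'm) \<Rightarrow> bool" where
  "is_ito_process M B \<Phi> Y \<longleftrightarrow>
     (\<forall>T\<ge>0. is_ito_integral M B \<Phi> T (Y T)) \<and>
     (\<forall>\<omega>\<in>space M. continuous_on {0..} (\<lambda>t. Y t \<omega>))"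

text \<open>\<open>Y y\<close> is \<open>\<integral>\<^sub>0\<^sup>y \<Phi>(z) dB(z)\<close> for all real \<open>y\<close>, where \<open>B\<close> is extended by \<open>B(y) = B(-y)\<close>: for
  \<open>y \<le> 0\<close> this is the Ito integral \<open>\<integral>\<^sub>0\<^sup>-\<^sup>y \<Phi>(-z) dB(z)\<close> with respect to \<open>B\<close> on \<open>{0..}\<close>.\<close>
definition is_two_sided_ito_process ::
    "'a measure \<Rightarrow> (real \<Rightarrow> 'a \<Rightarrow> real ^ 'n) \<Rightarrow> (real \<Rightarrow> 'a \<Rightarrow> real ^ 'n ^ 'm) \<Rightarrow>
     (real \<Rightarrow> 'a \<Rightarrow> real ^ 'm) \<Rightarrow> bool" where
  "is_two_sided_ito_process M B \<Phi> Y \<longleftrightarrow>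
     is_ito_process M B \<Phi> Y \<and>
     is_ito_process M B (\<lambda>z. \<Phi> (- z)) (\<lambda>t. Y (- t))"

definition diagonal_matrix :: "real ^ 'n \<Rightarrow> real ^ 'n ^ 'n" where
  "diagonal_matrix p = (\<chi> i j. if i = j then p $ i else 0)"

definition matrix_exp :: "real ^ 'n ^ 'n \<Rightarrow> real ^ 'n ^ 'n" where
  "matrix_exp A = (\<Sum>k. (1 / fact k) *\<^sub>R (((**) A ^^ k) (Finite_Cartesian_Product.mat 1)))"

end

theory Submission
  imports Defs "HOL-Complex_Analysis.Great_Picard" "Jordan_Normal_Form.Schur_Decomposition"
begin

no_notation Matrix.vec_index (infixl \<open>$\<close> 100)
no_notation Matrix.scalar_prod (infix \<open>\<bullet>\<close> 70)

text \<open>Replacing the integral over \<open>[0,x]\<close> by Riemann sums, the Laplace transform of a centered Gaussian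
  process with covariance \<open>R\<^sub>\<sigma>\<close> becomes \<open>d\<^sub>N(x)\<close> to the power \<open>-1/2\<close>, where
  \<open>d\<^sub>N(x) = det (I + (x/N) R\<^sub>\<sigma>(xk/N, xl/N))\<close>. The entries extend to entire functions of \<open>x\<close>, and they are
  invariant under \<open>(p, x) \<mapsto> (-p, -x)\<close>; since the process at negative times is the process of the
  reflected measure, one family \<open>d\<^sub>N\<close> serves both half lines. The \<open>d\<^sub>N\<close> are bounded on compact sets, so by
  Montel's theorem a subsequence converges to an entire function \<open>d\<close>, and the Laplace transform equals
  \<open>d\<close> to the power \<open>-1/2\<close> on the whole real line. On the positive half line it agrees with the Laplace
  transform under \<open>P\<^sup>\<sigma>\<close>, because both depend on the covariance only. Reflectionless potentials are second
  logarithmic derivatives of entire functions as well, so the equality extends from \<open>x > 0\<close> to all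
  \<open>x\<close> by the identity theorem.\<close>

section \<open>Bounds and recursions for determinants\<close>

text \<open>Nothing probabilistic links the two half lines: for \<open>x < 0\<close> the integral
  runs over a process built from the same Brownian path a second time. The entire function
  \<open>d\<close> glues them, and it is the source of differentiability at 0. The bound behind
  Montel's theorem is uniform in \<open>N\<close> because the entries are Kronecker delta plus
  O(1/N): the squared Frobenius norm is N + O(1), and the determinant bound subtracts exactly this
  N. A subsequence is enough, since at real points the whole sequence converges. The determinant
  formula uses the Gaussian law through cosines of linear combinations of samples. For the Ito
  process this law must be derived from a definition by mean square limits of random simple
  integrands. The isometry compares these with a deterministic step sum, whose characteristic
  function is a product of normal ones. Step heights that give each cell its exact variance leave a
  single error, the mean distance between integral and step sum.\<close>

lemma prod_list_le_exp_sum_list: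
  fixes xs :: "real list"
  assumes "\<And>x. x \<in> set xs \<Longrightarrow> 0 \<le> x"
  shows "0 \<le> prod_list xs \<and> prod_list xs \<le> exp (sum_list xs - length xs)"
  using assms
proof (induction xs)
  case (Cons a xs)
  have a: "0 \<le> a" using Cons.prems by auto
  have IH: "0 \<le> prod_list xs" "prod_list xs \<le> exp (sum_list xs - length xs)"
    using Cons by auto
  have "a \<le> exp (a - 1)" using exp_ge_add_one_self[of "a - 1"] by simp
  then have "a * prod_list xs \<le> exp (a - 1) * exp (sum_list xs - length xs)"
    using a IH by (intro mult_mono) auto
  also have "\<dots> = exp (sum_list (a # xs) - length (a # xs))"
    by (simp add: exp_add[symmetric] algebra_simps)
  finally show ?case using a IH by auto
qed simp

text \<open>Cyclicity of the trace on the level of entries: summing over the outer index collapses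
  \<open>Q * P\<close> to the identity. It is applied to a Schur form \<open>B\<close>, whose
  diagonal lists the eigenvalues.\<close>

lemma sum_list_diag_similar_mat_wit:
  fixes A :: "'a::comm_ring_1 mat"
  assumes "similar_mat_wit A B P Q" and A: "A \<in> carrier_mat n n"
  shows "sum_list (diag_mat B) = (\<Sum>i<n. A $$ (i,i))"
proof -
  have c: "B \<in> carrier_mat n n" "P \<in> carrier_mat n n" "Q \<in> carrier_mat n n"
    and QP: "Q * P = 1\<^sub>m n" and AP: "A = P * B * Q"
    using assms by (auto simp: similar_mat_wit_def Let_def)
  have "(\<Sum>i<n. A $$ (i,i)) = (\<Sum>i<n. \<Sum>l<n. \<Sum>k<n. P $$ (i,k) * B $$ (k,l) * Q $$ (l,i))"
    unfolding AP using c
    by (intro sum.cong refl, subst sum.swap)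
      (auto simp: scalar_prod_def sum_distrib_right sum_distrib_left atLeast0LessThan mult_ac intro!: sum.cong)
  also have "\<dots> = (\<Sum>l<n. \<Sum>k<n. \<Sum>i<n. P $$ (i,k) * B $$ (k,l) * Q $$ (l,i))"
    by (subst sum.swap) (intro sum.cong refl sum.swap)
  also have "\<dots> = (\<Sum>l<n. \<Sum>k<n. B $$ (k,l) * (Q * P) $$ (l,k))"
    using c by (intro sum.cong refl)
      (auto simp: scalar_prod_def sum_distrib_left atLeast0LessThan mult_ac intro!: sum.cong)
  also have "\<dots> = (\<Sum>l<n. \<Sum>k<n. if k = l then B $$ (k,l) else 0)"
    unfolding QP by (intro sum.cong refl) auto
  also have "\<dots> = (\<Sum>l<n. B $$ (l,l))" by simp
  finally show ?thesis using c
    by (auto simp: diag_mat_def sum_list_sum_nth interv_sum_list_conv_sum_set_nat atLeast0LessThan)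
qed

lemma prod_list_sum_list_of_real:
  fixes es :: "complex list"
  assumes "\<And>e. e \<in> set es \<Longrightarrow> e \<in> \<real> \<and> 0 \<le> Re e"
  shows "prod_list es = complex_of_real (prod_list (map Re es))
    \<and> sum_list es = complex_of_real (sum_list (map Re es))"
  using assms by (induction es) (auto simp: complex_is_Real_iff complex_eq_iff)

text \<open>This is the arithmetic-geometric mean inequality for the eigenvalues of the Gram matrix of \<open>C\<close>.\<close>
lemma norm_det_le_exp_frobenius:
  fixes C :: "complex mat"
  assumes C: "C \<in> carrier_mat n n"
  shows "(cmod (Determinant.det C))\<^sup>2 \<le> exp ((\<Sum>i<n. \<Sum>j<n. (cmod (C $$ (i,j)))\<^sup>2) - n)"
proof -
  interpret cnj: comm_ring_hom cnj by unfold_locales auto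
  define A where "A = transpose_mat (map_mat cnj C)"
  have A: "A \<in> carrier_mat n n" using C by (auto simp: A_def)
  define M where "M = A * C"
  have M: "M \<in> carrier_mat n n" using A C by (auto simp: M_def)
  have detM: "Determinant.det M = complex_of_real ((cmod (Determinant.det C))\<^sup>2)"
  proof -
    have "Determinant.det A = cnj (Determinant.det C)"
      unfolding A_def using C by (subst det_transpose[of _ n]) (auto simp: cnj.hom_det)
    then show ?thesis unfolding M_def
      by (subst det_mult[OF A C]) (simp only: complex_norm_square mult.commute)
  qed
  have Mij: "M $$ (i,j) = (\<Sum>k<n. cnj (C $$ (k,i)) * C $$ (k,j))" if "i < n" "j < n" for i j
    using that A C by (auto simp: M_def A_def scalar_prod_def atLeast0LessThan intro!: sum.cong)
  obtain es where es: "char_poly M = (\<Prod>e\<leftarrow>es. [:- e, 1:])" "length es = n"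
    using char_poly_factorized[OF M] by auto
  obtain B P Q where BPQ: "schur_decomposition M es = (B, P, Q)" by (metis prod_cases3)
  have sch: "similar_mat_wit M B P Q" "upper_triangular B" "diag_mat B = es"
    using schur_decomposition[OF M es(1) BPQ] by auto
  have Bc: "B \<in> carrier_mat n n" using sch(1) M by (auto simp: similar_mat_wit_def Let_def)
  have det_es: "Determinant.det M = prod_list es"
    using det_similar[of M B] sch det_upper_triangular[OF sch(2) Bc]
    by (auto simp: similar_mat_def)
  have tr_es: "sum_list es = (\<Sum>i<n. M $$ (i,i))"
    using sum_list_diag_similar_mat_wit[OF sch(1) M] sch(3) by simp
  \<comment> \<open>Since \<open>M\<close> is the conjugate transpose of \<open>C\<close> times
    \<open>C\<close>, pairing \<open>M v = e v\<close> with the conjugate of \<open>v\<close> gives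
    \<open>e\<close> times the squared norm of \<open>v\<close> on one side and the squared norm of
    \<open>w = C v\<close> on the other. So \<open>e\<close> is a quotient of nonnegative
    reals.\<close>
  have ev: "e \<in> \<real> \<and> 0 \<le> Re e" if e: "e \<in> set es" for e
  proof -
    have "poly (char_poly M) e = 0" unfolding es(1) poly_prod_list using e
      by (auto simp: prod_list_zero_iff)
    then have "eigenvalue M e" using eigenvalue_root_char_poly[OF M] by auto
    then obtain v where "eigenvector M v e" unfolding eigenvalue_def by auto
    then have v: "v \<in> carrier_vec n" "v \<noteq> 0\<^sub>v n" "M *\<^sub>v v = e \<cdot>\<^sub>v v"
      using M by (auto simp: eigenvector_def)
    define a where "a i = Matrix.vec_index v i" for i
    define w where "w k = (\<Sum>j<n. C $$ (k,j) * a j)" for k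
    have ea: "e * a i = (\<Sum>j<n. M $$ (i,j) * a j)" if "i < n" for i
    proof -
      have "Matrix.vec_index (M *\<^sub>v v) i = (\<Sum>j<n. M $$ (i,j) * a j)"
        using that M v(1) by (auto simp: scalar_prod_def a_def atLeast0LessThan intro!: sum.cong)
      then show ?thesis using v(3) v(1) that by (simp add: a_def)
    qed
    have "e * (\<Sum>i<n. cnj (a i) * a i) = (\<Sum>i<n. cnj (a i) * (\<Sum>j<n. M $$ (i,j) * a j))"
      unfolding sum_distrib_left[of e]
    proof (intro sum.cong refl)
      fix i assume "i \<in> {..<n}"
      then show "e * (cnj (a i) * a i) = cnj (a i) * (\<Sum>j<n. M $$ (i,j) * a j)"
        using ea[of i] by (metis lessThan_iff mult.left_commute)
    qed
    also have "\<dots> = (\<Sum>i<n. \<Sum>j<n. \<Sum>k<n. cnj (C $$ (k,i)) * cnj (a i) * (C $$ (k,j) * a j))"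
      by (auto simp: Mij sum_distrib_left sum_distrib_right mult_ac intro!: sum.cong)
    also have "\<dots> = (\<Sum>i<n. \<Sum>k<n. \<Sum>j<n. cnj (C $$ (k,i)) * cnj (a i) * (C $$ (k,j) * a j))"
      by (intro sum.cong refl sum.swap)
    also have "\<dots> = (\<Sum>k<n. \<Sum>i<n. \<Sum>j<n. cnj (C $$ (k,i)) * cnj (a i) * (C $$ (k,j) * a j))"
      by (rule sum.swap)
    also have "\<dots> = (\<Sum>k<n. cnj (w k) * w k)"
      unfolding w_def by (auto simp: sum_product intro!: sum.cong)
    finally have eq: "e * complex_of_real (\<Sum>i<n. (cmod (a i))\<^sup>2) = complex_of_real (\<Sum>k<n. (cmod (w k))\<^sup>2)"
      by (simp add: complex_norm_square mult.commute del: of_real_power)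
    have pos: "(\<Sum>i<n. (cmod (a i))\<^sup>2) > 0"
    proof -
      obtain i where "i < n" "a i \<noteq> 0" using v(1,2) by (auto simp: a_def vec_eq_iff)
      then show ?thesis by (intro sum_pos2[of _ i]) auto
    qed
    have "e = complex_of_real ((\<Sum>k<n. (cmod (w k))\<^sup>2) / (\<Sum>i<n. (cmod (a i))\<^sup>2))"
      using eq pos by (simp add: field_simps del: of_real_sum)
    then show ?thesis using pos
      by (metis Re_complex_of_real Reals_of_real divide_nonneg_pos sum_nonneg zero_le_power2)
  qed
  have tr: "(\<Sum>i<n. M $$ (i,i)) = complex_of_real (\<Sum>i<n. \<Sum>j<n. (cmod (C $$ (i,j)))\<^sup>2)"
  proof -
    have "(\<Sum>i<n. M $$ (i,i)) = (\<Sum>i<n. \<Sum>k<n. complex_of_real ((cmod (C $$ (k,i)))\<^sup>2))"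
      by (intro sum.cong refl) (simp add: Mij complex_norm_square mult.commute del: of_real_power)
    also have "\<dots> = (\<Sum>k<n. \<Sum>i<n. complex_of_real ((cmod (C $$ (k,i)))\<^sup>2))"
      by (rule sum.swap)
    finally show ?thesis by simp
  qed
  note re = prod_list_sum_list_of_real[of es, OF ev]
  have "complex_of_real ((cmod (Determinant.det C))\<^sup>2) = complex_of_real (prod_list (map Re es))"
    using detM det_es re by simp
  then have "(cmod (Determinant.det C))\<^sup>2 = prod_list (map Re es)"
    by (simp only: of_real_eq_iff)
  moreover have "complex_of_real (sum_list (map Re es))
      = complex_of_real (\<Sum>i<n. \<Sum>j<n. (cmod (C $$ (i,j)))\<^sup>2)"
    using tr_es tr re by simp
  then have "sum_list (map Re es) = (\<Sum>i<n. \<Sum>j<n. (cmod (C $$ (i,j)))\<^sup>2)"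
    by (simp only: of_real_eq_iff)
  ultimately show ?thesis
    using prod_list_le_exp_sum_list[of "map Re es"] ev es(2) by auto
qed

text \<open>The matrix factors into a block upper triangular one, with the Schur complement in its
  corner, and a unit lower triangular one. This is the algebraic counterpart of integrating out the
  last coordinate in \<open>gauss_prod_integral_exp_quad\<close>.\<close>

lemma det_schur_complement_last:
  fixes f :: "nat \<Rightarrow> nat \<Rightarrow> 'a::field"
  assumes s: "f N N \<noteq> 0"
  shows "Determinant.det (Matrix.mat (Suc N) (Suc N) (\<lambda>(i,j). f i j))
       = f N N * Determinant.det (Matrix.mat N N (\<lambda>(i,j). f i j - f i N * f N j / f N N))"
proof -
  define S where "S = Matrix.mat N N (\<lambda>(i,j). f i j - f i N * f N j / f N N)"
  define b where "b = Matrix.mat N 1 (\<lambda>(i,j). f i N)"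
  define r where "r = Matrix.mat 1 N (\<lambda>(i,j). f N j / f N N)"
  define s' where "s' = Matrix.mat 1 1 (\<lambda>_. f N N)"
  have c: "S \<in> carrier_mat N N" "b \<in> carrier_mat N 1" "r \<in> carrier_mat 1 N" "s' \<in> carrier_mat 1 1"
    by (auto simp: S_def b_def r_def s'_def)
  let ?U = "four_block_mat S b (0\<^sub>m 1 N) s'" and ?L = "four_block_mat (1\<^sub>m N) (0\<^sub>m N 1) r (1\<^sub>m 1)"
  have "?U * ?L = four_block_mat (S * 1\<^sub>m N + b * r) (S * 0\<^sub>m N 1 + b * 1\<^sub>m 1)
      (0\<^sub>m 1 N * 1\<^sub>m N + s' * r) (0\<^sub>m 1 N * 0\<^sub>m N 1 + s' * 1\<^sub>m 1)"
    using c by (intro mult_four_block_mat) auto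
  also have "\<dots> = Matrix.mat (Suc N) (Suc N) (\<lambda>(i,j). f i j)"
    using c s by (intro eq_matI)
      (auto simp: S_def b_def r_def s'_def scalar_prod_def less_Suc_eq four_block_mat_def Let_def)
  finally have "Determinant.det (Matrix.mat (Suc N) (Suc N) (\<lambda>(i,j). f i j))
      = Determinant.det ?U * Determinant.det ?L"
    using det_mult[of ?U "N + 1" ?L] four_block_carrier_mat[OF c(1) c(4)]
      four_block_carrier_mat[of "1\<^sub>m N" N N "1\<^sub>m 1" 1 1] by (metis one_carrier_mat)
  also have "Determinant.det ?U = Determinant.det S * Determinant.det s'"
    using c by (intro det_four_block_mat_lower_left_zero[of _ N _ 1]) auto
  also have "Determinant.det ?L = Determinant.det (1\<^sub>m N) * Determinant.det (1\<^sub>m 1)"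
    using c by (intro det_four_block_mat_upper_right_zero[of _ N _ 1]) auto
  also have "Determinant.det s' = f N N" by (subst det_single) (auto simp: s'_def)
  finally show ?thesis by (simp add: S_def)
qed

section \<open>Gaussian integrals\<close>

text \<open>Completing the square turns the integrand into a multiple of the normal density with
  mean \<open>- b / (1 + q)\<close> and variance \<open>1 / (1 + q)\<close>.\<close>

lemma std_normal_integral_exp_quadratic:
  fixes q b :: real
  assumes q: "0 \<le> q"
  shows "(LINT z|std_normal_distribution. exp (- (q * z\<^sup>2) / 2 - b * z))
       = exp (b\<^sup>2 / (2 * (1 + q))) / sqrt (1 + q)"
proof -
  define s where "s = 1 / sqrt (1 + q)"
  have s: "s > 0" "s\<^sup>2 = 1 / (1 + q)" using q by (auto simp: s_def power_divide)
  have q1: "1 + q > 0" using q by simp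
  let ?m = "- b / (1 + q)"
  have eq: "std_normal_density z * exp (- (q * z\<^sup>2) / 2 - b * z)
      = exp (b\<^sup>2 / (2 * (1 + q))) / sqrt (1 + q) * normal_density ?m s z" for z
  proof -
    have "- z\<^sup>2 / 2 + (- (q * z\<^sup>2) / 2 - b * z) = b\<^sup>2 / (2 * (1 + q)) - (z - ?m)\<^sup>2 / (2 * s\<^sup>2)"
    proof -
      define a where "a = 1 + q"
      have "a > 0" using q1 by (simp add: a_def)
      then have "(z - (- b / a))\<^sup>2 / (2 * (1 / a)) = a * z\<^sup>2 / 2 + b * z + b\<^sup>2 / (2 * a)"
        by (simp add: field_simps power2_eq_square)
      then show ?thesis unfolding s(2) a_def by (simp add: field_simps)
    qed
    then have "exp (- z\<^sup>2 / 2) * exp (- (q * z\<^sup>2) / 2 - b * z)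
        = exp (b\<^sup>2 / (2 * (1 + q))) * exp (- (z - ?m)\<^sup>2 / (2 * s\<^sup>2))"
      by (simp add: exp_add[symmetric])
    moreover have "sqrt (2 * pi * s\<^sup>2) = sqrt (2 * pi) / sqrt (1 + q)"
      unfolding s(2) by (simp add: real_sqrt_divide real_sqrt_mult)
    ultimately show ?thesis using q1
      unfolding std_normal_density_def normal_density_def by (simp add: field_simps)
  qed
  have "(LINT z|std_normal_distribution. exp (- (q * z\<^sup>2) / 2 - b * z))
      = (LINT z|lborel. std_normal_density z * exp (- (q * z\<^sup>2) / 2 - b * z))"
    by (subst integral_density) (auto simp: normal_density_nonneg)
  also have "\<dots> = exp (b\<^sup>2 / (2 * (1 + q))) / sqrt (1 + q) * (LINT z|lborel. normal_density ?m s z)"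
    unfolding eq by (rule integral_mult_right_zero)
  also have "(LINT z|lborel. normal_density ?m s z) = 1"
    using s by (simp add: integral_normal_density)
  finally show ?thesis by simp
qed

section \<open>Gaussian vectors and quadratic forms\<close>

definition gauss_prod :: "nat \<Rightarrow> (nat \<Rightarrow> real) measure" where
  "gauss_prod N = PiM {..<N} (\<lambda>_. std_normal_distribution)"

lemma prob_space_gauss_prod: "prob_space (gauss_prod N)"
  unfolding gauss_prod_def
  by (intro prob_space_PiM) (rule real_dist_normal_dist[THEN real_distribution.axioms(1)])

lemma coordinate_measurable_gauss_prod [measurable]:
  "k < N \<Longrightarrow> (\<lambda>z. z k) \<in> borel_measurable (gauss_prod N)"
proof -
  assume "k < N"
  then have "(\<lambda>z. z k) \<in> measurable (gauss_prod N) std_normal_distribution"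
    unfolding gauss_prod_def by (intro measurable_component_singleton) auto
  then show ?thesis by simp
qed

definition quad :: "nat \<Rightarrow> (nat \<Rightarrow> nat \<Rightarrow> real) \<Rightarrow> (nat \<Rightarrow> real) \<Rightarrow> real" where
  "quad N Q z = (\<Sum>i<N. \<Sum>j<N. Q i j * z i * z j)"

lemma borel_measurable_quad [measurable]: "quad N Q \<in> borel_measurable (gauss_prod N)"
  unfolding quad_def by (intro borel_measurable_sum borel_measurable_times) measurable

lemma quad_Suc:
  assumes "\<And>i. i < N \<Longrightarrow> Q i N = Q N i"
  shows "quad (Suc N) Q z = quad N Q z + 2 * (\<Sum>i<N. Q i N * z i) * z N + Q N N * (z N)\<^sup>2"
  using assms
  by (simp add: quad_def sum.distrib sum_distrib_left sum_distrib_right algebra_simps power2_eq_square)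

lemma quad_cong: "(\<And>i. i < N \<Longrightarrow> z i = y i) \<Longrightarrow> quad N Q z = quad N Q y"
  unfolding quad_def by (intro sum.cong refl) auto

lemma quad_rank_one_update:
  "quad N (\<lambda>i j. Q i j - b i * c j / d) z = quad N Q z - (\<Sum>i<N. b i * z i) * (\<Sum>j<N. c j * z j) / d"
  unfolding quad_def sum_product sum_divide_distrib sum_subtractf[symmetric]
  by (intro sum.cong refl) (simp add: algebra_simps)

text \<open>Induction on the dimension. Integrating out the last coordinate replaces
  \<open>Q\<close> by the Schur complement \<open>Q'\<close> of the pivot \<open>1 + q\<close> and
  contributes the factor \<open>1 / sqrt (1 + q)\<close>; the determinant splits off the same pivot.
  As every pivot is at least 1, so is the determinant.\<close>

lemma gauss_prod_integral_exp_quad: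
  assumes sym: "\<And>i j. i < N \<Longrightarrow> j < N \<Longrightarrow> Q i j = Q j i"
    and psd: "\<And>z. 0 \<le> quad N Q z"
  shows "1 \<le> Determinant.det (Matrix.mat N N (\<lambda>(i,j). (if i = j then 1 else 0) + Q i j)) \<and>
    (LINT z|gauss_prod N. exp (- quad N Q z / 2))
      = 1 / sqrt (Determinant.det (Matrix.mat N N (\<lambda>(i,j). (if i = j then 1 else 0) + Q i j)))"
  using assms
proof (induction N arbitrary: Q)
  case 0
  have "Determinant.det (Matrix.mat 0 0 (\<lambda>(i,j). (if i = j then 1 else 0) + Q i j)) = 1"
    by (rule det_dim_zero) auto
  then show ?case using prob_space.prob_space[OF prob_space_gauss_prod[of 0]]
    by (simp add: quad_def)
next
  case (Suc N)
  interpret pr: prob_space "gauss_prod N" by (rule prob_space_gauss_prod)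
  interpret prS: prob_space "gauss_prod (Suc N)" by (rule prob_space_gauss_prod)
  interpret ps: product_sigma_finite "\<lambda>_::nat. std_normal_distribution"
    by (simp add: product_sigma_finite_def prob_space_imp_sigma_finite prob_space_normal_density)
  define q where "q = Q N N"
  define b where "b z = (\<Sum>i<N. Q i N * z i)" for z
  define Q' where "Q' i j = Q i j - Q i N * Q N j / (1 + q)" for i j
  have sN: "i < N \<Longrightarrow> Q i N = Q N i" for i using Suc.prems(1) by auto
  have qS: "quad (Suc N) Q z = quad N Q z + 2 * b z * z N + q * (z N)\<^sup>2" for z
    using quad_Suc[of N Q z] sN by (simp add: b_def q_def)
  have q0: "0 \<le> q"
  proof -
    have "quad (Suc N) Q (\<lambda>i. if i = N then 1 else 0) = q"
      unfolding qS by (simp add: quad_def b_def)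
    then show ?thesis using Suc.prems(2) by metis
  qed
  have Q': "quad N Q' z = quad N Q z - (b z)\<^sup>2 / (1 + q)" for z
    unfolding Q'_def quad_rank_one_update b_def power2_eq_square by (simp add: sN)
  have upd: "quad N Q (z(N := y)) = quad N Q z" "b (z(N := y)) = b z" for z y
    by (rule quad_cong) (auto simp: b_def)
  have psd': "0 \<le> quad N Q' z" for z
  proof -
    \<comment> \<open>The minimizer of \<open>2 * b z * y + (1 + q) * y\<^sup>2\<close>, whose
      minimum is exactly the correction in \<open>Q'\<close>. Raising \<open>q\<close> to
      \<open>1 + q\<close> only enlarges the nonnegative value of the form at this point.\<close>
    let ?y = "- b z / (1 + q)"
    have "0 \<le> quad (Suc N) Q (z(N := ?y))" using Suc.prems(2) .
    also have "\<dots> = quad N Q z + 2 * b z * ?y + q * ?y\<^sup>2"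
      unfolding qS upd by simp
    also have "\<dots> \<le> quad N Q z + 2 * b z * ?y + (1 + q) * ?y\<^sup>2" by (simp add: algebra_simps)
    also have "\<dots> = quad N Q' z"
    proof -
      have "2 * t * (- t / a) + a * (- t / a)\<^sup>2 = - t\<^sup>2 / a" if "a > 0" for t a :: real
        using that by (simp add: power2_eq_square)
      from this[of "1 + q" "b z"] show ?thesis unfolding Q' using q0 by simp
    qed
    finally show ?thesis .
  qed
  have sym': "Q' i j = Q' j i" if "i < N" "j < N" for i j
    using that Suc.prems(1) sN[of i] sN[of j] unfolding Q'_def by (simp add: mult.commute)
  note IH = Suc.IH[of Q', OF sym' psd']
  let ?d = "\<lambda>N Q. Determinant.det (Matrix.mat N N (\<lambda>(i,j). (if i = j then 1 else 0) + Q i j :: real))"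
  have det: "?d (Suc N) Q = (1 + q) * ?d N Q'"
  proof -
    have "?d (Suc N) Q = (1 + q) * Determinant.det (Matrix.mat N N (\<lambda>(i,j).
        ((if i = j then 1 else 0) + Q i j) - ((if i = N then 1 else 0) + Q i N) * ((if N = j then 1 else 0) + Q N j)
        / ((if N = N then 1 else 0) + Q N N)))"
      using det_schur_complement_last[of "\<lambda>i j. (if i = j then 1 else 0) + Q i j" N] q0
      by (simp add: q_def)
    also have "(Matrix.mat N N (\<lambda>(i,j).
        ((if i = j then 1 else 0) + Q i j) - ((if i = N then 1 else 0) + Q i N) * ((if N = j then 1 else 0) + Q N j)
        / ((if N = N then 1 else 0) + Q N N))) = Matrix.mat N N (\<lambda>(i,j). (if i = j then 1 else 0) + Q' i j)"
      by (intro eq_matI) (auto simp: Q'_def q_def)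
    finally show ?thesis .
  qed
  have "1 * 1 \<le> (1 + q) * ?d N Q'" using IH q0 by (intro mult_mono) auto
  then have ge1: "1 \<le> ?d (Suc N) Q" using det by simp
  have int: "integrable (gauss_prod (Suc N)) (\<lambda>z. exp (- quad (Suc N) Q z / 2))"
    using Suc.prems(2) by (intro prS.integrable_const_bound[where B = 1]) auto
  have "(LINT z|gauss_prod (Suc N). exp (- quad (Suc N) Q z / 2))
     = (LINT z|gauss_prod N. LINT y|std_normal_distribution. exp (- quad (Suc N) Q (z(N := y)) / 2))"
    using int unfolding gauss_prod_def lessThan_Suc
    by (intro ps.product_integral_insert) auto
  also have "\<dots> = (LINT z|gauss_prod N. exp (- quad N Q z / 2) *
      (LINT y|std_normal_distribution. exp (- (q * y\<^sup>2) / 2 - b z * y)))"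
    unfolding qS upd integral_mult_right_zero[symmetric] exp_add[symmetric]
    by (intro Bochner_Integration.integral_cong refl arg_cong[where f = exp]) (simp add: field_simps)
  also have "\<dots> = (LINT z|gauss_prod N. exp (- quad N Q' z / 2) * (1 / sqrt (1 + q)))"
  proof -
    have "exp (- t / 2) * (exp (u / (2 * c)) / d) = exp (- (t - u / c) / 2) * (1 / d)" for t u c d :: real
    proof -
      have "- t / 2 + u / (2 * c) = - (t - u / c) / 2" by (simp add: diff_divide_distrib)
      then show ?thesis by (metis exp_add mult.assoc times_divide_eq_right mult.right_neutral)
    qed
    then show ?thesis unfolding std_normal_integral_exp_quadratic[OF q0] Q' by presburger
  qed
  also have "\<dots> = 1 / sqrt (?d (Suc N) Q)"
    using IH q0 by (simp add: det real_sqrt_mult)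
  finally show ?case using ge1 by blast
qed

text \<open>Since \<open>exp (-y\<^sup>2/2) = E cos (Z y)\<close> for a standard normal \<open>Z\<close>, the Laplace transform of a sum of
  squares is a Gaussian average of characteristic functions.\<close>
lemma (in prob_space) laplace_sum_squares:
  fixes Y :: "nat \<Rightarrow> 'a \<Rightarrow> real"
  assumes Y [measurable]: "\<And>k. k < N \<Longrightarrow> Y k \<in> borel_measurable M"
    and char: "\<And>\<theta>. (LINT \<omega>|M. cos (\<Sum>k<N. \<theta> k * Y k \<omega>)) = exp (- quad N Q \<theta> / 2)"
    and sym: "\<And>i j. i < N \<Longrightarrow> j < N \<Longrightarrow> Q i j = Q j i"
  shows "1 \<le> Determinant.det (Matrix.mat N N (\<lambda>(i,j). (if i = j then 1 else 0) + Q i j))"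
    and "(LINT \<omega>|M. exp (- (\<Sum>k<N. (Y k \<omega>)\<^sup>2) / 2))
      = 1 / sqrt (Determinant.det (Matrix.mat N N (\<lambda>(i,j). (if i = j then 1 else 0) + Q i j)))"
proof -
  \<comment> \<open>Semidefiniteness is hidden in \<open>char\<close>: an average of cosines is at
    most 1, so the exponent on the right cannot be positive.\<close>
  have psd: "0 \<le> quad N Q \<theta>" for \<theta>
  proof -
    have "(LINT \<omega>|M. cos (\<Sum>k<N. \<theta> k * Y k \<omega>)) \<le> (LINT \<omega>|M. 1)"
      by (intro integral_mono integrable_const_bound[where B = 1]) auto
    then show ?thesis unfolding char by (simp add: prob_space)
  qed
  interpret g: prob_space "gauss_prod N" by (rule prob_space_gauss_prod)
  interpret gM: pair_prob_space "gauss_prod N" M ..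
  have cosZ: "(LINT z|gauss_prod N. cos (\<Sum>k<N. z k * y k)) = exp (- (\<Sum>k<N. (y k)\<^sup>2) / 2)" for y
  proof -
    \<comment> \<open>The factors are the one-dimensional characters, so their product integrates to
      the product of standard normal characteristic functions. The cosine average is the real
      part.\<close>
    define f where "f k z = (if k < N then exp (\<i> * complex_of_real (y k) * complex_of_real z) else 1)" for k z
    interpret ps: product_sigma_finite "\<lambda>_::nat. std_normal_distribution"
      by (simp add: product_sigma_finite_def prob_space_imp_sigma_finite prob_space_normal_density)
    interpret n: prob_space std_normal_distribution by (rule prob_space_normal_density) simp
    have if': "integrable std_normal_distribution (f k)" if "k < N" for k
      using that unfolding f_def
      by (intro n.integrable_const_bound[where B = 1]) (auto simp: norm_exp_eq_Re)
    have fk: "(LINT z|std_normal_distribution. f k z) = exp (- (y k)\<^sup>2 / 2)" if "k < N" for k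
      using that fun_cong[OF char_std_normal_distribution, of "y k"]
      by (simp add: f_def char_def mult.assoc)
    have "(LINT z|gauss_prod N. (\<Prod>k<N. f k (z k))) = (\<Prod>k<N. complex_of_real (exp (- (y k)\<^sup>2 / 2)))"
      unfolding gauss_prod_def using if' fk by (subst ps.product_integral_prod) auto
    also have "\<dots> = complex_of_real (exp (- (\<Sum>k<N. (y k)\<^sup>2) / 2))"
      by (simp only: of_real_prod[symmetric] exp_sum[symmetric] finite_lessThan)
        (simp add: sum_negf sum_divide_distrib)
    finally have e: "(LINT z|gauss_prod N. (\<Prod>k<N. f k (z k))) = complex_of_real (exp (- (\<Sum>k<N. (y k)\<^sup>2) / 2))" .
    have prodf: "(\<Prod>k<N. f k (z k)) = cis (\<Sum>k<N. z k * y k)" for z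
      unfolding f_def cis_conv_exp
      by (simp add: exp_sum[symmetric] sum_distrib_left mult_ac)
    have "integrable (gauss_prod N) (\<lambda>z. cis (\<Sum>k<N. z k * y k))"
      unfolding prodf[symmetric] f_def
      by (intro g.integrable_const_bound[where B = 1]) (auto simp: norm_exp_eq_Re prod_norm[symmetric] intro!: borel_measurable_prod)
    then have "Re (LINT z|gauss_prod N. cis (\<Sum>k<N. z k * y k)) = (LINT z|gauss_prod N. cos (\<Sum>k<N. z k * y k))"
      by (subst integral_Re[symmetric]) auto
    then show ?thesis using e unfolding prodf by simp
  qed
  have [measurable]: "(\<lambda>(z, \<omega>). cos (\<Sum>k<N. z k * Y k \<omega>)) \<in> borel_measurable (gauss_prod N \<Otimes>\<^sub>M M)"
    unfolding case_prod_beta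
    by (intro measurable_compose[OF _ borel_measurable_cos] borel_measurable_sum borel_measurable_times)
       (auto intro: measurable_compose[OF measurable_fst] measurable_compose[OF measurable_snd])
  have int: "integrable (gauss_prod N \<Otimes>\<^sub>M M) (\<lambda>(z, \<omega>). cos (\<Sum>k<N. z k * Y k \<omega>))"
    by (intro gM.integrable_const_bound[where B = 1]) auto
  have "(LINT \<omega>|M. exp (- (\<Sum>k<N. (Y k \<omega>)\<^sup>2) / 2))
      = (LINT \<omega>|M. LINT z|gauss_prod N. cos (\<Sum>k<N. z k * Y k \<omega>))"
    unfolding cosZ ..
  also have "\<dots> = (LINT z|gauss_prod N. LINT \<omega>|M. cos (\<Sum>k<N. z k * Y k \<omega>))"
    using gM.Fubini_integral[OF int] by simp
  also have "\<dots> = (LINT z|gauss_prod N. exp (- quad N Q z / 2))"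
    unfolding char ..
  finally show "(LINT \<omega>|M. exp (- (\<Sum>k<N. (Y k \<omega>)\<^sup>2) / 2))
      = 1 / sqrt (Determinant.det (Matrix.mat N N (\<lambda>(i,j). (if i = j then 1 else 0) + Q i j)))"
    using gauss_prod_integral_exp_quad[OF sym psd] by simp
  show "1 \<le> Determinant.det (Matrix.mat N N (\<lambda>(i,j). (if i = j then 1 else 0) + Q i j))"
    using gauss_prod_integral_exp_quad[OF sym psd] by simp
qed

declare coordinate_measurable_gauss_prod [measurable del]

section \<open>Discretized Fredholm determinants\<close>

text \<open>On each cell the mean value theorem for the antiderivative writes the integral as
  \<open>h * g \<xi>\<close>, and uniform continuity compares \<open>g \<xi>\<close> with the value
  at the left endpoint.\<close>

lemma riemann_sum_tendsto:
  fixes g :: "real \<Rightarrow> real"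
  assumes x: "0 < x" and g: "continuous_on {0..x} g"
  shows "(\<lambda>N. x / real N * (\<Sum>k<N. g (x * real k / real N))) \<longlonglongrightarrow> (LBINT y:{0..x}. g y)"
proof (rule LIMSEQ_I)
  fix e :: real assume e: "0 < e"
  \<comment> \<open>An error per unit length: over the total length \<open>x\<close> it adds up to
    \<open>e / 2\<close>, which leaves room for the strict inequality.\<close>
  define e' where "e' = e / (2 * x)"
  have e': "e' > 0" using e x by (simp add: e'_def)
  define G where "G t = integral {0..t} g" for t
  have "set_integrable lborel {0..x} g" using g by (rule borel_integrable_atLeastAtMost')
  then have int: "(LBINT y:{0..x}. g y) = G x - G 0"
    by (simp add: set_borel_integral_eq_integral G_def)
  have dG: "(G has_real_derivative g t) (at t within {0..x})" if "t \<in> {0..x}" for t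
    unfolding G_def using integral_has_real_derivative[OF g that] .
  obtain d where d: "d > 0" "\<And>s t. s \<in> {0..x} \<Longrightarrow> t \<in> {0..x} \<Longrightarrow> \<bar>s - t\<bar> < d \<Longrightarrow> \<bar>g s - g t\<bar> < e'"
    using compact_uniformly_continuous[OF g] e' unfolding uniformly_continuous_on_def dist_real_def
    by (metis compact_Icc)
  obtain N0 where N0: "N0 > 0" "x / real N0 < d"
    using d(1) x real_arch_inverse[of "d / x"] by (auto simp: field_simps)
  have "norm (x / real N * (\<Sum>k<N. g (x * real k / real N)) - (LBINT y:{0..x}. g y)) < e" if N: "N \<ge> N0" for N
  proof -
    define h where "h = x / real N"
    have N': "N > 0" using N N0 by auto
    have h: "h > 0" using N' x by (simp add: h_def)
    have "h \<le> x / real N0" unfolding h_def using N N0(1) x by (intro divide_left_mono) auto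
    then have hd: "h < d" using N0(2) by simp
    have kh: "x * real k / real N = real k * h" for k by (simp add: h_def)
    have Nh: "real N * h = x" using N' by (simp add: h_def)
    have *: "\<bar>h * g (real k * h) - (G (real (Suc k) * h) - G (real k * h))\<bar> \<le> h * e'" if k: "k < N" for k
    proof -
      have le: "real (Suc k) * h \<le> x" "0 \<le> real k * h"
        using k h Nh mult_right_mono[of "real (Suc k)" "real N" h] by auto
      have "\<exists>\<xi>\<in>{real k * h<..<real (Suc k) * h}. G (real (Suc k) * h) - G (real k * h)
          = g \<xi> * (real (Suc k) * h - real k * h)"
      proof (rule mvt_simple)
        show "real k * h < real (Suc k) * h" using h by simp
        fix t assume t: "real k * h \<le> t" "t \<le> real (Suc k) * h"
        then have "(G has_real_derivative g t) (at t within {0..x})" using le by (intro dG) auto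
        then have "(G has_real_derivative g t) (at t within {real k * h..real (Suc k) * h})"
          by (rule DERIV_subset) (use le in auto)
        then show "(G has_derivative (*) (g t)) (at t within {real k * h..real (Suc k) * h})"
          by (simp add: has_field_derivative_def)
      qed
      then obtain \<xi> where \<xi>: "real k * h < \<xi>" "\<xi> < real (Suc k) * h"
        "G (real (Suc k) * h) - G (real k * h) = g \<xi> * h" by (auto simp: algebra_simps)
      have "0 \<le> \<xi>" using \<xi>(1) le(2) by linarith
      moreover have "\<xi> \<le> x" "real k * h \<le> x" "\<bar>real k * h - \<xi>\<bar> < d"
        using \<xi>(1,2) le(1) hd by (simp_all add: distrib_right)
      ultimately have "\<bar>g (real k * h) - g \<xi>\<bar> < e'"
        using le(2) by (intro d(2)) simp_all
      then have "\<bar>h * (g (real k * h) - g \<xi>)\<bar> \<le> h * e'"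
        using h by (simp add: abs_mult)
      then show ?thesis unfolding \<xi>(3) by (simp add: algebra_simps)
    qed
    have "G x - G 0 = (\<Sum>k<N. G (real (Suc k) * h) - G (real k * h))"
      using sum_lessThan_telescope[of "\<lambda>k. G (real k * h)" N] Nh by simp
    then have "\<bar>h * (\<Sum>k<N. g (real k * h)) - (G x - G 0)\<bar>
        = \<bar>\<Sum>k<N. h * g (real k * h) - (G (real (Suc k) * h) - G (real k * h))\<bar>"
      by (simp add: sum_distrib_left sum_subtractf)
    also have "\<dots> \<le> (\<Sum>k<N. h * e')"
      using * by (intro order_trans[OF sum_abs] sum_mono) auto
    also have "\<dots> = e / 2" using Nh x by (simp add: e'_def field_simps)
    also have "\<dots> < e" using e by simp
    finally show ?thesis unfolding int kh h_def[symmetric] by simp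
  qed
  then show "\<exists>N0. \<forall>N\<ge>N0. norm (x / real N * (\<Sum>k<N. g (x * real k / real N)) - (LBINT y:{0..x}. g y)) < e"
    by blast
qed

section \<open>The covariance kernel and its entire extension\<close>

text \<open>\<open>x * cov_kernel (x * s) (x * t) p\<close> for \<open>x \<ge> 0\<close>, in a form which is entire in \<open>x\<close>.\<close>
definition scaled_kernel :: "real \<Rightarrow> real \<Rightarrow> real \<Rightarrow> 'b::{real_normed_field,banach} \<Rightarrow> 'b" where
  "scaled_kernel s t p x = (if p = 0 then of_real (min s t) * x\<^sup>2
     else x * (exp (of_real (p * (s + t)) * x) - exp (of_real (p * \<bar>s - t\<bar>) * x)) / of_real (2 * p))"

definition scaled_cov :: "real ^ 'n \<Rightarrow> real ^ 'n \<Rightarrow> real \<Rightarrow> real \<Rightarrow> 'b::{real_normed_field,banach} \<Rightarrow> 'b" where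
  "scaled_cov c p s t x = (\<Sum>j\<in>UNIV. of_real ((c $ j)\<^sup>2) * scaled_kernel s t (p $ j) x)"

text \<open>The mesh lives in \<open>[0,1]\<close> and is scaled by \<open>x\<close>. Hence the
  absolute value in the kernel falls on fixed numbers \<open>s - t\<close> and the variable enters
  analytically. The polymorphic type gives the real determinant and its complex extension by one
  formula.\<close>

definition disc_det :: "real ^ 'n \<Rightarrow> real ^ 'n \<Rightarrow> nat \<Rightarrow> 'b::{real_normed_field,banach} \<Rightarrow> 'b" where
  "disc_det c p N x = Determinant.det (Matrix.mat N N (\<lambda>(k,l).
     (if k = l then 1 else 0) + scaled_cov c p (real k / real N) (real l / real N) x / of_nat N))"

lemma scaled_kernel_eq_cov_kernel:
  assumes "0 \<le> x"
  shows "x * cov_kernel (x * s) (x * t) p = scaled_kernel s t p (x::real)"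
proof -
  have "\<bar>x * s - x * t\<bar> = x * \<bar>s - t\<bar>" "min (x * s) (x * t) = x * min s t"
    using assms by (simp_all add: right_diff_distrib[symmetric] abs_mult min_mult_distrib_left)
  moreover have "p * (x * s + x * t) = p * (s + t) * x" "p * (x * \<bar>s - t\<bar>) = p * \<bar>s - t\<bar> * x"
    by (simp_all add: algebra_simps)
  ultimately have "cov_kernel (x * s) (x * t) p
      = (if p = 0 then x * min s t else (exp (p * (s + t) * x) - exp (p * \<bar>s - t\<bar> * x)) / (2 * p))"
    unfolding cov_kernel_def by metis
  then show ?thesis
    by (cases "p = 0") (simp_all add: scaled_kernel_def power2_eq_square)
qed

text \<open>The signs cancel in every exponent and in the quotient \<open>x / (2 * p)\<close>; for
  \<open>p = 0\<close> the factor \<open>x\<^sup>2\<close> is even.\<close>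

lemma scaled_kernel_uminus: "scaled_kernel s t (- p) (- x) = scaled_kernel s t p x"
  by (auto simp: scaled_kernel_def)

lemma disc_det_uminus: "disc_det c (- p) N (- x) = disc_det c p N x"
  by (simp add: disc_det_def scaled_cov_def scaled_kernel_uminus)

lemma scaled_cov_of_real: "scaled_cov c p s t (complex_of_real x) = complex_of_real (scaled_cov c p s t x)"
  by (auto simp: scaled_cov_def scaled_kernel_def exp_of_real[symmetric] intro!: sum.cong)

lemma disc_det_of_real: "disc_det c p N (complex_of_real x) = complex_of_real (disc_det c p N x)"
proof -
  show ?thesis unfolding disc_det_def of_real_hom.hom_det[symmetric]
    by (intro arg_cong[where f = Determinant.det] eq_matI) (auto simp: scaled_cov_of_real)
qed

lemma holomorphic_on_scaled_kernel: "scaled_kernel s t p holomorphic_on S"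
  unfolding scaled_kernel_def by (cases "p = 0") (auto intro!: holomorphic_intros)

lemma holomorphic_on_det:
  assumes "\<And>i j. i < n \<Longrightarrow> j < n \<Longrightarrow> (\<lambda>z. f i j z) holomorphic_on S"
  shows "(\<lambda>z. Determinant.det (Matrix.mat n n (\<lambda>(i,j). f i j z))) holomorphic_on S"
proof -
  have "(\<lambda>z. \<Sum>q\<in>{q. q permutes {0..<n}}. of_int (sign q) * (\<Prod>i=0..<n. f i (q i) z)) holomorphic_on S"
    using assms by (intro holomorphic_on_sum holomorphic_on_mult holomorphic_on_const holomorphic_on_prod)
      (auto simp: permutes_in_image dest: permutes_in_image[THEN iffD2])
  moreover have "Determinant.det (Matrix.mat n n (\<lambda>(i,j). f i j z))
      = (\<Sum>q\<in>{q. q permutes {0..<n}}. of_int (sign q) * (\<Prod>i=0..<n. f i (q i) z))" for z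
    unfolding Determinant.det_def by (auto simp: permutes_in_image intro!: sum.cong prod.cong)
  ultimately show ?thesis by simp
qed

lemma holomorphic_on_disc_det: "disc_det c p N holomorphic_on S"
proof -
  have "(\<lambda>x. disc_det c p N x) holomorphic_on S"
    unfolding disc_det_def
  proof (rule holomorphic_on_det)
    show "(\<lambda>x. (if k = l then 1 else 0) + scaled_cov c p (real k / real N) (real l / real N) x / of_nat N)
        holomorphic_on S" if "k < N" for k l
      unfolding scaled_cov_def using that by (auto intro!: holomorphic_intros holomorphic_on_scaled_kernel)
  qed
  then show ?thesis .
qed

text \<open>One bound for two cases: for \<open>p = 0\<close> the quotient is 0 by the convention
  for division and the first summand does the work, for other \<open>p\<close> the second one does.
  The 2 in the exponent bounds \<open>s + t\<close>.\<close>

lemma norm_scaled_kernel_le: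
  assumes s: "0 \<le> s" "s \<le> 1" and t: "0 \<le> t" "t \<le> 1" and x: "cmod x \<le> r"
  shows "cmod (scaled_kernel s t p x) \<le> r\<^sup>2 + r * exp (2 * \<bar>p\<bar> * r) / \<bar>p\<bar>"
proof (cases "p = 0")
  case True
  have "min s t * (cmod x)\<^sup>2 \<le> 1 * r\<^sup>2" using s t x by (intro mult_mono power_mono) auto
  then show ?thesis using True s t by (simp add: scaled_kernel_def norm_mult norm_power)
next
  case False
  have r: "r \<ge> 0" using x norm_ge_zero[of x] by linarith
  have b: "cmod (exp (complex_of_real (p * a) * x)) \<le> exp (2 * \<bar>p\<bar> * r)" if "\<bar>a\<bar> \<le> 2" for a
  proof -
    have "\<bar>p\<bar> * \<bar>a\<bar> * cmod x \<le> \<bar>p\<bar> * 2 * r" using that x by (intro mult_mono) auto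
    then show ?thesis
      by (intro order_trans[OF norm_exp]) (simp add: norm_mult abs_mult mult_ac)
  qed
  define E where "E = exp (complex_of_real (p * (s + t)) * x) - exp (complex_of_real (p * \<bar>s - t\<bar>) * x)"
  have "cmod E \<le> 2 * exp (2 * \<bar>p\<bar> * r)"
    using add_mono[OF b[of "s + t"] b[of "\<bar>s - t\<bar>"]] s t unfolding E_def
    by (intro order_trans[OF norm_triangle_ineq4]) (simp del: norm_exp_eq_Re)
  then have "cmod x * cmod E \<le> r * (2 * exp (2 * \<bar>p\<bar> * r))"
    using x r by (intro mult_mono) auto
  then have "cmod x * cmod E / (2 * \<bar>p\<bar>) \<le> r * (2 * exp (2 * \<bar>p\<bar> * r)) / (2 * \<bar>p\<bar>)"
    by (intro divide_right_mono) auto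
  moreover have "cmod (scaled_kernel s t p x) = cmod x * cmod E / (2 * \<bar>p\<bar>)"
    using False by (simp add: scaled_kernel_def E_def norm_mult norm_divide)
  ultimately have "cmod (scaled_kernel s t p x) \<le> r * (2 * exp (2 * \<bar>p\<bar> * r)) / (2 * \<bar>p\<bar>)"
    by simp
  then show ?thesis by (rule order_trans) simp
qed

lemma disc_det_bounded: "\<exists>K. \<forall>N. \<forall>z. cmod z \<le> r \<longrightarrow> cmod (disc_det c p N z) \<le> K"
proof -
  define K where "K = (\<Sum>j\<in>UNIV. (c $ j)\<^sup>2 * (r\<^sup>2 + r * exp (2 * \<bar>p $ j\<bar> * r) / \<bar>p $ j\<bar>))"
  have K: "cmod (scaled_cov c p s t z) \<le> K"
    if "0 \<le> s" "s \<le> 1" "0 \<le> t" "t \<le> 1" "cmod z \<le> r" for s t z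
    unfolding scaled_cov_def K_def
    by (intro sum_norm_le) (auto simp: norm_mult norm_power that intro!: mult_left_mono norm_scaled_kernel_le)
  have "cmod (disc_det c p N z) \<le> sqrt (exp (2 * K + K\<^sup>2))" if z: "cmod z \<le> r" for N z
  proof (cases "N = 0")
    \<comment> \<open>The empty determinant is 1. This case is separate because the estimate of the
      entries divides by \<open>N\<close>.\<close>
    case True
    have "0 \<le> K\<^sup>2 + 2 * K" using order_trans[OF norm_ge_zero K[of 0 0 z]] z by simp
    moreover have "disc_det c p N z = 1" unfolding disc_det_def True by (rule det_dim_zero) auto
    ultimately show ?thesis by (simp add: add.commute)
  next
    case False
    define C where "C = Matrix.mat N N (\<lambda>(k,l).
     (if k = l then 1 else 0) + scaled_cov c p (real k / real N) (real l / real N) z / of_nat N)"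
    have C: "C \<in> carrier_mat N N" by (simp add: C_def)
    \<comment> \<open>The cross term \<open>2 * K / N\<close> of the square occurs on the diagonal
      only. Summation therefore gives \<open>N + 2 * K + K\<^sup>2\<close>, and the \<open>N\<close>
      disappears against the \<open>- n\<close> in \<open>norm_det_le_exp_frobenius\<close>.\<close>
    have ent: "(cmod (C $$ (i,j)))\<^sup>2 \<le> (if i = j then 1 + 2 * K / N else 0) + K\<^sup>2 / N\<^sup>2" if ij: "i < N" "j < N" for i j
    proof -
      have "cmod (scaled_cov c p (real i / real N) (real j / real N) z) \<le> K"
        using ij z by (intro K) auto
      then have "cmod (C $$ (i,j)) \<le> (if i = j then 1 else 0) + K / N"
        unfolding C_def using ij False
        by (auto simp: norm_divide divide_right_mono intro!: order_trans[OF norm_triangle_ineq] add_left_mono)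
      then have "(cmod (C $$ (i,j)))\<^sup>2 \<le> ((if i = j then 1 else 0) + K / N)\<^sup>2"
        by (intro power_mono) auto
      also have "\<dots> = (if i = j then 1 + 2 * K / N else 0) + K\<^sup>2 / N\<^sup>2"
        by (auto simp: power2_sum power_divide)
      finally show ?thesis .
    qed
    have "(\<Sum>i<N. \<Sum>j<N. (cmod (C $$ (i,j)))\<^sup>2) \<le> (\<Sum>i<N. \<Sum>j<N. (if i = j then 1 + 2 * K / N else 0) + K\<^sup>2 / N\<^sup>2)"
      using ent by (intro sum_mono) auto
    also have "\<dots> = N + 2 * K + K\<^sup>2"
      using False by (simp add: sum.distrib algebra_simps power2_eq_square)
    finally have "(cmod (disc_det c p N z))\<^sup>2 \<le> exp (2 * K + K\<^sup>2)"
      using norm_det_le_exp_frobenius[OF C] unfolding disc_det_def C_def[symmetric]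
      by (intro order_trans[OF norm_det_le_exp_frobenius[OF C]]) auto
    then show ?thesis by (intro real_le_rsqrt)
  qed
  then show ?thesis by blast
qed

text \<open>The statement identifies \<open>d\<close> at real points where the full sequence
  converges. There the subsequence supplied by Montel's theorem has the same limit, whichever
  subsequence it is.\<close>

lemma disc_det_entire_limit:
  "\<exists>d. d holomorphic_on UNIV \<and>
    (\<forall>x L. (\<lambda>N. disc_det c p N (x::real)) \<longlonglongrightarrow> L \<longrightarrow> d (complex_of_real x) = complex_of_real L)"
proof -
  obtain g r where g: "g holomorphic_on UNIV" "strict_mono (r :: nat \<Rightarrow> nat)"
    "\<And>x. x \<in> UNIV \<Longrightarrow> (\<lambda>n. disc_det c p (r n) x) \<longlonglongrightarrow> g x"
  proof (rule Montel[of UNIV "range (disc_det c p)" "disc_det c p"])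
    show "h holomorphic_on UNIV" if "h \<in> range (disc_det c p)" for h :: "complex \<Rightarrow> complex"
      using that by (auto intro: holomorphic_on_disc_det)
    show "\<exists>B. \<forall>h\<in>range (disc_det c p). \<forall>z\<in>K. cmod (h z) \<le> B" if "compact K" for K
    proof -
      have "bounded K" using \<open>compact K\<close> by (rule compact_imp_bounded)
      then obtain b where b: "\<And>z. z \<in> K \<Longrightarrow> cmod z \<le> b"
        unfolding bounded_iff by auto
      obtain B where "\<forall>N. \<forall>z. cmod z \<le> b \<longrightarrow> cmod (disc_det c p N z) \<le> B"
        using disc_det_bounded by blast
      then show ?thesis using b by auto
    qed
  qed auto
  show ?thesis
  proof (intro exI conjI allI impI)
    show "g holomorphic_on UNIV" by fact
    fix x L assume L: "(\<lambda>N. disc_det c p N (x::real)) \<longlonglongrightarrow> L"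
    have "(\<lambda>n. complex_of_real (disc_det c p (r n) x)) \<longlonglongrightarrow> complex_of_real L"
      using LIMSEQ_subseq_LIMSEQ[OF L g(2)] by (intro tendsto_of_real) (simp add: o_def)
    then show "g (complex_of_real x) = complex_of_real L"
      using g(3)[of "complex_of_real x"] unfolding disc_det_of_real by (auto intro: LIMSEQ_unique)
  qed
qed

text \<open>With a Riemann sum in the exponent the Laplace transform is exactly
  \<open>disc_det\<close> to the power -1/2; dominated convergence with the constant 1 yields the
  limit. The assumption \<open>char\<close> carries the Gaussian law, so that one statement serves
  both the coordinate process and the Ito process.\<close>

lemma (in prob_space) disc_det_tendsto_laplace:
  fixes Y :: "real \<Rightarrow> 'a \<Rightarrow> real"
  assumes x: "0 < x"
    and Y: "\<And>t. 0 \<le> t \<Longrightarrow> Y t \<in> borel_measurable M"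
    and cont: "\<And>\<omega>. \<omega> \<in> space M \<Longrightarrow> continuous_on {0..} (\<lambda>t. Y t \<omega>)"
    and char: "\<And>N \<theta>. (LINT \<omega>|M. cos (\<Sum>k<N. \<theta> k * Y (x * real k / real N) \<omega>))
      = exp (- quad N (\<lambda>k l. \<Sum>j\<in>UNIV. (c $ j)\<^sup>2 * cov_kernel (x * real k / real N) (x * real l / real N) (p $ j)) \<theta> / 2)"
  shows "0 < (LINT \<omega>|M. exp (- (1 / 2) * (LBINT y:{0..x}. (Y y \<omega>)\<^sup>2)))"
    and "(\<lambda>N. disc_det c p N x) \<longlonglongrightarrow> 1 / (LINT \<omega>|M. exp (- (1 / 2) * (LBINT y:{0..x}. (Y y \<omega>)\<^sup>2)))\<^sup>2"
proof -
  define F where "F N \<omega> = exp (- (1 / 2) * (x / real N * (\<Sum>k<N. (Y (x * real k / real N) \<omega>)\<^sup>2)))" for N \<omega>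
  define G where "G = (\<lambda>\<omega>. exp (- (1 / 2) * (LBINT y:{0..x}. (Y y \<omega>)\<^sup>2)))"
  have Fm [measurable]: "F N \<in> borel_measurable M" for N
    unfolding F_def using x Y
    by (intro borel_measurable_exp[THEN measurable_compose[rotated]] borel_measurable_times
        borel_measurable_const borel_measurable_sum borel_measurable_power) auto
  have lim: "(\<lambda>N. F N \<omega>) \<longlonglongrightarrow> G \<omega>" if "\<omega> \<in> space M" for \<omega>
    unfolding F_def G_def
    by (intro tendsto_exp tendsto_mult tendsto_const riemann_sum_tendsto[OF x, of "\<lambda>y. (Y y \<omega>)\<^sup>2"]
        continuous_on_power continuous_on_subset[OF cont[OF that]]) auto
  have Gm: "G \<in> borel_measurable M"
    using lim Fm by (rule borel_measurable_LIMSEQ_real)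
  have bound: "norm (F N \<omega>) \<le> 1" for N \<omega>
    using x by (auto simp: F_def intro!: mult_nonneg_nonneg sum_nonneg divide_nonneg_nonneg)
  have conv: "(\<lambda>N. LINT \<omega>|M. F N \<omega>) \<longlonglongrightarrow> (LINT \<omega>|M. G \<omega>)" and Gi: "integrable M G"
    using integral_dominated_convergence[where f = G and M = M and s = F and w = "\<lambda>_. 1"]
      integrable_dominated_convergence[where f = G and M = M and s = F and w = "\<lambda>_. 1"]
      Gm lim bound by auto
  have pos: "0 < (LINT \<omega>|M. G \<omega>)"
    using integral_less_AE_space[of "\<lambda>_. 0" G] Gi by (auto simp: G_def emeasure_space_1)
  then show "0 < (LINT \<omega>|M. exp (- (1 / 2) * (LBINT y:{0..x}. (Y y \<omega>)\<^sup>2)))" unfolding G_def .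
  have FN: "(LINT \<omega>|M. F N \<omega>) = 1 / sqrt (disc_det c p N x) \<and> 1 \<le> disc_det c p N x" for N
  proof -
    define h where "h = x / real N"
    have h: "0 \<le> h" using x by (simp add: h_def)
    define R where "R k l = (\<Sum>j\<in>UNIV. (c $ j)\<^sup>2 * cov_kernel (x * real k / real N) (x * real l / real N) (p $ j))" for k l
    have RR: "scaled_cov c p (real k / real N) (real l / real N) x / real N = h * R k l" for k l
    proof -
      have "scaled_kernel (real k / real N) (real l / real N) q x
          = x * cov_kernel (x * real k / real N) (x * real l / real N) q" for q
        using scaled_kernel_eq_cov_kernel[of x "real k / real N" "real l / real N" q] x by simp
      then have "scaled_cov c p (real k / real N) (real l / real N) x = x * R k l"
        unfolding scaled_cov_def R_def sum_distrib_left by (intro sum.cong refl) simp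
      then show ?thesis by (simp add: h_def)
    qed
    \<comment> \<open>The mesh width is absorbed by scaling each sample with \<open>sqrt h\<close>;
      equivalently the weights \<open>\<theta>\<close> are scaled, and the quadratic form picks up
      the factor \<open>h\<close>.\<close>
    have ch: "(LINT \<omega>|M. cos (\<Sum>k<N. \<theta> k * (sqrt h * Y (x * real k / real N) \<omega>)))
        = exp (- quad N (\<lambda>k l. h * R k l) \<theta> / 2)" for \<theta>
    proof -
      have "quad N R (\<lambda>k. \<theta> k * sqrt h) = quad N (\<lambda>k l. h * R k l) \<theta>"
        unfolding quad_def using h by (intro sum.cong refl) (simp add: mult_ac)
      then show ?thesis using char[of "\<lambda>k. \<theta> k * sqrt h" N] unfolding R_def[symmetric]
        by (simp add: mult_ac)
    qed
    have "cov_kernel s t q = cov_kernel t s q" for s t q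
      by (simp add: cov_kernel_def add.commute abs_minus_commute min.commute)
    then have sym: "h * R i j = h * R j i" for i j
      unfolding R_def by presburger
    have m: "k < N \<Longrightarrow> (\<lambda>\<omega>. sqrt h * Y (x * real k / real N) \<omega>) \<in> borel_measurable M" for k
      using Y x by auto
    note L = laplace_sum_squares[where Y = "\<lambda>k \<omega>. sqrt h * Y (x * real k / real N) \<omega>", OF m ch sym]
    have "(LINT \<omega>|M. F N \<omega>) = (LINT \<omega>|M. exp (- (\<Sum>k<N. (sqrt h * Y (x * real k / real N) \<omega>)\<^sup>2) / 2))"
      unfolding F_def h_def[symmetric] using h
      by (simp add: power_mult_distrib sum_distrib_left[symmetric])
    then show ?thesis using L unfolding disc_det_def of_nat_eq_id RR by simp
  qed
  have "(\<lambda>N. 1 / (LINT \<omega>|M. F N \<omega>)\<^sup>2) \<longlonglongrightarrow> 1 / (LINT \<omega>|M. G \<omega>)\<^sup>2"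
    using pos by (intro tendsto_intros conv) auto
  moreover have "1 / (LINT \<omega>|M. F N \<omega>)\<^sup>2 = disc_det c p N x" for N
    using FN[of N] by (simp add: power_divide)
  ultimately show "(\<lambda>N. disc_det c p N x) \<longlonglongrightarrow> 1 / (LINT \<omega>|M. exp (- (1 / 2) * (LBINT y:{0..x}. (Y y \<omega>)\<^sup>2)))\<^sup>2"
    unfolding G_def by simp
qed

section \<open>Brownian increments\<close>

text \<open>\<open>lborel\<close> on vectors is the image of a product measure indexed by
  \<open>Basis\<close>. The function \<open>k\<close> inverts \<open>j \<mapsto> axis j 1\<close>,
  so that factors indexed by coordinates become factors indexed by basis vectors.\<close>

lemma lborel_vec_integral_prod:
  fixes f :: "'n::finite \<Rightarrow> real \<Rightarrow> 'b::{real_normed_field,banach,second_countable_topology}"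
  assumes f: "\<And>j. integrable lborel (f j)"
  shows "integrable lborel (\<lambda>x::real ^ 'n. \<Prod>j\<in>UNIV. f j (x $ j))"
    and "(LINT x|lborel. (\<Prod>j\<in>UNIV. f j ((x::real ^ 'n) $ j))) = (\<Prod>j\<in>UNIV. LINT y|lborel. f j y)"
proof -
  interpret ps: product_sigma_finite "\<lambda>_::real^'n. lborel :: real measure"
    by (simp add: product_sigma_finite_def sigma_finite_lborel)
  define e where "e j = (axis j 1 :: real ^ 'n)" for j
  define k where "k b = inv_into UNIV e b" for b
  have inj: "inj e" by (auto simp: inj_def e_def axis_eq_axis)
  have B: "Basis = range e" unfolding e_def by (auto simp: Basis_vec_def)
  have ke: "k (e j) = j" for j unfolding k_def using inj by simp
  define S where "S = (\<lambda>y. \<Sum>b\<in>Basis. y b *\<^sub>R (b::real ^ 'n))"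
  have Sj: "S y $ j = y (e j)" for y j
  proof -
    have "S y $ j = (\<Sum>b\<in>Basis. y b *\<^sub>R b) \<bullet> e j"
      by (simp add: S_def e_def cart_eq_inner_axis)
    also have "\<dots> = y (e j)" using B by (subst inner_sum_left_Basis) auto
    finally show ?thesis .
  qed
  have Sm: "S \<in> measurable (Pi\<^sub>M Basis (\<lambda>b. lborel)) borel"
    unfolding S_def by measurable
  have eq: "(\<Prod>j\<in>UNIV. f j (S y $ j)) = (\<Prod>b\<in>Basis. f (k b) (y b))" for y
    unfolding B Sj by (subst prod.reindex) (auto simp: inj ke)
  have eq2: "(\<Prod>j\<in>UNIV. LINT y|lborel. f j y) = (\<Prod>b\<in>Basis. LINT y|lborel. f (k b) y)"
    unfolding B by (subst prod.reindex) (auto simp: inj ke)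
  have fm: "f j \<in> borel_measurable borel" for j using f[of j] by auto
  have [measurable]: "(\<lambda>x::real ^ 'n. \<Prod>j\<in>UNIV. f j (x $ j)) \<in> borel_measurable borel"
    by (intro borel_measurable_prod measurable_compose[OF _ fm]) measurable
  have l: "lborel = distr (Pi\<^sub>M Basis (\<lambda>b. lborel)) borel S"
    unfolding S_def by (rule lborel_eq)
  have "integrable (Pi\<^sub>M Basis (\<lambda>b. lborel)) (\<lambda>y. \<Prod>b\<in>(Basis :: (real ^ 'n) set). f (k b) (y b))"
    by (rule ps.product_integrable_prod) (auto simp: f)
  then show "integrable lborel (\<lambda>x::real ^ 'n. \<Prod>j\<in>UNIV. f j (x $ j))"
    unfolding l by (subst integrable_distr_eq[OF Sm]) (auto simp: eq)
  show "(LINT x|lborel. (\<Prod>j\<in>UNIV. f j ((x::real ^ 'n) $ j))) = (\<Prod>j\<in>UNIV. LINT y|lborel. f j y)"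
    unfolding l eq2 by (subst integral_distr[OF Sm]) (auto simp: eq f intro: ps.product_integral_prod)
qed

lemma borel_measurable_vec_nth: "(\<lambda>x::'a::topological_space ^ 'n. x $ i) \<in> borel_measurable borel"
  by (intro borel_measurable_continuous_onI continuous_intros)

lemma prod_if_eq_UNIV:
  fixes i :: "'n::finite"
  shows "(\<Prod>j\<in>UNIV. if j = i then f j else 1) = f i"
  by (simp add: prod.delta)

lemma
  fixes \<sigma> :: real
  assumes "0 < \<sigma>"
  shows normal_integrable_id: "integrable (density lborel (normal_density 0 \<sigma>)) (\<lambda>y. y)"
    and normal_integral_id: "(LINT y|density lborel (normal_density 0 \<sigma>). y) = 0"
    and normal_integrable_square: "integrable (density lborel (normal_density 0 \<sigma>)) (\<lambda>y. y * y)"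
    and normal_integral_square: "(LINT y|density lborel (normal_density 0 \<sigma>). y * y) = \<sigma>\<^sup>2"
    and normal_integrable_const: "integrable (density lborel (normal_density 0 \<sigma>)) (\<lambda>y. 1::real)"
    and normal_integral_const: "(LINT y|density lborel (normal_density 0 \<sigma>). (1::real)) = 1"
proof -
  interpret n: prob_space "density lborel (normal_density 0 \<sigma>)"
    using assms by (rule prob_space_normal_density)
  show "integrable (density lborel (normal_density 0 \<sigma>)) (\<lambda>y. 1::real)"
    "(LINT y|density lborel (normal_density 0 \<sigma>). (1::real)) = 1"
    using n.prob_space by auto
  show "integrable (density lborel (normal_density 0 \<sigma>)) (\<lambda>y. y)"
    using integrable_normal_moment[OF assms, of 0 1]
    by (subst integrable_density) (auto simp: normal_density_nonneg)
  show "(LINT y|density lborel (normal_density 0 \<sigma>). y) = 0"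
    using integral_normal_moment_odd[OF assms, of 0 0]
    by (subst integral_density) (auto simp: normal_density_nonneg)
  show "integrable (density lborel (normal_density 0 \<sigma>)) (\<lambda>y. y * y)"
    using integrable_normal_moment[OF assms, of 0 2]
    by (subst integrable_density) (auto simp: normal_density_nonneg power2_eq_square)
  show "(LINT y|density lborel (normal_density 0 \<sigma>). y * y) = \<sigma>\<^sup>2"
    using integral_normal_moment_even[OF assms, of 0 1]
    by (subst integral_density) (auto simp: normal_density_nonneg power2_eq_square fact_numeral)
qed

section \<open>Filtration, independence and moments of increments\<close>

locale brownian = prob_space M for M :: "'a measure" +
  fixes B :: "real \<Rightarrow> 'a \<Rightarrow> real ^ 'n"
  assumes BM: "brownian_motion M B"
begin

abbreviation \<F> :: "real \<Rightarrow> 'a measure" where "\<F> \<equiv> natural_filtration M B"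

definition D :: "'n \<Rightarrow> real \<Rightarrow> real \<Rightarrow> 'a \<Rightarrow> real" where
  "D i s t \<omega> = B t \<omega> $ i - B s \<omega> $ i"

lemma B_measurable: "0 \<le> t \<Longrightarrow> B t \<in> borel_measurable M"
  using BM by (simp add: brownian_motion_def)

lemma B_component_measurable: "0 \<le> t \<Longrightarrow> (\<lambda>\<omega>. B t \<omega> $ i) \<in> borel_measurable M"
  by (intro measurable_compose[OF B_measurable borel_measurable_vec_nth])

lemma D_measurable: "0 \<le> s \<Longrightarrow> 0 \<le> t \<Longrightarrow> D i s t \<in> borel_measurable M"
  unfolding D_def by (intro borel_measurable_diff B_component_measurable)

lemma space_filtration [simp]: "space (\<F> t) = space M"
  by (simp add: natural_filtration_def space_measure_of_conv)

lemma sets_filtration_eq: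
  "sets (\<F> t) = sigma_sets (space M) {B r -` S \<inter> space M | r S. 0 \<le> r \<and> r \<le> t \<and> S \<in> sets borel}"
  unfolding natural_filtration_def by (rule sets_measure_of) auto

lemma sets_filtration_mono: "s \<le> t \<Longrightarrow> sets (\<F> s) \<subseteq> sets (\<F> t)"
  unfolding sets_filtration_eq by (rule sigma_sets_mono') (blast intro: order_trans)

lemma filtration_mono: "f \<in> measurable (\<F> s) N \<Longrightarrow> s \<le> t \<Longrightarrow> f \<in> measurable (\<F> t) N"
  using measurable_mono[of N N "\<F> s" "\<F> t"] sets_filtration_mono by auto

lemma sets_filtration_subset: "sets (\<F> t) \<subseteq> sets M"
  unfolding sets_filtration_eq
  by (rule sets.sigma_sets_subset) (auto intro: measurable_sets[OF B_measurable])

lemma measurable_filtration: "f \<in> measurable (\<F> t) N \<Longrightarrow> f \<in> measurable M N"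
  using measurable_mono[of N N "\<F> t" M] sets_filtration_subset by auto

lemma B_adapted: "0 \<le> r \<Longrightarrow> r \<le> t \<Longrightarrow> B r \<in> borel_measurable (\<F> t)"
proof (rule measurableI)
  fix A :: "(real ^ 'n) set" assume "0 \<le> r" "r \<le> t" "A \<in> sets borel"
  then show "B r -` A \<inter> space (\<F> t) \<in> sets (\<F> t)"
    unfolding sets_filtration_eq by auto
qed auto

lemma D_adapted: "0 \<le> r \<Longrightarrow> 0 \<le> s \<Longrightarrow> r \<le> t \<Longrightarrow> s \<le> t \<Longrightarrow> D i r s \<in> borel_measurable (\<F> t)"
  unfolding D_def
  by (intro borel_measurable_diff measurable_compose[OF B_adapted borel_measurable_vec_nth]) auto

text \<open>\<open>brownian_motion\<close> asserts independence of two sigma-fields. It passes to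
  \<open>Z\<close> and to functions of the increment because their preimages generate smaller
  sigma-fields.\<close>

lemma indep_increment:
  fixes Z :: "'a \<Rightarrow> 'b::topological_space" and g :: "real ^ 'n \<Rightarrow> 'b"
  assumes st: "0 \<le> s" "s < t" and Z: "Z \<in> borel_measurable (\<F> s)" and g: "g \<in> borel_measurable borel"
  shows "indep_var borel Z borel (\<lambda>\<omega>. g (B t \<omega> - B s \<omega>))"
proof -
  let ?V = "sets (vimage_algebra (space M) (\<lambda>\<omega>. B t \<omega> - B s \<omega>) borel)"
  have ind: "indep_set (sets (\<F> s)) ?V"
    using BM st by (auto simp: brownian_motion_def)
  have "(\<lambda>\<omega>. B t \<omega> - B s \<omega>) \<in> borel_measurable M"
    using st by (intro borel_measurable_diff B_measurable) auto
  then have m: "(\<lambda>\<omega>. g (B t \<omega> - B s \<omega>)) \<in> borel_measurable M"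
    by (rule measurable_compose) (rule g)
  have "sigma_sets (space M) {Z -` A \<inter> space M |A. A \<in> sets borel} \<subseteq> sets (\<F> s)"
    using measurable_sets[OF Z] sets.sigma_sets_subset[of "{Z -` A \<inter> space M |A. A \<in> sets borel}" "\<F> s"]
    by fastforce
  moreover have "sigma_sets (space M) {(\<lambda>\<omega>. g (B t \<omega> - B s \<omega>)) -` A \<inter> space M |A. A \<in> sets borel} \<subseteq> ?V"
  proof -
    have "(\<lambda>\<omega>. g (B t \<omega> - B s \<omega>)) -` A \<inter> space M \<in> ?V" if "A \<in> sets borel" for A
    proof -
      have "(\<lambda>\<omega>. B t \<omega> - B s \<omega>) -` (g -` A) \<inter> space M \<in> ?V"
        using measurable_sets[OF g that] by (intro in_vimage_algebra) auto
      then show ?thesis by (simp add: vimage_def)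
    qed
    then show ?thesis
      using sets.sigma_sets_subset[of "{(\<lambda>\<omega>. g (B t \<omega> - B s \<omega>)) -` A \<inter> space M |A. A \<in> sets borel}"
          "vimage_algebra (space M) (\<lambda>\<omega>. B t \<omega> - B s \<omega>) borel"] by auto
  qed
  ultimately have "indep_set (sigma_sets (space M) {Z -` A \<inter> space M |A. A \<in> sets borel})
      (sigma_sets (space M) {(\<lambda>\<omega>. g (B t \<omega> - B s \<omega>)) -` A \<inter> space M |A. A \<in> sets borel})"
    using ind unfolding indep_set_def
    by (elim indep_sets_mono_sets) (auto split: bool.split)
  then show ?thesis
    using measurable_filtration[OF Z] m by (simp add: indep_var_eq)
qed

text \<open>The joint density is a product, so expectations of products over the coordinates factor.
  The values may be complex: the real case gives the moments, the complex case the characteristic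
  function in \<open>wiener_sum_char\<close>.\<close>

lemma increment_density_integral:
  fixes f :: "'n \<Rightarrow> real \<Rightarrow> 'b::{real_normed_field,banach,second_countable_topology}"
  assumes st: "0 \<le> s" "s < t"
    and f: "\<And>j. integrable (density lborel (normal_density 0 (sqrt (t - s)))) (f j)"
  shows "integrable M (\<lambda>\<omega>. \<Prod>j\<in>UNIV. f j (D j s t \<omega>))"
    and "(LINT \<omega>|M. (\<Prod>j\<in>UNIV. f j (D j s t \<omega>)))
      = (\<Prod>j\<in>UNIV. LINT y|density lborel (normal_density 0 (sqrt (t - s))). f j y)"
proof -
  let ?n = "normal_density 0 (sqrt (t - s))"
  let ?d = "\<lambda>x::real ^ 'n. \<Prod>j\<in>UNIV. ?n (x $ j)"
  have dist: "distributed M lborel (\<lambda>\<omega>. B t \<omega> - B s \<omega>) (\<lambda>x. ennreal (?d x))"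
    using BM st by (auto simp: brownian_motion_def)
  have m: "(\<lambda>\<omega>. B t \<omega> - B s \<omega>) \<in> measurable M lborel"
    using distributed_measurable[OF dist] .
  have de: "distr M lborel (\<lambda>\<omega>. B t \<omega> - B s \<omega>) = density lborel (\<lambda>x. ennreal (?d x))"
    using distributed_distr_eq_density[OF dist] .
  have fm: "f j \<in> borel_measurable borel" for j using f[of j] by auto
  have [measurable]: "(\<lambda>x::real ^ 'n. \<Prod>j\<in>UNIV. f j (x $ j)) \<in> borel_measurable borel"
    by (intro borel_measurable_prod measurable_compose[OF _ fm]) measurable
  have fd: "integrable lborel (\<lambda>y. ?n y *\<^sub>R f j y)" for j
    using f[of j] fm by (subst (asm) integrable_density) (auto simp: normal_density_nonneg)
  have eq: "?d x *\<^sub>R (\<Prod>j\<in>UNIV. f j (x $ j)) = (\<Prod>j\<in>UNIV. ?n (x $ j) *\<^sub>R f j (x $ j))" for x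
    by (simp add: scaleR_conv_of_real prod.distrib)
  have dm: "?d \<in> borel_measurable lborel" by measurable
  have d0: "AE x in lborel. 0 \<le> ?d x" by (auto intro!: prod_nonneg simp: normal_density_nonneg)
  have "integrable (distr M lborel (\<lambda>\<omega>. B t \<omega> - B s \<omega>)) (\<lambda>x. \<Prod>j\<in>UNIV. f j (x $ j))"
    unfolding de using lborel_vec_integral_prod(1)[where f = "\<lambda>j y. ?n y *\<^sub>R f j y", OF fd]
    by (subst integrable_density[OF _ dm d0]) (auto simp: eq)
  then show "integrable M (\<lambda>\<omega>. \<Prod>j\<in>UNIV. f j (D j s t \<omega>))"
    by (subst (asm) integrable_distr_eq[OF m]) (auto simp: D_def)
  have "(LINT \<omega>|M. (\<Prod>j\<in>UNIV. f j (D j s t \<omega>)))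
      = (LINT x|distr M lborel (\<lambda>\<omega>. B t \<omega> - B s \<omega>). (\<Prod>j\<in>UNIV. f j (x $ j)))"
    by (subst integral_distr[OF m]) (auto simp: D_def)
  also have "\<dots> = (\<Prod>j\<in>UNIV. LINT y|lborel. ?n y *\<^sub>R f j y)"
    unfolding de using lborel_vec_integral_prod(2)[where f = "\<lambda>j y. ?n y *\<^sub>R f j y", OF fd]
    by (subst integral_density[OF _ dm d0]) (auto simp: eq)
  also have "\<dots> = (\<Prod>j\<in>UNIV. LINT y|density lborel ?n. f j y)"
    using fm by (intro prod.cong refl) (subst integral_density, auto simp: normal_density_nonneg)
  finally show "(LINT \<omega>|M. (\<Prod>j\<in>UNIV. f j (D j s t \<omega>)))
      = (\<Prod>j\<in>UNIV. LINT y|density lborel ?n. f j y)" .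
qed

lemma
  assumes st: "0 \<le> s" "s \<le> t"
  shows D_integrable: "integrable M (D i s t)"
    and D_expectation: "expectation (D i s t) = 0"
    and DD_integrable: "integrable M (\<lambda>\<omega>. D i s t \<omega> * D k s t \<omega>)"
    and DD_expectation: "expectation (\<lambda>\<omega>. D i s t \<omega> * D k s t \<omega>) = (if i = k then t - s else 0)"
proof -
  have "integrable M (D i s t) \<and> expectation (D i s t) = 0 \<and>
    integrable M (\<lambda>\<omega>. D i s t \<omega> * D k s t \<omega>) \<and>
    expectation (\<lambda>\<omega>. D i s t \<omega> * D k s t \<omega>) = (if i = k then t - s else 0)"
  proof (cases "s = t")
    case True
    then show ?thesis by (simp add: D_def[abs_def])
  next
    case False
    then have lt: "s < t" and sq: "0 < sqrt (t - s)" using st by auto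
    note [simp] = normal_integrable_id[OF sq] normal_integral_id[OF sq] normal_integrable_square[OF sq]
      normal_integral_square[OF sq] normal_integrable_const[OF sq] normal_integral_const[OF sq, simplified]
    \<comment> \<open>\<open>f\<close> and \<open>g\<close> select one or two coordinates from the
      product over all of them by being 1 elsewhere. For \<open>i = k\<close> the two factors of
      \<open>g\<close> meet in one coordinate and produce the square.\<close>
    define f where "f j y = (if j = i then y else 1)" for j and y :: real
    define g where "g j y = (if j = i then y else 1) * (if j = k then y else 1)" for j and y :: real
    have f: "integrable (density lborel (normal_density 0 (sqrt (t - s)))) (f j)" for j
      by (cases "j = i") (simp_all add: f_def[abs_def])
    have g: "integrable (density lborel (normal_density 0 (sqrt (t - s)))) (g j)" for j
      by (cases "j = i"; cases "j = k") (simp_all add: g_def[abs_def])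
    have fD: "(\<Prod>j\<in>UNIV. f j (D j s t \<omega>)) = D i s t \<omega>" for \<omega>
      unfolding f_def by (rule prod_if_eq_UNIV)
    have gD: "(\<Prod>j\<in>UNIV. g j (D j s t \<omega>)) = D i s t \<omega> * D k s t \<omega>" for \<omega>
      unfolding g_def prod.distrib prod_if_eq_UNIV by simp
    have pf: "(\<Prod>j\<in>UNIV. LINT y|density lborel (normal_density 0 (sqrt (t - s))). f j y) = 0"
    proof (rule prod_zero[OF finite bexI])
      show "(LINT y|density lborel (normal_density 0 (sqrt (t - s))). f i y) = 0" by (simp add: f_def)
    qed simp
    have pg: "(\<Prod>j\<in>UNIV. LINT y|density lborel (normal_density 0 (sqrt (t - s))). g j y)
        = (if i = k then t - s else 0)"
    proof (cases "i = k")
      case True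
      have "(LINT y|density lborel (normal_density 0 (sqrt (t - s))). g j y) = (if j = i then t - s else 1)" for j
        using True st by (simp add: g_def)
      then show ?thesis using True prod_if_eq_UNIV[of i "\<lambda>_. t - s"] by simp
    next
      case False
      then have "(LINT y|density lborel (normal_density 0 (sqrt (t - s))). g i y) = 0" by (simp add: g_def)
      then have "(\<Prod>j\<in>UNIV. LINT y|density lborel (normal_density 0 (sqrt (t - s))). g j y) = 0"
        by (rule prod_zero[OF finite bexI]) simp
      then show ?thesis using False by simp
    qed
    show ?thesis
      using increment_density_integral[where f = f, OF st(1) lt f]
        increment_density_integral[where f = g, OF st(1) lt g]
      unfolding fD gD pf pg by blast
  qed
  then show "integrable M (D i s t)" "expectation (D i s t) = 0"
    "integrable M (\<lambda>\<omega>. D i s t \<omega> * D k s t \<omega>)"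
    "expectation (\<lambda>\<omega>. D i s t \<omega> * D k s t \<omega>) = (if i = k then t - s else 0)"
    by auto
qed

lemma
  fixes Z :: "'a \<Rightarrow> 'b::{real_normed_field,banach,second_countable_topology}" and g :: "real ^ 'n \<Rightarrow> 'b"
  assumes st: "0 \<le> s" "s < t" and Z: "Z \<in> borel_measurable (\<F> s)" "integrable M Z"
    and g: "g \<in> borel_measurable borel" "integrable M (\<lambda>\<omega>. g (B t \<omega> - B s \<omega>))"
  shows increment_mult_integrable: "integrable M (\<lambda>\<omega>. Z \<omega> * g (B t \<omega> - B s \<omega>))"
    and increment_mult_integral:
      "(LINT \<omega>|M. Z \<omega> * g (B t \<omega> - B s \<omega>)) = (LINT \<omega>|M. Z \<omega>) * (LINT \<omega>|M. g (B t \<omega> - B s \<omega>))"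
proof -
  note i = indep_increment[OF st Z(1) g(1)]
  show "integrable M (\<lambda>\<omega>. Z \<omega> * g (B t \<omega> - B s \<omega>))"
    using indep_var_integrable[OF i Z(2) g(2)] .
  show "(LINT \<omega>|M. Z \<omega> * g (B t \<omega> - B s \<omega>)) = (LINT \<omega>|M. Z \<omega>) * (LINT \<omega>|M. g (B t \<omega> - B s \<omega>))"
    using indep_var_lebesgue_integral[OF i Z(2) g(2)] .
qed

text \<open>The martingale property and the covariation of the increments, by independence of the
  past. The case \<open>s = t\<close> is separate because the density is available for
  \<open>s < t\<close> only.\<close>

lemma
  assumes st: "0 \<le> s" "s \<le> t" and Z: "Z \<in> borel_measurable (\<F> s)" "integrable M Z"
  shows adapted_D_integrable: "integrable M (\<lambda>\<omega>. Z \<omega> * D i s t \<omega>)"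
    and adapted_D_expectation: "expectation (\<lambda>\<omega>. Z \<omega> * D i s t \<omega>) = 0"
    and adapted_DD_integrable: "integrable M (\<lambda>\<omega>. Z \<omega> * (D i s t \<omega> * D k s t \<omega>))"
    and adapted_DD_expectation: "expectation (\<lambda>\<omega>. Z \<omega> * (D i s t \<omega> * D k s t \<omega>))
      = (if i = k then t - s else 0) * expectation Z"
proof -
  have D: "D i s t \<omega> = (B t \<omega> - B s \<omega>) $ i" for i \<omega> by (simp add: D_def)
  have "integrable M (\<lambda>\<omega>. Z \<omega> * D i s t \<omega>) \<and> expectation (\<lambda>\<omega>. Z \<omega> * D i s t \<omega>) = 0 \<and>
     integrable M (\<lambda>\<omega>. Z \<omega> * (D i s t \<omega> * D k s t \<omega>)) \<and>
     expectation (\<lambda>\<omega>. Z \<omega> * (D i s t \<omega> * D k s t \<omega>)) = (if i = k then t - s else 0) * expectation Z"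
  proof (cases "s = t")
    case True
    then show ?thesis by (simp add: D_def[abs_def])
  next
    case False
    then have lt: "s < t" using st by auto
    have i1: "integrable M (\<lambda>\<omega>. (B t \<omega> - B s \<omega>) $ i)" for i
      using D_integrable[OF st, of i] unfolding D .
    have i2: "integrable M (\<lambda>\<omega>. (B t \<omega> - B s \<omega>) $ i * (B t \<omega> - B s \<omega>) $ k)"
      using DD_integrable[OF st, of i k] unfolding D .
    have m1: "(\<lambda>x::real ^ 'n. x $ i) \<in> borel_measurable borel"
      "(\<lambda>x::real ^ 'n. x $ i * x $ k) \<in> borel_measurable borel" for i k :: 'n
      by (intro borel_measurable_times borel_measurable_vec_nth)+
    show ?thesis
      unfolding D using increment_mult_integrable[OF st(1) lt Z m1(1) i1]
        increment_mult_integral[OF st(1) lt Z m1(1) i1]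
        increment_mult_integrable[OF st(1) lt Z m1(2) i2]
        increment_mult_integral[OF st(1) lt Z m1(2) i2]
        D_expectation[OF st, of i] DD_expectation[OF st, of i k] unfolding D by simp
  qed
  then show "integrable M (\<lambda>\<omega>. Z \<omega> * D i s t \<omega>)" "expectation (\<lambda>\<omega>. Z \<omega> * D i s t \<omega>) = 0"
    "integrable M (\<lambda>\<omega>. Z \<omega> * (D i s t \<omega> * D k s t \<omega>))"
    "expectation (\<lambda>\<omega>. Z \<omega> * (D i s t \<omega> * D k s t \<omega>)) = (if i = k then t - s else 0) * expectation Z"
    by auto
qed

end

section \<open>The Ito isometry\<close>

lemma integrable_bounded_mult:
  fixes f g :: "'a \<Rightarrow> real"
  assumes f: "integrable M f" and g: "g \<in> borel_measurable M" "\<And>x. x \<in> space M \<Longrightarrow> \<bar>g x\<bar> \<le> C"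
  shows "integrable M (\<lambda>x. g x * f x)"
proof (rule Bochner_Integration.integrable_bound)
  show "integrable M (\<lambda>x. C * f x)" using f by simp
  show "(\<lambda>x. g x * f x) \<in> borel_measurable M" using f g by auto
  show "AE x in M. norm (g x * f x) \<le> norm (C * f x)"
    using g(2) by (intro AE_I2) (simp add: abs_mult mult_right_mono order_trans[OF _ abs_ge_self])
qed

text \<open>The intervals will be intersections of two time intervals; \<open>max 0\<close> covers
  the empty ones.\<close>

lemma has_bochner_integral_lborel_Ioc:
  "has_bochner_integral lborel (indicator {a<..b} :: real \<Rightarrow> real) (max 0 (b - a))"
proof (cases "a \<le> b")
  case True
  then show ?thesis
    using has_bochner_integral_real_indicator[of "{a<..b}" lborel] by (simp add: max_def measure_def)
next
  case False
  then have "(indicator {a<..b} :: real \<Rightarrow> real) = (\<lambda>_. 0)" by (auto simp: indicator_def)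
  then show ?thesis using False by (simp add: has_bochner_integral_zero)
qed

context brownian
begin

definition adapted :: "real \<Rightarrow> ('a \<Rightarrow> real) \<Rightarrow> bool" where
  "adapted s \<alpha> \<longleftrightarrow> \<alpha> \<in> borel_measurable (\<F> s) \<and> (\<exists>C. \<forall>\<omega>\<in>space M. \<bar>\<alpha> \<omega>\<bar> \<le> C)"

lemma adapted_measurable: "adapted s \<alpha> \<Longrightarrow> \<alpha> \<in> borel_measurable M"
  by (auto simp: adapted_def intro: measurable_filtration)

lemma adapted_integrable_mult: "adapted s \<alpha> \<Longrightarrow> integrable M f \<Longrightarrow> integrable M (\<lambda>\<omega>. \<alpha> \<omega> * f \<omega>)"
  using adapted_measurable integrable_bounded_mult unfolding adapted_def by metis

lemma adapted_integrable: "adapted s \<alpha> \<Longrightarrow> integrable M \<alpha>"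
  using adapted_integrable_mult[of s \<alpha> "\<lambda>_. 1"] by simp

lemma adapted_mono: "adapted s \<alpha> \<Longrightarrow> s \<le> t \<Longrightarrow> adapted t \<alpha>"
  unfolding adapted_def using filtration_mono by blast

lemma adapted_mult:
  assumes "adapted s \<alpha>" "adapted s \<beta>"
  shows "adapted s (\<lambda>\<omega>. \<alpha> \<omega> * \<beta> \<omega>)"
proof -
  obtain C C' where "\<forall>\<omega>\<in>space M. \<bar>\<alpha> \<omega>\<bar> \<le> C" "\<forall>\<omega>\<in>space M. \<bar>\<beta> \<omega>\<bar> \<le> C'"
    using assms by (auto simp: adapted_def)
  then have "\<forall>\<omega>\<in>space M. \<bar>\<alpha> \<omega> * \<beta> \<omega>\<bar> \<le> C * C'"
    by (auto simp: abs_mult intro!: mult_mono order_trans[OF abs_ge_zero])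
  then show ?thesis using assms by (auto simp: adapted_def)
qed

lemma adapted_const: "adapted s (\<lambda>_. c)"
  by (auto simp: adapted_def)

text \<open>Both time intervals are cut at \<open>u\<close> and at the earlier end \<open>m\<close>.
  Only the common piece contributes: in every other product the later increment is centered and
  independent of the rest, which is \<open>Z\<close>.\<close>

lemma bracket_ordered:
  assumes st: "0 \<le> s" "s \<le> t" "s \<le> u" "u \<le> v" and \<alpha>: "adapted s \<alpha>" and \<beta>: "adapted u \<beta>"
  shows "integrable M (\<lambda>\<omega>. (\<alpha> \<omega> * D i s t \<omega>) * (\<beta> \<omega> * D k u v \<omega>)) \<and>
    expectation (\<lambda>\<omega>. (\<alpha> \<omega> * D i s t \<omega>) * (\<beta> \<omega> * D k u v \<omega>))
      = (if i = k then max 0 (min t v - u) else 0) * expectation (\<lambda>\<omega>. \<alpha> \<omega> * \<beta> \<omega>)"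
proof -
  define \<gamma> where "\<gamma> \<omega> = \<alpha> \<omega> * \<beta> \<omega>" for \<omega>
  have \<gamma>: "adapted u \<gamma>" unfolding \<gamma>_def using adapted_mult[OF adapted_mono[OF \<alpha>] \<beta>] st by blast
  have \<gamma>m: "\<gamma> \<in> borel_measurable (\<F> r)" if "u \<le> r" for r
    using adapted_mono[OF \<gamma> that] by (simp add: adapted_def)
  have Z: "integrable M (\<lambda>\<omega>. (\<gamma> \<omega> * D j a b \<omega>) * D l r q \<omega>)"
      "expectation (\<lambda>\<omega>. (\<gamma> \<omega> * D j a b \<omega>) * D l r q \<omega>) = 0"
    if "0 \<le> a" "a \<le> b" "b \<le> r" "u \<le> r" "r \<le> q" for a b r q j l
  proof -
    have "(\<lambda>\<omega>. \<gamma> \<omega> * D j a b \<omega>) \<in> borel_measurable (\<F> r)"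
      using that by (intro borel_measurable_times \<gamma>m D_adapted) auto
    moreover have "integrable M (\<lambda>\<omega>. \<gamma> \<omega> * D j a b \<omega>)"
      using that by (intro adapted_integrable_mult[OF \<gamma>] D_integrable) auto
    ultimately show "integrable M (\<lambda>\<omega>. (\<gamma> \<omega> * D j a b \<omega>) * D l r q \<omega>)"
      "expectation (\<lambda>\<omega>. (\<gamma> \<omega> * D j a b \<omega>) * D l r q \<omega>) = 0"
      using adapted_D_integrable[of r q] adapted_D_expectation[of r q] that by auto
  qed
  show ?thesis
  proof (cases "t \<le> u")
    case True
    then show ?thesis using Z[of s t u v i k] st by (simp add: \<gamma>_def mult_ac)
  next
    case False
    define m where "m = min t v"
    have m: "u \<le> m" "m \<le> t" "m \<le> v" "0 \<le> u" using False st by (auto simp: m_def)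
    \<comment> \<open>Of the six products of pieces, the two with \<open>D i s u\<close> are kept
      together, and that of the two pieces after \<open>m\<close> vanishes, since \<open>m\<close>
      is the end of one of the intervals.\<close>
    have eq: "(\<alpha> \<omega> * D i s t \<omega>) * (\<beta> \<omega> * D k u v \<omega>) = (\<gamma> \<omega> * D i s u \<omega>) * D k u v \<omega>
        + \<gamma> \<omega> * (D i u m \<omega> * D k u m \<omega>) + (\<gamma> \<omega> * D i u m \<omega>) * D k m v \<omega>
        + (\<gamma> \<omega> * D k u m \<omega>) * D i m t \<omega>" for \<omega>
    proof -
      have "D i m t \<omega> = 0 \<or> D k m v \<omega> = 0" by (auto simp: m_def min_def D_def)
      moreover have "D i s t \<omega> = D i s u \<omega> + D i u m \<omega> + D i m t \<omega>" "D k u v \<omega> = D k u m \<omega> + D k m v \<omega>"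
        by (auto simp: D_def)
      ultimately show ?thesis unfolding \<gamma>_def by (auto simp: algebra_simps)
    qed
    note DD = adapted_DD_integrable[OF m(4,1) \<gamma>m[OF order_refl] adapted_integrable[OF \<gamma>], of i k]
      adapted_DD_expectation[OF m(4,1) \<gamma>m[OF order_refl] adapted_integrable[OF \<gamma>], of i k]
    have "max 0 (min t v - u) = m - u" using m by (simp add: m_def)
    moreover have "expectation (\<lambda>\<omega>. \<alpha> \<omega> * \<beta> \<omega>) = expectation \<gamma>" by (simp add: \<gamma>_def[abs_def])
    ultimately show ?thesis
      unfolding eq using Z[of s u u v i k] Z[of u m m v i k] Z[of u m m t k i] DD m st by simp
  qed
qed

lemma bracket:
  assumes "0 \<le> s" "s \<le> t" "0 \<le> u" "u \<le> v" and \<alpha>: "adapted s \<alpha>" and \<beta>: "adapted u \<beta>"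
  shows "integrable M (\<lambda>\<omega>. (\<alpha> \<omega> * D i s t \<omega>) * (\<beta> \<omega> * D k u v \<omega>)) \<and>
    expectation (\<lambda>\<omega>. (\<alpha> \<omega> * D i s t \<omega>) * (\<beta> \<omega> * D k u v \<omega>))
      = (if i = k then max 0 (min t v - max s u) else 0) * expectation (\<lambda>\<omega>. \<alpha> \<omega> * \<beta> \<omega>)"
proof (cases "s \<le> u")
  case True
  then show ?thesis using bracket_ordered[of s t u v \<alpha> \<beta> i k] assms by (simp add: max_def)
next
  case False
  then show ?thesis using bracket_ordered[of u v s t \<beta> \<alpha> k i] assms
    by (simp add: max_def mult.commute min.commute eq_commute[of i k])
qed

text \<open>The intervals of the family may overlap and may belong to different coordinates. Thus
  the difference of two step integrals over unrelated partitions is covered without a common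
  refinement. Both sides are sums over pairs of the overlap \<open>ov a b\<close> times the
  expectation of the product of coefficients.\<close>

lemma ito_isometry:
  fixes A :: "'b set" and idx :: "'b \<Rightarrow> 'n"
  assumes fin: "finite A" and st: "\<And>a. a \<in> A \<Longrightarrow> 0 \<le> s a \<and> s a \<le> t a"
    and \<alpha>: "\<And>a. a \<in> A \<Longrightarrow> adapted (s a) (\<alpha> a)"
  shows "(\<integral>\<^sup>+\<omega>. ennreal ((\<Sum>a\<in>A. \<alpha> a \<omega> * D (idx a) (s a) (t a) \<omega>)\<^sup>2) \<partial>M)
    = (\<integral>\<^sup>+\<omega>. \<integral>\<^sup>+z. ennreal (\<Sum>i\<in>UNIV.
        (\<Sum>a\<in>A. if idx a = i then \<alpha> a \<omega> * indicator {s a<..t a} z else 0)\<^sup>2) \<partial>lborel \<partial>M)"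
proof -
  define ov where "ov a b = (if idx a = idx b then max 0 (min (t a) (t b) - max (s a) (s b)) else 0)" for a b
  let ?S = "\<lambda>\<omega>. \<Sum>a\<in>A. \<alpha> a \<omega> * D (idx a) (s a) (t a) \<omega>"
  have sq: "(?S \<omega>)\<^sup>2 = (\<Sum>a\<in>A. \<Sum>b\<in>A. (\<alpha> a \<omega> * D (idx a) (s a) (t a) \<omega>) * (\<alpha> b \<omega> * D (idx b) (s b) (t b) \<omega>))" for \<omega>
    by (simp add: power2_eq_square sum_product)
  have br: "integrable M (\<lambda>\<omega>. (\<alpha> a \<omega> * D (idx a) (s a) (t a) \<omega>) * (\<alpha> b \<omega> * D (idx b) (s b) (t b) \<omega>))"
    "expectation (\<lambda>\<omega>. (\<alpha> a \<omega> * D (idx a) (s a) (t a) \<omega>) * (\<alpha> b \<omega> * D (idx b) (s b) (t b) \<omega>))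
      = ov a b * expectation (\<lambda>\<omega>. \<alpha> a \<omega> * \<alpha> b \<omega>)" if "a \<in> A" "b \<in> A" for a b
    using bracket[of "s a" "t a" "s b" "t b" "\<alpha> a" "\<alpha> b" "idx a" "idx b"] st \<alpha> that
    unfolding ov_def by auto
  have aa: "integrable M (\<lambda>\<omega>. \<alpha> a \<omega> * \<alpha> b \<omega>)" if "a \<in> A" "b \<in> A" for a b
    using \<alpha> that by (intro adapted_integrable_mult[of "s a"] adapted_integrable[of "s b"]) auto
  have "(\<integral>\<^sup>+\<omega>. ennreal ((?S \<omega>)\<^sup>2) \<partial>M) = ennreal (expectation (\<lambda>\<omega>. (?S \<omega>)\<^sup>2))"
  proof -
    have "integrable M (\<lambda>\<omega>. (?S \<omega>)\<^sup>2)"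
      unfolding sq using br by (intro Bochner_Integration.integrable_sum)
    then show ?thesis by (rule nn_integral_eq_integral) simp
  qed
  also have "expectation (\<lambda>\<omega>. (?S \<omega>)\<^sup>2) = (\<Sum>a\<in>A. \<Sum>b\<in>A. ov a b * expectation (\<lambda>\<omega>. \<alpha> a \<omega> * \<alpha> b \<omega>))"
    unfolding sq using br by (simp add: integral_sum)
  also have "\<dots> = expectation (\<lambda>\<omega>. \<Sum>a\<in>A. \<Sum>b\<in>A. ov a b * (\<alpha> a \<omega> * \<alpha> b \<omega>))"
    using aa by (simp add: integral_sum)
  finally have lhs: "(\<integral>\<^sup>+\<omega>. ennreal ((?S \<omega>)\<^sup>2) \<partial>M)
    = ennreal (expectation (\<lambda>\<omega>. \<Sum>a\<in>A. \<Sum>b\<in>A. ov a b * (\<alpha> a \<omega> * \<alpha> b \<omega>)))" .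
  let ?f = "\<lambda>\<omega> z. \<Sum>i\<in>UNIV. (\<Sum>a\<in>A. if idx a = i then \<alpha> a \<omega> * indicator {s a<..t a} z else 0)\<^sup>2 :: real"
  \<comment> \<open>Summing over the coordinate first leaves the pairs with equal index; the product
    of their indicators is the indicator of the intersection.\<close>
  have f: "?f \<omega> z = (\<Sum>a\<in>A. \<Sum>b\<in>A. (if idx a = idx b then \<alpha> a \<omega> * \<alpha> b \<omega> else 0)
      * indicator {max (s a) (s b)<..min (t a) (t b)} z)" for \<omega> z
  proof -
    let ?g = "\<lambda>a. \<alpha> a \<omega> * indicator {s a<..t a} z"
    have "?f \<omega> z = (\<Sum>i\<in>UNIV. \<Sum>a\<in>A. \<Sum>b\<in>A. if idx a = i then if idx b = i then ?g a * ?g b else 0 else 0)"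
      unfolding power2_eq_square sum_product by (intro sum.cong refl) auto
    also have "\<dots> = (\<Sum>a\<in>A. \<Sum>b\<in>A. \<Sum>i\<in>UNIV. if idx a = i then if idx b = i then ?g a * ?g b else 0 else 0)"
      by (subst sum.swap) (intro sum.cong refl sum.swap)
    also have "\<dots> = (\<Sum>a\<in>A. \<Sum>b\<in>A. (if idx a = idx b then \<alpha> a \<omega> * \<alpha> b \<omega> else 0)
      * indicator {max (s a) (s b)<..min (t a) (t b)} z)"
      by (intro sum.cong refl) (auto simp: sum.delta' indicator_def)
    finally show ?thesis .
  qed
  have inner: "has_bochner_integral lborel (?f \<omega>) (\<Sum>a\<in>A. \<Sum>b\<in>A. ov a b * (\<alpha> a \<omega> * \<alpha> b \<omega>))" for \<omega>
  proof -
    have "has_bochner_integral lborel (\<lambda>z. (if idx a = idx b then \<alpha> a \<omega> * \<alpha> b \<omega> else 0)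
      * indicator {max (s a) (s b)<..min (t a) (t b)} z) (ov a b * (\<alpha> a \<omega> * \<alpha> b \<omega>))" for a b
    proof -
      have "has_bochner_integral lborel (indicator {max (s a) (s b)<..min (t a) (t b)} :: real \<Rightarrow> real)
          (max 0 (min (t a) (t b) - max (s a) (s b)))"
        by (rule has_bochner_integral_lborel_Ioc)
      from has_bochner_integral_mult_right[OF this] show ?thesis
        unfolding ov_def by (cases "idx a = idx b") (simp_all add: mult.commute has_bochner_integral_zero)
    qed
    then show ?thesis unfolding f by (intro has_bochner_integral_sum)
  qed
  have nn: "0 \<le> (\<Sum>a\<in>A. \<Sum>b\<in>A. ov a b * (\<alpha> a \<omega> * \<alpha> b \<omega>))" for \<omega>
    unfolding has_bochner_integral_integral_eq[OF inner, symmetric]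
    by (intro Bochner_Integration.integral_nonneg sum_nonneg zero_le_power2)
  have "(\<integral>\<^sup>+z. ennreal (?f \<omega> z) \<partial>lborel) = ennreal (\<Sum>a\<in>A. \<Sum>b\<in>A. ov a b * (\<alpha> a \<omega> * \<alpha> b \<omega>))" for \<omega>
    using inner[of \<omega>] by (subst nn_integral_eq_integral)
      (auto simp: has_bochner_integral_iff intro!: sum_nonneg)
  then show ?thesis
    unfolding lhs using aa nn by (simp, subst nn_integral_eq_integral) auto
qed

section \<open>Comparison of an Ito integral with a deterministic step sum\<close>

lemma simple_integral_component:
  "simple_integral B N t H T \<omega> $ r
    = (\<Sum>k<N. \<Sum>j\<in>UNIV. H k \<omega> $ r $ j * D j (min T (t k)) (min T (t (Suc k))) \<omega>)"
  by (simp add: simple_integral_def matrix_vector_mult_def D_def sum_component)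

text \<open>The defining sequence of simple integrals stands between \<open>Y\<close> and the step
  sum. The isometry moves the comparison to the integrands, where \<open>\<Phi>\<close> is inserted.
  The square of a sum is split twice, each time with a factor 2, whence the 4; the terms with the
  simple processes vanish in the limit.\<close>

lemma deterministic_ito_bound:
  fixes \<Phi> :: "real \<Rightarrow> real ^ 'n ^ 'm" and a :: "nat \<Rightarrow> 'n \<Rightarrow> real" and z :: "nat \<Rightarrow> real"
  assumes I: "is_ito_integral M B (\<lambda>x \<omega>. \<Phi> x) T Y" and T: "0 \<le> T"
    and \<Phi>: "\<Phi> \<in> borel_measurable borel"
    and z: "\<And>l. l < L \<Longrightarrow> 0 \<le> z l \<and> z l \<le> z (Suc l) \<and> z (Suc l) \<le> T"
    and e: "0 \<le> e"
    and approx: "\<And>x. 0 < x \<Longrightarrow> x \<le> T \<Longrightarrow>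
      (\<Sum>i\<in>UNIV. (\<Phi> x $ r $ i - (\<Sum>l<L. a l i * indicator {z l<..z (Suc l)} x))\<^sup>2) \<le> e"
  shows "(\<integral>\<^sup>+\<omega>. ennreal ((Y \<omega> $ r - (\<Sum>l<L. \<Sum>i\<in>UNIV. a l i * D i (z l) (z (Suc l)) \<omega>))\<^sup>2) \<partial>M)
    \<le> ennreal (4 * e * T)"
proof -
  let ?W = "\<lambda>\<omega>. \<Sum>l<L. \<Sum>i\<in>UNIV. a l i * D i (z l) (z (Suc l)) \<omega>"
  obtain N t H where
    Ym: "Y \<in> borel_measurable M" and
    simple: "\<And>q. simple_integrand M B (N q) (t q) (H q)" and
    conv1: "(\<lambda>q. \<integral>\<^sup>+\<omega>. (\<integral>\<^sup>+s\<in>{0..T}.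
           ennreal ((norm (simple_value (N q) (t q) (H q) s \<omega> - \<Phi> s))\<^sup>2) \<partial>lborel) \<partial>M) \<longlonglongrightarrow> 0" and
    conv2: "(\<lambda>q. \<integral>\<^sup>+\<omega>. ennreal ((norm (simple_integral B (N q) (t q) (H q) T \<omega> - Y \<omega>))\<^sup>2) \<partial>M) \<longlonglongrightarrow> 0"
    using I unfolding is_ito_integral_def by blast
  let ?si = "\<lambda>q \<omega>. simple_integral B (N q) (t q) (H q) T \<omega>"
  let ?sv = "\<lambda>q s \<omega>. simple_value (N q) (t q) (H q) s \<omega>"
  define c1 where "c1 q = (\<integral>\<^sup>+\<omega>. (\<integral>\<^sup>+s\<in>{0..T}. ennreal ((norm (?sv q s \<omega> - \<Phi> s))\<^sup>2) \<partial>lborel) \<partial>M)" for q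
  define c2 where "c2 q = (\<integral>\<^sup>+\<omega>. ennreal ((norm (?si q \<omega> - Y \<omega>))\<^sup>2) \<partial>M)" for q
  have Dm: "D i (min T u) (min T v) \<in> borel_measurable M" if "0 \<le> u" "0 \<le> v" for i u v
    using T that by (intro D_measurable) auto
  have Wm: "?W \<in> borel_measurable M"
    using z by (intro borel_measurable_sum borel_measurable_times borel_measurable_const D_measurable)
      (auto intro: order_trans)
  have key: "(\<integral>\<^sup>+\<omega>. ennreal ((?si q \<omega> $ r - ?W \<omega>)\<^sup>2) \<partial>M) \<le> 2 * c1 q + ennreal (2 * e * T)"
    and tk: "\<And>k. k \<le> N q \<Longrightarrow> 0 \<le> t q k"
    and Hm: "\<And>k. k < N q \<Longrightarrow> H q k \<in> borel_measurable M" for q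
  proof -
    define N' where "N' = N q"
    define t' where "t' = t q"
    define H' where "H' = H q"
    have sH: "0 \<le> t' 0" "\<And>k. k < N' \<Longrightarrow> t' k < t' (Suc k)"
      "\<And>k. k < N' \<Longrightarrow> H' k \<in> borel_measurable (\<F> (t' k))"
      "\<And>k. k < N' \<Longrightarrow> \<exists>C. \<forall>\<omega>\<in>space M. norm (H' k \<omega>) \<le> C"
      using simple[of q] unfolding simple_integrand_def N'_def t'_def H'_def by auto
    have t0: "0 \<le> t' k" if "k \<le> N'" for k
      using that
    proof (induction k)
      case (Suc k)
      then show ?case using sH(2)[of k] by simp
    qed (simp add: sH(1))
    then show "\<And>k. k \<le> N q \<Longrightarrow> 0 \<le> t q k" by (simp add: N'_def t'_def)
    have Hm': "H' k \<in> borel_measurable M" if "k < N'" for k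
      using sH(3)[OF that] by (rule measurable_filtration)
    then show "\<And>k. k < N q \<Longrightarrow> H q k \<in> borel_measurable M" by (simp add: N'_def H'_def)
    \<comment> \<open>The left summand indexes the pieces of the simple process, the right one the
      cells of the step function. The latter get negative coefficients in \<open>\<alpha>\<close>,
      so that the isometry applies to the difference.\<close>
    define A where "A = ({..<N'} \<times> (UNIV :: 'n set)) <+> ({..<L} \<times> (UNIV :: 'n set))"
    define idx :: "(nat \<times> 'n) + (nat \<times> 'n) \<Rightarrow> 'n" where "idx = case_sum snd snd"
    define sa where "sa = case_sum (\<lambda>(k, j :: 'n). min T (t' k)) (\<lambda>(l, j :: 'n). z l)"
    define ta where "ta = case_sum (\<lambda>(k, j :: 'n). min T (t' (Suc k))) (\<lambda>(l, j :: 'n). z (Suc l))"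
    \<comment> \<open>If \<open>t' k \<ge> T\<close>, the interval clipped at \<open>T\<close>
      starts at \<open>T\<close>, possibly too early for \<open>H' k\<close> to be measurable. Its
      increment is 0, so replacing the coefficient by 0 keeps the sum and restores
      adaptedness.\<close>
    define \<alpha> where "\<alpha> = case_sum (\<lambda>(k, j) \<omega>. if t' k < T then H' k \<omega> $ r $ j else 0) (\<lambda>(l, j) \<omega>. - a l j)"
    have sumA: "(\<Sum>x\<in>A. g x) = (\<Sum>k<N'. \<Sum>j\<in>UNIV. g (Inl (k, j))) + (\<Sum>l<L. \<Sum>j\<in>UNIV. g (Inr (l, j)))"
      for g :: "_ \<Rightarrow> real"
      unfolding A_def by (subst sum.Plus) (auto simp: sum.cartesian_product o_def split_def)
    have ad: "adapted (min T (t' k)) (\<lambda>\<omega>. if t' k < T then H' k \<omega> $ r $ j else 0)" if k: "k < N'" for k j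
    proof (cases "t' k < T")
      case True
      obtain C where C: "\<forall>\<omega>\<in>space M. norm (H' k \<omega>) \<le> C" using sH(4)[OF k] by blast
      have "\<bar>H' k \<omega> $ r $ j\<bar> \<le> C" if "\<omega> \<in> space M" for \<omega>
        using C that component_le_norm_cart[of "H' k \<omega> $ r" j] Finite_Cartesian_Product.norm_nth_le[of "H' k \<omega>" r] by fastforce
      moreover have "(\<lambda>\<omega>. H' k \<omega> $ r $ j) \<in> borel_measurable (\<F> (t' k))"
        by (intro measurable_compose[OF sH(3)[OF k]] borel_measurable_continuous_onI continuous_intros)
      ultimately show ?thesis using True unfolding adapted_def by auto
    next
      case False
      then show ?thesis using adapted_const[of _ 0] by simp
    qed
    have S_eq: "(\<Sum>x\<in>A. \<alpha> x \<omega> * D (idx x) (sa x) (ta x) \<omega>) = ?si q \<omega> $ r - ?W \<omega>" for \<omega>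
    proof -
      have eq: "(if t' k < T then H' k \<omega> $ r $ j else 0) * D j (min T (t' k)) (min T (t' (Suc k))) \<omega>
          = H' k \<omega> $ r $ j * D j (min T (t' k)) (min T (t' (Suc k))) \<omega>" if "k < N'" for k j
        using sH(2)[OF that] by (auto simp: D_def min_def)
      then show ?thesis
        unfolding sumA simple_integral_component N'_def[symmetric] t'_def[symmetric] H'_def[symmetric]
        by (simp add: \<alpha>_def idx_def sa_def ta_def sum_negf del: if_cancel mult_cancel_right)
          (intro sum.cong refl, simp only: lessThan_iff eq)
    qed
    have "(\<integral>\<^sup>+\<omega>. ennreal ((?si q \<omega> $ r - ?W \<omega>)\<^sup>2) \<partial>M)
      = (\<integral>\<^sup>+\<omega>. \<integral>\<^sup>+s. ennreal (\<Sum>i\<in>UNIV.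
        (\<Sum>x\<in>A. if idx x = i then \<alpha> x \<omega> * indicator {sa x<..ta x} s else 0)\<^sup>2) \<partial>lborel \<partial>M)"
      unfolding S_eq[symmetric]
    proof (rule ito_isometry)
      show "finite A" by (simp add: A_def)
      show "0 \<le> sa x \<and> sa x \<le> ta x" if "x \<in> A" for x
        using that T t0 sH(2) z unfolding A_def sa_def ta_def
        by (fastforce intro: min.mono less_imp_le simp: Suc_le_eq)
      show "adapted (sa x) (\<alpha> x)" if "x \<in> A" for x
        using that ad adapted_const unfolding A_def sa_def \<alpha>_def by auto
    qed
    also have "(\<integral>\<^sup>+\<omega>. \<integral>\<^sup>+s. ennreal (\<Sum>i\<in>UNIV.
        (\<Sum>x\<in>A. if idx x = i then \<alpha> x \<omega> * indicator {sa x<..ta x} s else 0)\<^sup>2) \<partial>lborel \<partial>M)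
      \<le> (\<integral>\<^sup>+\<omega>. (\<integral>\<^sup>+s. 2 * (ennreal ((norm (?sv q s \<omega> - \<Phi> s))\<^sup>2) * indicator {0..T} s)
           + ennreal (2 * e) * indicator {0..T} s \<partial>lborel) \<partial>M)"
    proof (intro nn_integral_mono)
      fix \<omega> s
      let ?g = "\<lambda>i. \<Sum>l<L. a l i * indicator {z l<..z (Suc l)} s"
      let ?q = "\<lambda>i. \<Sum>x\<in>A. if idx x = i then \<alpha> x \<omega> * indicator {sa x<..ta x} s else 0 :: real"
      have q: "?q i = (\<Sum>k<N'. (if t' k < T then H' k \<omega> $ r $ i else 0) * indicator {min T (t' k)<..min T (t' (Suc k))} s) - ?g i" for i
        unfolding sumA by (simp add: \<alpha>_def idx_def sa_def ta_def sum_negf)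
      show "ennreal (\<Sum>i\<in>UNIV. (?q i)\<^sup>2) \<le> 2 * (ennreal ((norm (?sv q s \<omega> - \<Phi> s))\<^sup>2) * indicator {0..T} s)
           + ennreal (2 * e) * indicator {0..T} s"
      \<comment> \<open>Outside \<open>(0, T]\<close> all indicators are 0: the intervals are
        clipped at \<open>T\<close> and open on the left, which excludes the point 0.\<close>
      proof (cases "0 < s \<and> s \<le> T")
        case False
        have "indicator {min T (t' k)<..min T (t' (Suc k))} s = (0::real)" if "k < N'" for k
          using False t0[of k] that T by (auto simp: indicator_def)
        moreover have "indicator {z l<..z (Suc l)} s = (0::real)" if "l < L" for l
          using False z[OF that] by (auto simp: indicator_def)
        ultimately show ?thesis unfolding q by simp
      next
        case True
        have "?q i = ?sv q s \<omega> $ r $ i - ?g i" for i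
        proof -
          have "(if t' k < T then H' k \<omega> $ r $ i else 0) * indicator {min T (t' k)<..min T (t' (Suc k))} s
             = indicator {t' k<..t' (Suc k)} s * H' k \<omega> $ r $ i" if "k < N'" for k
            using True by (auto simp: indicator_def)
          then show ?thesis unfolding q
            by (simp add: simple_value_def sum_component N'_def t'_def H'_def)
        qed
        moreover have "(x - w)\<^sup>2 \<le> 2 * (x - y)\<^sup>2 + 2 * (y - w)\<^sup>2" for x y w :: real
          using zero_le_power2[of "(x - y) - (y - w)"] by (simp add: power2_eq_square algebra_simps)
        ultimately have "(?q i)\<^sup>2 \<le> 2 * (?sv q s \<omega> $ r $ i - \<Phi> s $ r $ i)\<^sup>2 + 2 * (\<Phi> s $ r $ i - ?g i)\<^sup>2" for i
          by (simp only:)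
        then have "(\<Sum>i\<in>UNIV. (?q i)\<^sup>2) \<le> (\<Sum>i\<in>UNIV. 2 * (?sv q s \<omega> $ r $ i - \<Phi> s $ r $ i)\<^sup>2 + 2 * (\<Phi> s $ r $ i - ?g i)\<^sup>2)"
          by (intro sum_mono)
        also have "\<dots> = 2 * (\<Sum>i\<in>UNIV. (?sv q s \<omega> $ r $ i - \<Phi> s $ r $ i)\<^sup>2) + 2 * (\<Sum>i\<in>UNIV. (\<Phi> s $ r $ i - ?g i)\<^sup>2)"
          by (simp add: sum.distrib sum_distrib_left)
        also have "\<dots> \<le> 2 * (norm (?sv q s \<omega> - \<Phi> s))\<^sup>2 + 2 * e"
        proof -
          have "(\<Sum>i\<in>UNIV. (?sv q s \<omega> $ r $ i - \<Phi> s $ r $ i)\<^sup>2) = (norm ((?sv q s \<omega> - \<Phi> s) $ r))\<^sup>2"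
            by (simp add: norm_vec_def L2_set_def sum_nonneg)
          also have "\<dots> \<le> (norm (?sv q s \<omega> - \<Phi> s))\<^sup>2"
            by (intro power_mono Finite_Cartesian_Product.norm_nth_le) auto
          finally show ?thesis using approx[of s] True by auto
        qed
        finally have "ennreal (\<Sum>i\<in>UNIV. (?q i)\<^sup>2) \<le> ennreal (2 * (norm (?sv q s \<omega> - \<Phi> s))\<^sup>2 + 2 * e)"
          by (rule ennreal_leI)
        also have "\<dots> = 2 * ennreal ((norm (?sv q s \<omega> - \<Phi> s))\<^sup>2) + ennreal (2 * e)"
          using e by (simp add: ennreal_mult' ennreal_numeral)
        finally show ?thesis using True by simp
      qed
    qed
    also have "\<dots> = (\<integral>\<^sup>+\<omega>. 2 * (\<integral>\<^sup>+s\<in>{0..T}. ennreal ((norm (?sv q s \<omega> - \<Phi> s))\<^sup>2) \<partial>lborel) + ennreal (2 * e * T) \<partial>M)"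
    proof (intro nn_integral_cong)
      fix \<omega>
      have [measurable]: "(\<lambda>s. ?sv q s \<omega>) \<in> borel_measurable borel"
        unfolding simple_value_def by measurable
      note \<Phi>[measurable]
      have "(\<integral>\<^sup>+s. ennreal (2 * e) * indicator {0..T} s \<partial>lborel) = ennreal (2 * e * T)"
        using T e by (simp add: nn_integral_cmult_indicator ennreal_mult)
      then show "(\<integral>\<^sup>+s. 2 * (ennreal ((norm (?sv q s \<omega> - \<Phi> s))\<^sup>2) * indicator {0..T} s)
           + ennreal (2 * e) * indicator {0..T} s \<partial>lborel)
        = 2 * (\<integral>\<^sup>+s\<in>{0..T}. ennreal ((norm (?sv q s \<omega> - \<Phi> s))\<^sup>2) \<partial>lborel) + ennreal (2 * e * T)"
        by (simp add: nn_integral_add nn_integral_cmult)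
    qed
    also have "\<dots> = 2 * c1 q + ennreal (2 * e * T)"
    proof -
      have [measurable]: "k < N' \<Longrightarrow> H' k \<in> borel_measurable M" for k by (rule Hm')
      note \<Phi>[measurable]
      have "(\<lambda>(\<omega>, s). ?sv q s \<omega>) \<in> borel_measurable (M \<Otimes>\<^sub>M lborel)"
        unfolding simple_value_def case_prod_beta N'_def[symmetric] t'_def[symmetric] H'_def[symmetric]
        by (intro borel_measurable_sum borel_measurable_scaleR) (auto intro: measurable_compose[OF measurable_fst])
      then have [measurable]: "(\<lambda>x. ?sv q (snd x) (fst x)) \<in> borel_measurable (M \<Otimes>\<^sub>M lborel)"
        by (simp add: case_prod_beta)
      have "(\<lambda>(\<omega>, s). ennreal ((norm (?sv q s \<omega> - \<Phi> s))\<^sup>2) * indicator {0..T} s) \<in> borel_measurable (M \<Otimes>\<^sub>M lborel)"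
        unfolding case_prod_beta by measurable
      then have "(\<lambda>\<omega>. \<integral>\<^sup>+s\<in>{0..T}. ennreal ((norm (?sv q s \<omega> - \<Phi> s))\<^sup>2) \<partial>lborel) \<in> borel_measurable M"
        by (rule lborel.borel_measurable_nn_integral)
      then show ?thesis
        by (simp add: nn_integral_add nn_integral_cmult c1_def emeasure_space_1)
    qed
    finally show "(\<integral>\<^sup>+\<omega>. ennreal ((?si q \<omega> $ r - ?W \<omega>)\<^sup>2) \<partial>M) \<le> 2 * c1 q + ennreal (2 * e * T)" .
  qed
  have sim: "(\<lambda>\<omega>. ?si q \<omega> $ r) \<in> borel_measurable M" for q
    unfolding simple_integral_component
    by (intro borel_measurable_sum borel_measurable_times Dm tk measurable_compose[OF Hm] 
        borel_measurable_continuous_onI continuous_intros) auto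
  have Yrm: "(\<lambda>\<omega>. Y \<omega> $ r) \<in> borel_measurable M"
    by (rule measurable_compose[OF Ym borel_measurable_vec_nth])
  have bound: "(\<integral>\<^sup>+\<omega>. ennreal ((Y \<omega> $ r - ?W \<omega>)\<^sup>2) \<partial>M) \<le> 2 * c2 q + 2 * (2 * c1 q + ennreal (2 * e * T))" for q
  proof -
    have "(\<integral>\<^sup>+\<omega>. ennreal ((Y \<omega> $ r - ?W \<omega>)\<^sup>2) \<partial>M)
        \<le> (\<integral>\<^sup>+\<omega>. 2 * ennreal ((?si q \<omega> $ r - Y \<omega> $ r)\<^sup>2) + 2 * ennreal ((?si q \<omega> $ r - ?W \<omega>)\<^sup>2) \<partial>M)"
    proof (intro nn_integral_mono)
      fix \<omega>
      have "(y - w)\<^sup>2 \<le> 2 * (x - y)\<^sup>2 + 2 * (x - w)\<^sup>2" for x y w :: real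
        using zero_le_power2[of "(x - y) + (x - w)"] by (simp add: power2_eq_square algebra_simps)
      then have "ennreal ((Y \<omega> $ r - ?W \<omega>)\<^sup>2) \<le> ennreal (2 * (?si q \<omega> $ r - Y \<omega> $ r)\<^sup>2 + 2 * (?si q \<omega> $ r - ?W \<omega>)\<^sup>2)"
        by (intro ennreal_leI)
      then show "ennreal ((Y \<omega> $ r - ?W \<omega>)\<^sup>2) \<le> 2 * ennreal ((?si q \<omega> $ r - Y \<omega> $ r)\<^sup>2) + 2 * ennreal ((?si q \<omega> $ r - ?W \<omega>)\<^sup>2)"
        by (simp add: ennreal_mult' ennreal_numeral)
    qed
    also have "\<dots> = 2 * (\<integral>\<^sup>+\<omega>. ennreal ((?si q \<omega> $ r - Y \<omega> $ r)\<^sup>2) \<partial>M) + 2 * (\<integral>\<^sup>+\<omega>. ennreal ((?si q \<omega> $ r - ?W \<omega>)\<^sup>2) \<partial>M)"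
      using sim Yrm Wm by (simp add: nn_integral_add nn_integral_cmult)
    also have "\<dots> \<le> 2 * c2 q + 2 * (2 * c1 q + ennreal (2 * e * T))"
    proof (intro add_mono mult_left_mono key)
      have "(?si q \<omega> $ r - Y \<omega> $ r)\<^sup>2 \<le> (norm (?si q \<omega> - Y \<omega>))\<^sup>2" for \<omega>
        using component_le_norm_cart[of "?si q \<omega> - Y \<omega>" r] by (intro abs_le_square_iff[THEN iffD1]) simp
      then show "(\<integral>\<^sup>+\<omega>. ennreal ((?si q \<omega> $ r - Y \<omega> $ r)\<^sup>2) \<partial>M) \<le> c2 q"
        unfolding c2_def by (intro nn_integral_mono ennreal_leI)
    qed auto
    finally show ?thesis .
  qed
  have "(\<lambda>q. 2 * c2 q + 2 * (2 * c1 q + ennreal (2 * e * T))) \<longlonglongrightarrow> 2 * 0 + 2 * (2 * 0 + ennreal (2 * e * T))"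
    using conv1 conv2 unfolding c1_def[symmetric] c2_def[symmetric]
    by (intro tendsto_add ennreal_tendsto_cmult tendsto_const) auto
  then have "(\<integral>\<^sup>+\<omega>. ennreal ((Y \<omega> $ r - ?W \<omega>)\<^sup>2) \<partial>M) \<le> 2 * 0 + 2 * (2 * 0 + ennreal (2 * e * T))"
    by (rule LIMSEQ_le_const) (use bound in blast)
  also have "\<dots> = ennreal (4 * e * T)"
  proof -
    have "4 * e * T = 2 * (2 * e * T)" by simp
    then show ?thesis by (simp only: ennreal_mult' ennreal_numeral mult_zero_right add_0)
  qed
  finally show ?thesis .
qed

end

section \<open>Deterministic integrands\<close>

lemma funpow_diagonal_matrix:
  "((**) (diagonal_matrix q) ^^ k) (Finite_Cartesian_Product.mat 1) = diagonal_matrix (\<chi> j. (q $ j) ^ k)"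
proof (induction k)
  case 0
  show ?case by (simp add: diagonal_matrix_def Finite_Cartesian_Product.mat_def Finite_Cartesian_Product.vec_eq_iff)
next
  case (Suc k)
  have "diagonal_matrix q ** diagonal_matrix (\<chi> j. (q $ j) ^ k) = diagonal_matrix (\<chi> j. (q $ j) ^ Suc k)"
    by (simp add: diagonal_matrix_def matrix_matrix_mult_def Finite_Cartesian_Product.vec_eq_iff mult_delta_left)
  then show ?case using Suc by simp
qed

lemma matrix_exp_diagonal_matrix:
  "matrix_exp (diagonal_matrix q) = diagonal_matrix (\<chi> j. exp (q $ j))"
proof -
  have "(\<lambda>k. (1 / fact k) *\<^sub>R diagonal_matrix (\<chi> j. (q $ j) ^ k)) sums diagonal_matrix (\<chi> j. exp (q $ j))"
    unfolding sums_def
  proof (intro vec_tendstoI)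
    fix i j
    have "(\<lambda>n. \<Sum>k<n. (q $ i) ^ k /\<^sub>R fact k) \<longlonglongrightarrow> exp (q $ i)"
      using exp_converges[of "q $ i"] by (simp add: sums_def)
    then show "(\<lambda>n. (\<Sum>k<n. (1 / fact k) *\<^sub>R diagonal_matrix (\<chi> j. (q $ j) ^ k)) $ i $ j)
        \<longlonglongrightarrow> diagonal_matrix (\<chi> j. exp (q $ j)) $ i $ j"
      by (cases "i = j") (simp_all add: diagonal_matrix_def sum_component inverse_eq_divide)
  qed
  then show ?thesis
    unfolding matrix_exp_def funpow_diagonal_matrix by (rule sums_unique[symmetric])
qed

lemma matrix_exp_scaleR_diagonal_matrix:
  "matrix_exp (y *\<^sub>R diagonal_matrix p) = diagonal_matrix (\<chi> j. exp (y * p $ j))"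
proof -
  have "y *\<^sub>R diagonal_matrix p = diagonal_matrix (\<chi> j. y * p $ j)"
    by (simp add: diagonal_matrix_def Finite_Cartesian_Product.vec_eq_iff)
  then show ?thesis by (simp add: matrix_exp_diagonal_matrix)
qed

lemma diagonal_matrix_mult_vec: "(diagonal_matrix q *v v) $ j = q $ j * v $ j"
  by (simp add: diagonal_matrix_def matrix_vector_mult_def mult_delta_left)

text \<open>The mean is dominated by the root mean square; the pointwise bound
  \<open>\<bar>U\<bar> \<le> U\<^sup>2 / (2 * K) + K / 2\<close> takes the place of the
  Cauchy-Schwarz inequality and gives integrability as well.\<close>

lemma integral_abs_le_of_nn_integral_square:
  fixes U :: "'a \<Rightarrow> real"
  assumes "prob_space M" and U: "U \<in> borel_measurable M" and K: "0 < K"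
    and le: "(\<integral>\<^sup>+\<omega>. ennreal ((U \<omega>)\<^sup>2) \<partial>M) \<le> ennreal (K\<^sup>2)"
  shows "integrable M U" and "(LINT \<omega>|M. \<bar>U \<omega>\<bar>) \<le> K"
proof -
  interpret prob_space M by fact
  have i2: "integrable M (\<lambda>\<omega>. (U \<omega>)\<^sup>2)"
    using U le by (intro integrableI_nonneg) (auto intro: le_less_trans)
  have "ennreal (LINT \<omega>|M. (U \<omega>)\<^sup>2) \<le> ennreal (K\<^sup>2)"
    using le nn_integral_eq_integral[OF i2] by simp
  then have e: "(LINT \<omega>|M. (U \<omega>)\<^sup>2) \<le> K\<^sup>2" by simp
  have b: "\<bar>U \<omega>\<bar> \<le> (U \<omega>)\<^sup>2 / (2 * K) + K / 2" for \<omega>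
  proof -
    have "0 \<le> (\<bar>U \<omega>\<bar> - K)\<^sup>2" by simp
    then have "2 * K * \<bar>U \<omega>\<bar> \<le> (U \<omega>)\<^sup>2 + K\<^sup>2"
      by (simp add: power2_diff mult_ac)
    then show ?thesis using K by (simp add: field_simps power2_eq_square)
  qed
  have bi: "integrable M (\<lambda>\<omega>. (U \<omega>)\<^sup>2 / (2 * K) + K / 2)" using i2 by simp
  show "integrable M U"
    by (rule Bochner_Integration.integrable_bound[OF bi U]) (use b in \<open>auto intro: order_trans[OF _ abs_ge_self]\<close>)
  then have "(LINT \<omega>|M. \<bar>U \<omega>\<bar>) \<le> (LINT \<omega>|M. (U \<omega>)\<^sup>2 / (2 * K) + K / 2)"
    using bi b by (intro integral_mono) auto
  also have "\<dots> = (LINT \<omega>|M. (U \<omega>)\<^sup>2) / (2 * K) + K / 2"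
    using i2 by (simp add: prob_space)
  also have "\<dots> \<le> K\<^sup>2 / (2 * K) + K / 2"
    using e K by (intro add_right_mono divide_right_mono) auto
  also have "\<dots> = K" using K by (simp add: power2_eq_square)
  finally show "(LINT \<omega>|M. \<bar>U \<omega>\<bar>) \<le> K" .
qed

lemma abs_cos_diff_le: "\<bar>cos a - cos b\<bar> \<le> \<bar>a - b :: real\<bar>"
proof -
  have "\<bar>cos a - cos b\<bar> = 2 * (\<bar>sin ((a + b) / 2)\<bar> * \<bar>sin ((b - a) / 2)\<bar>)"
    by (simp add: cos_diff_cos abs_mult)
  also have "\<dots> \<le> 2 * (1 * \<bar>(b - a) / 2\<bar>)"
    by (intro mult_left_mono mult_mono abs_sin_le_one abs_sin_x_le_abs_x) auto
  finally show ?thesis by simp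
qed

section \<open>Variance of the exponential integrand and its step approximation\<close>

text \<open>\<open>exp_var p y\<close> is the integral of \<open>exp (-2 p z)\<close> over \<open>0 \<le> z \<le> y\<close>.\<close>
definition exp_var :: "real \<Rightarrow> real \<Rightarrow> real" where
  "exp_var p y = (if p = 0 then y else (1 - exp (- 2 * p * y)) / (2 * p))"

lemma exp_var_0 [simp]: "exp_var p 0 = 0"
  by (simp add: exp_var_def)

lemma DERIV_exp_var: "(exp_var p has_real_derivative exp (- p * y) ^ 2) (at y)"
proof (cases "p = 0")
  case True
  then show ?thesis by (auto simp: exp_var_def[abs_def])
next
  case False
  have "exp (- p * y) ^ 2 = exp (- 2 * p * y)" by (simp add: exp_double[symmetric])
  then show ?thesis using False unfolding exp_var_def
    by (auto intro!: derivative_eq_intros)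
qed

text \<open>The isometry in closed form: integrals of \<open>exp (- p z)\<close> up to
  \<open>s\<close> and up to \<open>t\<close> share the interval up to \<open>min s t\<close>, and
  the outer exponentials are the factors in front of the integrals in \<xi>.\<close>

lemma cov_kernel_eq_exp_var:
  "0 \<le> s \<Longrightarrow> 0 \<le> t \<Longrightarrow> cov_kernel s t p = exp (s * p) * exp (t * p) * exp_var p (min s t)"
proof -
  assume st: "0 \<le> s" "0 \<le> t"
  have "exp (s * p) * exp (t * p) * exp (- 2 * p * min s t) = exp (p * \<bar>s - t\<bar>)"
    by (simp add: exp_add[symmetric] min_def abs_if algebra_simps)
  then show ?thesis
    by (simp add: cov_kernel_def exp_var_def right_diff_distrib exp_add[symmetric] algebra_simps)
qed

text \<open>The values of the approximating step function are taken at mean value points, which makes its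
  \<open>L\<^sup>2\<close> norm on each cell exact.\<close>
lemma exp_step_function:
  fixes p :: "real ^ 'n"
  assumes x: "0 < x" and e: "0 < e"
  obtains h0 where "0 < h0"
    and "\<And>h. 0 < h \<Longrightarrow> h < h0 \<Longrightarrow> \<exists>a. \<forall>l j. real (Suc l) * h \<le> x \<longrightarrow>
        (a l j)\<^sup>2 * h = exp_var (p $ j) (real (Suc l) * h) - exp_var (p $ j) (real l * h) \<and>
        (\<forall>y\<in>{real l * h<..real (Suc l) * h}. \<bar>exp (- y * p $ j) - a l j\<bar> \<le> e)"
proof -
  \<comment> \<open>The coordinates are bundled into one vector valued function, so that a single
    \<open>h0\<close> serves all of them.\<close>
  have "continuous_on {0..x} (\<lambda>y. \<chi> j. exp (- y * p $ j))"
    by (intro continuous_intros)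
  then have "uniformly_continuous_on {0..x} (\<lambda>y. \<chi> j. exp (- y * p $ j))"
    by (rule compact_uniformly_continuous) simp
  then obtain h0 where h0: "0 < h0" "\<And>y y'. y \<in> {0..x} \<Longrightarrow> y' \<in> {0..x} \<Longrightarrow> dist y' y < h0 \<Longrightarrow>
      dist (\<chi> j. exp (- y' * p $ j)) (\<chi> j. exp (- y * p $ j)) < e"
    unfolding uniformly_continuous_on_def using e by blast
  have "\<exists>a. \<forall>l j. real (Suc l) * h \<le> x \<longrightarrow>
        (a l j)\<^sup>2 * h = exp_var (p $ j) (real (Suc l) * h) - exp_var (p $ j) (real l * h) \<and>
        (\<forall>y\<in>{real l * h<..real (Suc l) * h}. \<bar>exp (- y * p $ j) - a l j\<bar> \<le> e)"
    if h: "0 < h" "h < h0" for h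
  proof -
    have "\<exists>b. real (Suc l) * h \<le> x \<longrightarrow>
        b\<^sup>2 * h = exp_var (p $ j) (real (Suc l) * h) - exp_var (p $ j) (real l * h) \<and>
        (\<forall>y\<in>{real l * h<..real (Suc l) * h}. \<bar>exp (- y * p $ j) - b\<bar> \<le> e)" for l j
    proof (cases "real (Suc l) * h \<le> x")
      case True
      have "real l * h < real (Suc l) * h" using h by simp
      from MVT2[OF this DERIV_exp_var]
      obtain \<xi> where \<xi>: "real l * h < \<xi>" "\<xi> < real (Suc l) * h"
        "exp_var (p $ j) (real (Suc l) * h) - exp_var (p $ j) (real l * h)
          = (real (Suc l) * h - real l * h) * exp (- (p $ j) * \<xi>) ^ 2" by blast
      have "0 \<le> real l * h" using h by simp
      have "\<bar>exp (- y * p $ j) - exp (- (p $ j) * \<xi>)\<bar> \<le> e" if y: "real l * h < y" "y \<le> real (Suc l) * h" for y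
      proof -
        have "real (Suc l) * h = real l * h + h" by (simp add: distrib_right)
        then have "0 \<le> y" "y \<le> x" "0 \<le> \<xi>" "\<xi> \<le> x" "\<bar>y - \<xi>\<bar> < h0"
          using y \<xi>(1,2) True \<open>0 \<le> real l * h\<close> h by linarith+
        then have "dist (\<chi> j. exp (- y * p $ j)) (\<chi> j. exp (- \<xi> * p $ j)) < e"
          by (intro h0(2)) (simp_all add: dist_real_def)
        moreover have "\<bar>exp (- y * p $ j) - exp (- \<xi> * p $ j)\<bar>
            \<le> dist (\<chi> j. exp (- y * p $ j)) (\<chi> j. exp (- \<xi> * p $ j))"
          using dist_vec_nth_le[of "\<chi> j. exp (- y * p $ j)" j "\<chi> j. exp (- \<xi> * p $ j)"]
          by (simp add: dist_real_def)
        ultimately show ?thesis by (simp add: mult.commute)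
      qed
      moreover have "exp (- (p $ j) * \<xi>) ^ 2 * h = exp_var (p $ j) (real (Suc l) * h) - exp_var (p $ j) (real l * h)"
        unfolding \<xi>(3) by (simp add: algebra_simps)
      ultimately show ?thesis by (intro exI[of _ "exp (- (p $ j) * \<xi>)"]) auto
    qed auto
    then have "\<forall>l j. \<exists>b. real (Suc l) * h \<le> x \<longrightarrow>
        b\<^sup>2 * h = exp_var (p $ j) (real (Suc l) * h) - exp_var (p $ j) (real l * h) \<and>
        (\<forall>y\<in>{real l * h<..real (Suc l) * h}. \<bar>exp (- y * p $ j) - b\<bar> \<le> e)" by blast
    then show ?thesis by metis
  qed
  then show ?thesis using that h0(1) by blast
qed

lemma (in prob_space) normal_distributed_char:
  assumes \<sigma>: "0 < \<sigma>" and D: "distributed M lborel X (normal_density 0 \<sigma>)"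
  shows "(LINT \<omega>|M. cis (v * X \<omega>)) = complex_of_real (exp (- (v * \<sigma>)\<^sup>2 / 2))"
proof -
  have X: "X \<in> borel_measurable M" using distributed_measurable[OF D] by simp
  have "distributed M lborel (\<lambda>\<omega>. X \<omega> / \<sigma>) std_normal_density"
    using normal_standard_normal_convert[OF \<sigma>, of X 0] D by simp
  then have ds: "distr M lborel (\<lambda>\<omega>. X \<omega> / \<sigma>) = std_normal_distribution"
    by (simp add: distributed_distr_eq_density)
  have "(LINT \<omega>|M. cis (v * X \<omega>)) = (LINT \<omega>|M. cis ((v * \<sigma>) * (X \<omega> / \<sigma>)))"
    using \<sigma> by simp
  also have "\<dots> = (LINT y|std_normal_distribution. cis ((v * \<sigma>) * y))"
    unfolding ds[symmetric] using X
    by (subst integral_distr) (auto intro!: borel_measurable_continuous_onI continuous_intros)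
  also have "\<dots> = char std_normal_distribution (v * \<sigma>)"
    by (simp add: char_def cis_conv_exp)
  finally show ?thesis unfolding char_std_normal_distribution .
qed

section \<open>Characteristic functions of step sums and of the Ito process\<close>

context brownian
begin

lemma wiener_sum_adapted:
  fixes z :: "nat \<Rightarrow> real" and v :: "nat \<Rightarrow> 'n \<Rightarrow> real"
  assumes z: "\<And>l. l < L \<Longrightarrow> 0 \<le> z l \<and> z l \<le> z (Suc l)" and r: "\<And>l. l < L \<Longrightarrow> z (Suc l) \<le> r"
  shows "(\<lambda>\<omega>. \<Sum>l<L. \<Sum>j\<in>UNIV. v l j * D j (z l) (z (Suc l)) \<omega>) \<in> borel_measurable (\<F> r)"
proof -
  have "D j (z l) (z (Suc l)) \<in> borel_measurable (\<F> r)" if "l < L" for l j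
    using z[OF that] r[OF that] by (intro D_adapted) linarith+
  then show ?thesis by (intro borel_measurable_sum borel_measurable_times borel_measurable_const) auto
qed

text \<open>Induction on the number of cells: the last increment is independent of the sum before
  it, and its own characteristic function is a product over the coordinates.\<close>

lemma wiener_sum_char:
  fixes z :: "nat \<Rightarrow> real" and v :: "nat \<Rightarrow> 'n \<Rightarrow> real"
  assumes z: "0 \<le> z 0" "\<And>l. z l < z (Suc l)"
  shows "(LINT \<omega>|M. cis (\<Sum>l<L. \<Sum>j\<in>UNIV. v l j * D j (z l) (z (Suc l)) \<omega>))
    = complex_of_real (exp (- (\<Sum>l<L. \<Sum>j\<in>UNIV. (v l j)\<^sup>2 * (z (Suc l) - z l)) / 2))"
proof (induction L)
  case 0
  show ?case by (simp add: prob_space)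
next
  case (Suc L)
  let ?S = "\<lambda>L \<omega>. \<Sum>l<L. \<Sum>j\<in>UNIV. v l j * D j (z l) (z (Suc l)) \<omega>"
  have z0: "0 \<le> z l" for l
    by (induction l) (auto simp: z(1) intro: order_trans[OF _ less_imp_le[OF z(2)]])
  have mono: "mono z" using z(2) by (intro mono_iff_le_Suc[THEN iffD2]) (auto intro: less_imp_le)
  define g where "g x = cis (\<Sum>j\<in>UNIV. v L j * x $ j)" for x :: "real ^ 'n"
  have g: "g \<in> borel_measurable borel"
    unfolding g_def by (intro borel_measurable_continuous_onI continuous_intros)
  have gD: "g (B (z (Suc L)) \<omega> - B (z L) \<omega>) = cis (\<Sum>j\<in>UNIV. v L j * D j (z L) (z (Suc L)) \<omega>)" for \<omega>
    by (simp add: g_def D_def)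
  have Z: "(\<lambda>\<omega>. cis (?S L \<omega>)) \<in> borel_measurable (\<F> (z L))"
  proof (rule measurable_compose[OF wiener_sum_adapted])
    show "cis \<in> borel_measurable borel"
      by (intro borel_measurable_continuous_onI continuous_intros)
  qed (use z0 z(2) monoD[OF mono] in \<open>auto intro: less_imp_le\<close>)
  have Zi: "integrable M (\<lambda>\<omega>. cis (?S L \<omega>))"
    using measurable_filtration[OF Z] by (intro integrable_const_bound[where B = 1]) auto
  have "(\<lambda>\<omega>. B (z (Suc L)) \<omega> - B (z L) \<omega>) \<in> borel_measurable M"
    using z0 by (intro borel_measurable_diff B_measurable)
  then have gi: "integrable M (\<lambda>\<omega>. g (B (z (Suc L)) \<omega> - B (z L) \<omega>))"
    by (intro integrable_const_bound[where B = 1] measurable_compose[OF _ g]) (auto simp: g_def)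
  define \<sigma> where "\<sigma> = sqrt (z (Suc L) - z L)"
  have \<sigma>: "0 < \<sigma>" "\<sigma>\<^sup>2 = z (Suc L) - z L" using z(2)[of L] by (auto simp: \<sigma>_def)
  interpret n: prob_space "density lborel (normal_density 0 \<sigma>)"
    using \<sigma>(1) by (rule prob_space_normal_density)
  have ni: "integrable (density lborel (normal_density 0 \<sigma>)) (\<lambda>y. cis (v L j * y))" for j
    by (intro n.integrable_const_bound[where B = 1])
      (auto intro!: borel_measurable_continuous_onI continuous_intros)
  have nI: "(LINT y|density lborel (normal_density 0 \<sigma>). cis (v L j * y))
      = complex_of_real (exp (- ((v L j)\<^sup>2 * (z (Suc L) - z L)) / 2))" for j
  proof -
    have "distributed (density lborel (normal_density 0 \<sigma>)) lborel (\<lambda>y. y) (normal_density 0 \<sigma>)"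
      by (auto simp: distributed_def distr_id2 cong: distr_cong)
    from n.normal_distributed_char[OF \<sigma>(1) this, of "v L j"]
    show ?thesis by (simp add: power_mult_distrib \<sigma>(2))
  qed
  have gI: "(LINT \<omega>|M. g (B (z (Suc L)) \<omega> - B (z L) \<omega>))
      = complex_of_real (exp (- (\<Sum>j\<in>UNIV. (v L j)\<^sup>2 * (z (Suc L) - z L)) / 2))"
  proof -
    have "cis (\<Sum>j\<in>UNIV. v L j * D j (z L) (z (Suc L)) \<omega>) = (\<Prod>j\<in>UNIV. cis (v L j * D j (z L) (z (Suc L)) \<omega>))" for \<omega>
      by (simp add: cis_conv_exp exp_sum[symmetric] sum_distrib_left)
    then have "(LINT \<omega>|M. g (B (z (Suc L)) \<omega> - B (z L) \<omega>))
        = (\<Prod>j\<in>UNIV. complex_of_real (exp (- ((v L j)\<^sup>2 * (z (Suc L) - z L)) / 2)))"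
      unfolding gD nI[symmetric] \<sigma>_def
      using increment_density_integral(2)[OF z0 z(2), where f = "\<lambda>j y. cis (v L j * y)"] ni[unfolded \<sigma>_def] by simp
    also have "\<dots> = complex_of_real (exp (\<Sum>j\<in>UNIV. - ((v L j)\<^sup>2 * (z (Suc L) - z L)) / 2))"
      by (simp only: of_real_prod[symmetric] exp_sum[symmetric] finite)
    finally show ?thesis by (simp add: sum_negf sum_divide_distrib)
  qed
  have "(LINT \<omega>|M. cis (?S (Suc L) \<omega>)) = (LINT \<omega>|M. cis (?S L \<omega>) * g (B (z (Suc L)) \<omega> - B (z L) \<omega>))"
    by (simp add: gD cis_mult)
  also have "\<dots> = (LINT \<omega>|M. cis (?S L \<omega>)) * (LINT \<omega>|M. g (B (z (Suc L)) \<omega> - B (z L) \<omega>))"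
    by (rule increment_mult_integral[OF z0 z(2) Z Zi g gi])
  also have "\<dots> = complex_of_real (exp (- (\<Sum>l<Suc L. \<Sum>j\<in>UNIV. (v l j)\<^sup>2 * (z (Suc l) - z l)) / 2))"
    unfolding Suc.IH gI by (simp add: exp_add[symmetric] of_real_mult[symmetric] add_divide_distrib del: of_real_mult)
  finally show ?case .
qed

text \<open>\<open>U\<close> is the linear combination of samples and \<open>G\<close> its step
  approximation on a mesh through the sampling times. The cell variances are exact, so
  \<open>G\<close> already has the asserted characteristic function for every mesh. As the cosine is
  1-Lipschitz, the error is at most the mean of \<open>\<bar>U - G\<bar>\<close>, which is made
  small through \<open>e\<close>.\<close>

lemma ito_process_char:
  fixes c p :: "real ^ 'n" and J :: "real \<Rightarrow> 'a \<Rightarrow> real ^ 'n"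
  assumes J: "is_ito_process M B (\<lambda>y \<omega>. matrix_exp (- y *\<^sub>R diagonal_matrix p)) J"
    and X: "\<And>t \<omega>. 0 \<le> t \<Longrightarrow> X t \<omega> = c \<bullet> (matrix_exp (t *\<^sub>R diagonal_matrix p) *v J t \<omega>)"
    and x: "0 < x"
  shows "(LINT \<omega>|M. cos (\<Sum>k<N. \<theta> k * X (x * real k / real N) \<omega>))
      = exp (- quad N (\<lambda>k l. \<Sum>j\<in>UNIV. (c $ j)\<^sup>2 * cov_kernel (x * real k / real N) (x * real l / real N) (p $ j)) \<theta> / 2)"
    (is "?lhs = exp (- ?Q / 2)")
proof (cases "N = 0")
  case True
  then show ?thesis by (simp add: quad_def prob_space)
next
  case False
  define T where "T k = x * real k / real N" for k
  have T: "0 \<le> T k" "k < N \<Longrightarrow> T k \<le> x" for k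
    using x False by (auto simp: T_def field_simps)
  define w where "w k j = \<theta> k * (c $ j * exp (T k * p $ j))" for k j
  define U where "U \<omega> = (\<Sum>k<N. \<theta> k * X (T k) \<omega>)" for \<omega>
  have U: "U \<omega> = (\<Sum>k<N. \<Sum>j\<in>UNIV. w k j * J (T k) \<omega> $ j)" for \<omega>
    unfolding U_def w_def using T
    by (simp add: X matrix_exp_scaleR_diagonal_matrix diagonal_matrix_mult_vec inner_vec_def sum_distrib_left mult_ac)
  have JT: "is_ito_integral M B (\<lambda>y \<omega>. matrix_exp (- y *\<^sub>R diagonal_matrix p)) (T k) (J (T k))" for k
    using J T(1) by (auto simp: is_ito_process_def)
  have JTm: "(\<lambda>\<omega>. J (T k) \<omega> $ j) \<in> borel_measurable M" for k j
    using JT[of k] by (auto simp: is_ito_integral_def intro: measurable_compose[OF _ borel_measurable_vec_nth])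
  define C where "C = (\<Sum>k<N. \<Sum>j\<in>UNIV. \<bar>w k j\<bar>)"
  have C0: "0 \<le> C" by (auto simp: C_def intro!: sum_nonneg)
  have close: "\<bar>?lhs - exp (- ?Q / 2)\<bar> \<le> C * (2 * e * sqrt x)" if e: "0 < e" for e
  proof -
    obtain h0 where h0: "0 < h0" "\<And>h. 0 < h \<Longrightarrow> h < h0 \<Longrightarrow> \<exists>a. \<forall>l j. real (Suc l) * h \<le> x \<longrightarrow>
        (a l j)\<^sup>2 * h = exp_var (p $ j) (real (Suc l) * h) - exp_var (p $ j) (real l * h) \<and>
        (\<forall>y\<in>{real l * h<..real (Suc l) * h}. \<bar>exp (- y * p $ j) - a l j\<bar> \<le> e)"
      using exp_step_function[OF x e, of p] by blast
    \<comment> \<open>Each of the \<open>N\<close> sampling intervals is divided into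
      \<open>m\<close> cells. Hence every sampling time is a mesh point,
      \<open>T k = z (k * m)\<close>, and the width \<open>h\<close> stays below
      \<open>h0\<close>.\<close>
    obtain m :: nat where m: "m > 0" "x / real m < h0"
      using h0(1) x real_arch_inverse[of "h0 / x"] by (auto simp: field_simps)
    define h where "h = x / (real N * real m)"
    have h: "0 < h" using x False m(1) by (simp add: h_def)
    have "h \<le> x / real m" unfolding h_def using x False m(1) by (intro divide_left_mono) auto
    then have "h < h0" using m(2) by simp
    then obtain a where a: "\<And>l j. real (Suc l) * h \<le> x \<Longrightarrow>
        (a l j)\<^sup>2 * h = exp_var (p $ j) (real (Suc l) * h) - exp_var (p $ j) (real l * h)"
      "\<And>l j y. real (Suc l) * h \<le> x \<Longrightarrow> real l * h < y \<Longrightarrow> y \<le> real (Suc l) * h \<Longrightarrow> \<bar>exp (- y * p $ j) - a l j\<bar> \<le> e"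
      using h0(2)[OF h] by (metis greaterThanAtMost_iff)
    define z where "z l = real l * h" for l
    have Tz: "T k = z (k * m)" for k using False m(1) by (simp add: T_def z_def h_def)
    have xz: "x = z (N * m)" using False m(1) by (simp add: z_def h_def)
    have zS: "z (Suc l) \<le> x" if "l < N * m" for l
    proof -
      have "real (Suc l) \<le> real (N * m)" using that by (intro of_nat_mono) simp
      then show ?thesis unfolding xz z_def using h by (intro mult_right_mono) auto
    qed
    have zmono: "z l \<le> z l'" if "l \<le> l'" for l l'
      unfolding z_def using that h by (intro mult_right_mono) auto
    have zless: "z l < z (Suc l)" for l unfolding z_def using h by simp
    have zdiff: "z (Suc l) - z l = h" for l by (simp add: z_def algebra_simps)
    have z0: "0 \<le> z l" for l unfolding z_def using h by simp
    define W where "W k j \<omega> = (\<Sum>l<k * m. a l j * D j (z l) (z (Suc l)) \<omega>)" for k j \<omega>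
    have Wm: "W k j \<in> borel_measurable M" for k j
      unfolding W_def using z0 by (intro borel_measurable_sum borel_measurable_times borel_measurable_const D_measurable)
    have JW: "integrable M (\<lambda>\<omega>. J (T k) \<omega> $ j - W k j \<omega>) \<and> expectation (\<lambda>\<omega>. \<bar>J (T k) \<omega> $ j - W k j \<omega>\<bar>) \<le> 2 * e * sqrt x"
      if k: "k < N" for k j
    proof -
      let ?\<Phi> = "\<lambda>y. matrix_exp (- y *\<^sub>R diagonal_matrix p)"
      have \<Phi>_eq: "?\<Phi> y = (\<chi> i j. if i = j then exp (- y * p $ i) else 0)" for y
        by (subst matrix_exp_scaleR_diagonal_matrix)
          (simp add: diagonal_matrix_def Finite_Cartesian_Product.vec_eq_iff)
      have kN: "k * m \<le> N * m" using k by simp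
      have W_eq: "W k j \<omega> = (\<Sum>l<k * m. \<Sum>i\<in>UNIV. (if i = j then a l j else 0) * D i (z l) (z (Suc l)) \<omega>)" for \<omega>
        unfolding W_def by (simp add: mult_delta_left)
      have "(\<integral>\<^sup>+\<omega>. ennreal ((J (T k) \<omega> $ j - W k j \<omega>)\<^sup>2) \<partial>M)
        \<le> ennreal (4 * e\<^sup>2 * T k)"
        unfolding W_eq
      proof (rule deterministic_ito_bound[OF JT T(1)])
        show "?\<Phi> \<in> borel_measurable borel"
          unfolding \<Phi>_eq
        proof (intro borel_measurable_continuous_onI continuous_on_vec_lambda)
          show "continuous_on UNIV (\<lambda>y. if i = j then exp (- y * p $ i) else 0)" for i j
            by (cases "i = j") (auto intro!: continuous_intros)
        qed
        show "0 \<le> z l \<and> z l \<le> z (Suc l) \<and> z (Suc l) \<le> T k" if "l < k * m" for l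
          unfolding Tz using that z0 zmono by (simp add: Suc_le_eq)
        fix y assume y: "0 < y" "y \<le> T k"
        have "\<exists>l. z l < y \<and> y \<le> z (Suc l) \<and> l < k * m"
        proof -
          \<comment> \<open>The cell containing \<open>y\<close>: minimality gives
            \<open>z l < y\<close>, and for \<open>l = 0\<close> this is the assumption
            \<open>0 < y\<close>.\<close>
          define l where "l = (LEAST l. y \<le> z (Suc l))"
          have km: "k * m \<noteq> 0"
          proof
            assume "k * m = 0"
            then have "z (k * m) = 0" unfolding z_def by (simp only: of_nat_0 mult_zero_left)
            then show False using y unfolding Tz by simp
          qed
          then have ex: "y \<le> z (Suc (k * m - 1))" using y(2) unfolding Tz by simp
          have 1: "y \<le> z (Suc l)" unfolding l_def by (rule LeastI[of "\<lambda>l. y \<le> z (Suc l)", OF ex])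
          have "l \<le> k * m - 1" unfolding l_def by (rule Least_le[of "\<lambda>l. y \<le> z (Suc l)", OF ex])
          moreover have "z l < y"
          proof (cases l)
            case 0
            then show ?thesis using y by (simp add: z_def)
          next
            case (Suc l')
            then have "\<not> y \<le> z (Suc l')" using not_less_Least[of l' "\<lambda>l. y \<le> z (Suc l)"] unfolding l_def by auto
            then show ?thesis using Suc by simp
          qed
          ultimately show ?thesis using 1 km by (intro exI[of _ l]) linarith
        qed
        then obtain l where l: "z l < y" "y \<le> z (Suc l)" "l < k * m" by blast
        have ind: "indicator {z l'<..z (Suc l')} y = (if l' = l then 1 else 0 :: real)" for l'
        proof (cases l' l rule: linorder_cases)
          case less
          then show ?thesis using zmono[of "Suc l'" l] l by (auto simp: indicator_def)
        next
          case greater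
          then show ?thesis using zmono[of "Suc l" l'] l by (auto simp: indicator_def)
        qed (use l in auto)
        have "(\<Sum>l'<k * m. (if i = j then a l' j else 0) * indicator {z l'<..z (Suc l')} y)
            = (if i = j then a l j else 0)" for i
          unfolding ind using l(3) by (simp add: mult_delta_right)
        then have "(\<Sum>i\<in>UNIV. (?\<Phi> y $ j $ i - (\<Sum>l'<k * m. (if i = j then a l' j else 0) * indicator {z l'<..z (Suc l')} y))\<^sup>2)
          = (\<Sum>i\<in>UNIV. if i = j then (exp (- y * p $ j) - a l j)\<^sup>2 else 0)"
          unfolding \<Phi>_eq by (intro sum.cong refl) auto
        also have "\<dots> = (exp (- y * p $ j) - a l j)\<^sup>2" by simp
        also have "\<dots> \<le> e\<^sup>2"
        proof -
          have "real (Suc l) * h \<le> x" using zS[of l] l(3) kN by (simp add: z_def)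
          then have "\<bar>exp (- y * p $ j) - a l j\<bar> \<le> e"
            using l by (intro a(2)) (auto simp: z_def)
          then show ?thesis using e by (intro abs_le_square_iff[THEN iffD1]) simp
        qed
        finally show "(\<Sum>i\<in>UNIV. (?\<Phi> y $ j $ i - (\<Sum>l'<k * m. (if i = j then a l' j else 0) * indicator {z l'<..z (Suc l')} y))\<^sup>2) \<le> e\<^sup>2" .
      qed simp
      also have "ennreal (4 * e\<^sup>2 * T k) \<le> ennreal ((2 * e * sqrt x)\<^sup>2)"
        using T(2)[OF k] x e by (intro ennreal_leI) (simp add: power_mult_distrib)
      finally show ?thesis
        using integral_abs_le_of_nn_integral_square[OF prob_space_axioms, of "\<lambda>\<omega>. J (T k) \<omega> $ j - W k j \<omega>" "2 * e * sqrt x"]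
          JTm Wm e x by auto
    qed
    \<comment> \<open>Regrouping by cells: cell \<open>l\<close> lies before the sampling time
      \<open>T k\<close> iff \<open>l < k * m\<close>, so its increment carries the weights of all
      those samples.\<close>
    define v where "v l j = a l j * (\<Sum>k<N. if l < k * m then w k j else 0)" for l j
    define G where "G \<omega> = (\<Sum>l<N * m. \<Sum>j\<in>UNIV. v l j * D j (z l) (z (Suc l)) \<omega>)" for \<omega>
    have ext: "(\<Sum>l<k * m. f l) = (\<Sum>l<N * m. if l < k * m then f l else 0)" if "k < N" for k and f :: "nat \<Rightarrow> real"
    proof -
      have "k * m \<le> N * m" using that by simp
      then have "l < N * m" if "l < k * m" for l using that by linarith
      then have "{..<N * m} \<inter> {l. l < k * m} = {..<k * m}" by auto
      then show ?thesis by (simp add: sum.If_cases)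
    qed
    have G: "G \<omega> = (\<Sum>k<N. \<Sum>j\<in>UNIV. w k j * W k j \<omega>)" for \<omega>
    proof -
      have "(\<Sum>k<N. \<Sum>j\<in>UNIV. w k j * W k j \<omega>)
          = (\<Sum>k<N. \<Sum>j\<in>UNIV. \<Sum>l<N * m. (if l < k * m then w k j else 0) * (a l j * D j (z l) (z (Suc l)) \<omega>))"
        unfolding W_def by (intro sum.cong refl) (simp add: ext sum_distrib_left if_distrib if_distribR cong: if_cong)
      also have "\<dots> = (\<Sum>k<N. \<Sum>l<N * m. \<Sum>j\<in>UNIV. (if l < k * m then w k j else 0) * (a l j * D j (z l) (z (Suc l)) \<omega>))"
        by (intro sum.cong refl sum.swap)
      also have "\<dots> = (\<Sum>l<N * m. \<Sum>k<N. \<Sum>j\<in>UNIV. (if l < k * m then w k j else 0) * (a l j * D j (z l) (z (Suc l)) \<omega>))"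
        by (rule sum.swap)
      also have "\<dots> = (\<Sum>l<N * m. \<Sum>j\<in>UNIV. \<Sum>k<N. (if l < k * m then w k j else 0) * (a l j * D j (z l) (z (Suc l)) \<omega>))"
        by (intro sum.cong refl sum.swap)
      also have "\<dots> = G \<omega>"
        unfolding G_def v_def by (intro sum.cong refl) (simp add: sum_distrib_left sum_distrib_right mult_ac)
      finally show ?thesis ..
    qed
    have var: "(\<Sum>l<N * m. \<Sum>j\<in>UNIV. (v l j)\<^sup>2 * h) = ?Q"
    proof -
      \<comment> \<open>The cells before both sampling times are those before the earlier one. Their
        exact variances telescope to \<open>exp_var\<close> at the minimum, the factor that appears
        in \<open>cov_kernel_eq_exp_var\<close>.\<close>
      have tel: "(\<Sum>l<N * m. if l < k * m \<and> l < k' * m then (a l j)\<^sup>2 * h else 0) = exp_var (p $ j) (min (T k) (T k'))"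
        if "k < N" "k' < N" for k k' j
      proof -
        have eq: "l < k * m \<and> l < k' * m \<longleftrightarrow> l < min k k' * m" for l
          using m(1) by (auto simp: min_def) (meson le_less_trans less_le_trans mult_le_mono1 nat_le_linear)+
        have "(\<Sum>l<N * m. if l < k * m \<and> l < k' * m then (a l j)\<^sup>2 * h else 0) = (\<Sum>l<min k k' * m. (a l j)\<^sup>2 * h)"
          unfolding eq using that ext[of "min k k'" "\<lambda>l. (a l j)\<^sup>2 * h"] by simp
        also have "\<dots> = (\<Sum>l<min k k' * m. exp_var (p $ j) (z (Suc l)) - exp_var (p $ j) (z l))"
        proof (intro sum.cong refl)
          fix l assume "l \<in> {..<min k k' * m}"
          then have "l < min k k' * m" by simp
          also have "\<dots> \<le> N * m" using that by (intro mult_le_mono1) simp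
          finally show "(a l j)\<^sup>2 * h = exp_var (p $ j) (z (Suc l)) - exp_var (p $ j) (z l)"
            using zS a(1) unfolding z_def by blast
        qed
        also have "\<dots> = exp_var (p $ j) (z (min k k' * m))"
          by (subst sum_lessThan_telescope) (simp add: z_def)
        also have "z (min k k' * m) = min (T k) (T k')"
          unfolding Tz using zmono by (auto simp: min_def antisym)
        finally show ?thesis .
      qed
      have "(\<Sum>l<N * m. \<Sum>j\<in>UNIV. (v l j)\<^sup>2 * h)
        = (\<Sum>l<N * m. \<Sum>j\<in>UNIV. \<Sum>k<N. \<Sum>k'<N. w k j * w k' j * (if l < k * m \<and> l < k' * m then (a l j)\<^sup>2 * h else 0))"
        unfolding v_def power_mult_distrib power2_eq_square[of "sum _ _"] sum_product
        by (intro sum.cong refl) (auto simp: sum_distrib_left sum_distrib_right intro!: sum.cong)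
      also have "\<dots> = (\<Sum>j\<in>UNIV. \<Sum>l<N * m. \<Sum>k<N. \<Sum>k'<N. w k j * w k' j * (if l < k * m \<and> l < k' * m then (a l j)\<^sup>2 * h else 0))"
        by (rule sum.swap)
      also have "\<dots> = (\<Sum>j\<in>UNIV. \<Sum>k<N. \<Sum>l<N * m. \<Sum>k'<N. w k j * w k' j * (if l < k * m \<and> l < k' * m then (a l j)\<^sup>2 * h else 0))"
        by (intro sum.cong refl sum.swap)
      also have "\<dots> = (\<Sum>j\<in>UNIV. \<Sum>k<N. \<Sum>k'<N. \<Sum>l<N * m. w k j * w k' j * (if l < k * m \<and> l < k' * m then (a l j)\<^sup>2 * h else 0))"
        by (intro sum.cong refl sum.swap)
      also have "\<dots> = (\<Sum>j\<in>UNIV. \<Sum>k<N. \<Sum>k'<N. w k j * w k' j * exp_var (p $ j) (min (T k) (T k')))"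
        by (intro sum.cong refl) (simp add: sum_distrib_left[symmetric] tel)
      also have "\<dots> = (\<Sum>j\<in>UNIV. \<Sum>k<N. \<Sum>k'<N. (c $ j)\<^sup>2 * cov_kernel (T k) (T k') (p $ j) * \<theta> k * \<theta> k')"
        by (intro sum.cong refl) (simp add: cov_kernel_eq_exp_var T(1) w_def power2_eq_square mult_ac)
      also have "\<dots> = (\<Sum>k<N. \<Sum>j\<in>UNIV. \<Sum>k'<N. (c $ j)\<^sup>2 * cov_kernel (T k) (T k') (p $ j) * \<theta> k * \<theta> k')"
        by (rule sum.swap)
      also have "\<dots> = (\<Sum>k<N. \<Sum>k'<N. \<Sum>j\<in>UNIV. (c $ j)\<^sup>2 * cov_kernel (T k) (T k') (p $ j) * \<theta> k * \<theta> k')"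
        by (intro sum.cong refl sum.swap)
      also have "\<dots> = ?Q"
        unfolding quad_def T_def by (intro sum.cong refl) (simp add: sum_distrib_right)
      finally show ?thesis .
    qed
    have Gm: "G \<in> borel_measurable M"
      unfolding G_def using z0 by (intro borel_measurable_sum borel_measurable_times borel_measurable_const D_measurable)
    have "(LINT \<omega>|M. cis (G \<omega>)) = complex_of_real (exp (- ?Q / 2))"
      using wiener_sum_char[of z v "N * m", OF z0 zless] unfolding G_def[symmetric] zdiff var .
    moreover have "integrable M (\<lambda>\<omega>. cis (G \<omega>))"
      by (intro integrable_const_bound[where B = 1] measurable_compose[OF Gm]
          borel_measurable_continuous_onI continuous_intros) auto
    ultimately have cosG: "expectation (\<lambda>\<omega>. cos (G \<omega>)) = exp (- ?Q / 2)"
      using integral_Re[of M "\<lambda>\<omega>. cis (G \<omega>)"] by simp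
    have Um: "U \<in> borel_measurable M"
      unfolding U using JTm by (intro borel_measurable_sum borel_measurable_times borel_measurable_const)
    have cosi: "integrable M (\<lambda>\<omega>. cos (U \<omega>))" "integrable M (\<lambda>\<omega>. cos (G \<omega>))"
      using Um Gm by (auto intro!: integrable_const_bound[where B = 1])
    have UG: "\<bar>U \<omega> - G \<omega>\<bar> \<le> (\<Sum>k<N. \<Sum>j\<in>UNIV. \<bar>w k j\<bar> * \<bar>J (T k) \<omega> $ j - W k j \<omega>\<bar>)" for \<omega>
    proof -
      have "U \<omega> - G \<omega> = (\<Sum>k<N. \<Sum>j\<in>UNIV. w k j * (J (T k) \<omega> $ j - W k j \<omega>))"
        unfolding U G by (simp add: sum_subtractf right_diff_distrib)
      then show ?thesis
        by (auto simp: abs_mult[symmetric] intro!: order_trans[OF sum_abs] sum_mono)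
    qed
    have "\<bar>?lhs - exp (- ?Q / 2)\<bar> = \<bar>expectation (\<lambda>\<omega>. cos (U \<omega>) - cos (G \<omega>))\<bar>"
      using cosi cosG unfolding U_def T_def by simp
    also have "\<dots> \<le> expectation (\<lambda>\<omega>. \<bar>cos (U \<omega>) - cos (G \<omega>)\<bar>)"
      by (rule integral_abs_bound)
    also have "\<dots> \<le> expectation (\<lambda>\<omega>. \<Sum>k<N. \<Sum>j\<in>UNIV. \<bar>w k j\<bar> * \<bar>J (T k) \<omega> $ j - W k j \<omega>\<bar>)"
      using JW cosi by (intro integral_mono order_trans[OF abs_cos_diff_le UG] Bochner_Integration.integrable_sum) auto
    also have "\<dots> = (\<Sum>k<N. \<Sum>j\<in>UNIV. \<bar>w k j\<bar> * expectation (\<lambda>\<omega>. \<bar>J (T k) \<omega> $ j - W k j \<omega>\<bar>))"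
      using JW by (simp add: Bochner_Integration.integral_sum)
    also have "\<dots> \<le> (\<Sum>k<N. \<Sum>j\<in>UNIV. \<bar>w k j\<bar> * (2 * e * sqrt x))"
      using JW by (intro sum_mono mult_left_mono) auto
    also have "\<dots> = C * (2 * e * sqrt x)" by (simp add: C_def sum_distrib_right)
    finally show ?thesis .
  qed
  have "\<bar>?lhs - exp (- ?Q / 2)\<bar> \<le> 0"
  proof (rule field_le_epsilon)
    fix e :: real assume e: "0 < e"
    \<comment> \<open>\<open>C + 1\<close> in place of \<open>C\<close> avoids a zero denominator
      when all weights vanish.\<close>
    define d where "d = e / (2 * (C + 1) * sqrt x)"
    have "0 < d" using e x C0 by (simp add: d_def)
    then have "\<bar>?lhs - exp (- ?Q / 2)\<bar> \<le> C * (2 * d * sqrt x)" by (rule close)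
    also have "\<dots> \<le> (C + 1) * (2 * d * sqrt x)"
      using \<open>0 < d\<close> x by (intro mult_right_mono) auto
    also have "\<dots> = e"
    proof -
      have "a * (2 * (e / (2 * a * b)) * b) = e" if "a \<noteq> 0" "b \<noteq> 0" for a b
        using that by simp
      from this[of "C + 1" "sqrt x"] show ?thesis using C0 x unfolding d_def by simp
    qed
    finally show "\<bar>?lhs - exp (- ?Q / 2)\<bar> \<le> 0 + e" by simp
  qed
  then show ?thesis by simp
qed

end

section \<open>Gaussian processes with an atomic spectral measure\<close>

text \<open>The measure is the image of a weighted counting measure on the index type under
  \<open>j \<mapsto> p $ j\<close>, for which the integral is a finite sum.\<close>

lemma lebesgue_integral_atomic_measure:
  fixes c p :: "real ^ 'n" and f :: "real \<Rightarrow> real"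
  assumes f: "f \<in> borel_measurable borel"
  shows "(LINT \<zeta>|atomic_measure c p. f \<zeta>) = (\<Sum>j\<in>UNIV. (c $ j)\<^sup>2 * f (p $ j))"
proof -
  let ?Q = "point_measure (UNIV :: 'n set) (\<lambda>j. ennreal ((c $ j)\<^sup>2))"
  have m: "(\<lambda>j. p $ j) \<in> measurable ?Q borel" by (simp add: point_measure_def)
  have "atomic_measure c p = distr ?Q borel (\<lambda>j. p $ j)"
  proof (rule measure_eqI)
    fix A assume "A \<in> sets (atomic_measure c p)"
    then have A: "A \<in> sets borel" by simp
    have "emeasure (distr ?Q borel (\<lambda>j. p $ j)) A = (\<Sum>j\<in>{j. p $ j \<in> A}. ennreal ((c $ j)\<^sup>2))"
      by (subst emeasure_distr[OF m A])
        (simp add: space_point_measure vimage_def emeasure_point_measure_finite)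
    also have "\<dots> = (\<Sum>j\<in>UNIV. ennreal ((c $ j)\<^sup>2) * indicator A (p $ j))"
      by (rule sum.mono_neutral_cong_left) (auto simp: indicator_def)
    finally show "emeasure (atomic_measure c p) A = emeasure (distr ?Q borel (\<lambda>j. p $ j)) A"
      by (simp add: emeasure_atomic_measure[OF A])
  qed simp
  then show ?thesis
    by (simp add: integral_distr[OF m f] lebesgue_integral_point_measure_finite)
qed

lemma R_cov_atomic_measure:
  "R_cov (atomic_measure c p) s t = (\<Sum>j\<in>UNIV. (c $ j)\<^sup>2 * cov_kernel s t (p $ j))"
  unfolding R_cov_def
  by (rule lebesgue_integral_atomic_measure) (unfold cov_kernel_def, measurable)

text \<open>The two cases of \<open>gaussian_rv\<close>: an almost surely constant variable of mean
  0 vanishes and both sides are 1; otherwise the cosine average is the real part of the normal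
  characteristic function.\<close>

lemma (in prob_space) centered_gaussian_rv:
  assumes Y: "gaussian_rv M Y" and mean: "expectation Y = 0"
  shows "integrable M (\<lambda>\<omega>. (Y \<omega>)\<^sup>2)"
    and "expectation (\<lambda>\<omega>. cos (Y \<omega>)) = exp (- expectation (\<lambda>\<omega>. (Y \<omega>)\<^sup>2) / 2)"
proof -
  have Ym: "Y \<in> borel_measurable M" using Y by (simp add: gaussian_rv_def)
  have "integrable M (\<lambda>\<omega>. (Y \<omega>)\<^sup>2) \<and>
    expectation (\<lambda>\<omega>. cos (Y \<omega>)) = exp (- expectation (\<lambda>\<omega>. (Y \<omega>)\<^sup>2) / 2)"
  proof (cases "\<exists>m. AE \<omega> in M. Y \<omega> = m")
    case True
    then obtain m where m: "AE \<omega> in M. Y \<omega> = m" by blast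
    have "expectation Y = expectation (\<lambda>_. m)"
      using m Ym by (intro integral_cong_AE) auto
    then have "m = 0" using mean by (simp add: prob_space)
    then have ae: "AE \<omega> in M. Y \<omega> = 0" using m by simp
    have "integrable M (\<lambda>\<omega>. (Y \<omega>)\<^sup>2) = integrable M (\<lambda>_. 0 :: real)"
      using ae Ym by (intro integrable_cong_AE) auto
    moreover have "expectation (\<lambda>\<omega>. (Y \<omega>)\<^sup>2) = expectation (\<lambda>_. 0)"
      using ae Ym by (intro integral_cong_AE) auto
    moreover have "expectation (\<lambda>\<omega>. cos (Y \<omega>)) = expectation (\<lambda>_. 1)"
      using ae Ym by (intro integral_cong_AE) auto
    ultimately show ?thesis by (simp add: prob_space)
  next
    case False
    then obtain m s where s: "s > 0" and D: "distributed M lborel Y (normal_density m s)"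
      using Y by (auto simp: gaussian_rv_def)
    have m0: "m = 0" using normal_distributed_expectation[OF s D] mean by simp
    have "integrable lborel (\<lambda>y. normal_density 0 s y * y\<^sup>2)"
      using integrable_normal_moment[OF s, of 0 2] by simp
    then have i: "integrable M (\<lambda>\<omega>. (Y \<omega>)\<^sup>2)"
      using distributed_integrable[OF D, of "\<lambda>y. y\<^sup>2"] m0 by (simp add: normal_density_nonneg)
    have v: "expectation (\<lambda>\<omega>. (Y \<omega>)\<^sup>2) = s\<^sup>2"
      using normal_distributed_variance[OF s D] mean by simp
    have "expectation (\<lambda>\<omega>. cis (1 * Y \<omega>)) = complex_of_real (exp (- (1 * s)\<^sup>2 / 2))"
      using normal_distributed_char[OF s] D m0 by blast
    moreover have "integrable M (\<lambda>\<omega>. cis (Y \<omega>))"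
      by (intro integrable_const_bound[where B = 1] measurable_compose[OF Ym]
          borel_measurable_continuous_onI continuous_intros) auto
    ultimately show ?thesis
      using i v integral_Re[of M "\<lambda>\<omega>. cis (Y \<omega>)"] by simp
  qed
  then show "integrable M (\<lambda>\<omega>. (Y \<omega>)\<^sup>2)"
    "expectation (\<lambda>\<omega>. cos (Y \<omega>)) = exp (- expectation (\<lambda>\<omega>. (Y \<omega>)\<^sup>2) / 2)" by auto
qed

lemma (in prob_space) integrable_mult_of_square:
  fixes X Y :: "'a \<Rightarrow> real"
  assumes "X \<in> borel_measurable M" "Y \<in> borel_measurable M"
    and "integrable M (\<lambda>\<omega>. (X \<omega>)\<^sup>2)" "integrable M (\<lambda>\<omega>. (Y \<omega>)\<^sup>2)"
  shows "integrable M (\<lambda>\<omega>. X \<omega> * Y \<omega>)"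
proof (rule Bochner_Integration.integrable_bound)
  show "integrable M (\<lambda>\<omega>. (X \<omega>)\<^sup>2 + (Y \<omega>)\<^sup>2)" using assms by simp
  have "\<bar>x * y\<bar> \<le> x\<^sup>2 + y\<^sup>2" for x y :: real
  proof -
    have "2 * \<bar>x * y\<bar> \<le> x\<^sup>2 + y\<^sup>2"
      using sum_squares_bound[of "\<bar>x\<bar>" "\<bar>y\<bar>"] by (simp add: abs_mult)
    then show ?thesis by linarith
  qed
  then show "AE \<omega> in M. norm (X \<omega> * Y \<omega>) \<le> norm ((X \<omega>)\<^sup>2 + (Y \<omega>)\<^sup>2)"
    by (intro AE_I2) (simp add: order_trans[OF _ abs_ge_self])
qed (use assms in measurable)

text \<open>\<open>gaussian_process\<close> speaks about finite sets of times. Injectivity of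
  \<open>t\<close> turns the coefficients of a finite sequence of times into coefficients on its
  image.\<close>

lemma centered_gaussian_process_char:
  assumes G: "centered_gaussian_process M S X R"
    and t: "inj_on t {..<N}" "\<And>k. k < N \<Longrightarrow> t k \<in> S"
  shows "(LINT \<omega>|M. cos (\<Sum>k<N. \<theta> k * X (t k) \<omega>)) = exp (- quad N (\<lambda>k l. R (t k) (t l)) \<theta> / 2)"
proof -
  interpret prob_space M using G by (simp add: centered_gaussian_process_def gaussian_process_def)
  have g: "finite J \<Longrightarrow> J \<subseteq> S \<Longrightarrow> gaussian_rv M (\<lambda>\<omega>. \<Sum>s\<in>J. a s * X s \<omega>)" for J a
    using G unfolding centered_gaussian_process_def gaussian_process_def by blast
  have mean: "s \<in> S \<Longrightarrow> expectation (X s) = 0" for s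
    using G by (simp add: centered_gaussian_process_def)
  have cov: "s \<in> S \<Longrightarrow> s' \<in> S \<Longrightarrow> expectation (\<lambda>\<omega>. X s \<omega> * X s' \<omega>) = R s s'" for s s'
    using G by (simp add: centered_gaussian_process_def)
  have gX: "gaussian_rv M (X s)" if "s \<in> S" for s
    using g[of "{s}" "\<lambda>_. 1"] that by simp
  have Xm: "X s \<in> borel_measurable M" if "s \<in> S" for s
    using gX[OF that] by (simp add: gaussian_rv_def)
  have X2: "integrable M (\<lambda>\<omega>. (X s \<omega>)\<^sup>2)" if "s \<in> S" for s
    using centered_gaussian_rv(1)[OF gX mean] that by blast
  have X1: "integrable M (X s)" if "s \<in> S" for s
    using square_integrable_imp_integrable[OF Xm X2] that by blast
  have XX: "integrable M (\<lambda>\<omega>. X s \<omega> * X s' \<omega>)" if "s \<in> S" "s' \<in> S" for s s'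
    using integrable_mult_of_square Xm X2 that by blast
  let ?Y = "\<lambda>\<omega>. \<Sum>k<N. \<theta> k * X (t k) \<omega>"
  have "?Y = (\<lambda>\<omega>. \<Sum>s\<in>t ` {..<N}. \<theta> (the_inv_into {..<N} t s) * X s \<omega>)"
    using t(1) by (simp add: sum.reindex the_inv_into_f_f)
  then have gY: "gaussian_rv M ?Y"
    using g[of "t ` {..<N}" "\<lambda>s. \<theta> (the_inv_into {..<N} t s)"] t(2) by auto
  have "expectation ?Y = 0" using t(2) X1 mean by (simp add: Bochner_Integration.integral_sum)
  note Y = centered_gaussian_rv(2)[OF gY this]
  have "expectation (\<lambda>\<omega>. (?Y \<omega>)\<^sup>2) = expectation (\<lambda>\<omega>. \<Sum>k<N. \<Sum>l<N. \<theta> k * \<theta> l * (X (t k) \<omega> * X (t l) \<omega>))"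
    by (simp add: power2_eq_square sum_product mult_ac)
  also have "\<dots> = (\<Sum>k<N. \<Sum>l<N. \<theta> k * \<theta> l * R (t k) (t l))"
  proof -
    have int: "integrable M (\<lambda>\<omega>. \<theta> k * \<theta> l * (X (t k) \<omega> * X (t l) \<omega>))"
      and exp: "expectation (\<lambda>\<omega>. \<theta> k * \<theta> l * (X (t k) \<omega> * X (t l) \<omega>)) = \<theta> k * \<theta> l * R (t k) (t l)"
      if "k < N" "l < N" for k l
      using XX[OF t(2) t(2)] cov[OF t(2) t(2)] that by auto
    have "expectation (\<lambda>\<omega>. \<Sum>k<N. \<Sum>l<N. \<theta> k * \<theta> l * (X (t k) \<omega> * X (t l) \<omega>))
        = (\<Sum>k<N. expectation (\<lambda>\<omega>. \<Sum>l<N. \<theta> k * \<theta> l * (X (t k) \<omega> * X (t l) \<omega>)))"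
      by (intro Bochner_Integration.integral_sum Bochner_Integration.integrable_sum int) auto
    also have "\<dots> = (\<Sum>k<N. \<Sum>l<N. expectation (\<lambda>\<omega>. \<theta> k * \<theta> l * (X (t k) \<omega> * X (t l) \<omega>)))"
      by (intro sum.cong refl Bochner_Integration.integral_sum int) auto
    also have "\<dots> = (\<Sum>k<N. \<Sum>l<N. \<theta> k * \<theta> l * R (t k) (t l))"
      by (intro sum.cong refl exp) auto
    finally show ?thesis .
  qed
  also have "\<dots> = quad N (\<lambda>k l. R (t k) (t l)) \<theta>"
    by (simp add: quad_def mult_ac)
  finally show ?thesis using Y by simp
qed

section \<open>Second logarithmic derivatives\<close>

text \<open>On the real axis the imaginary part of \<open>f\<close> vanishes identically, hence so
  does its derivative along the axis. The lemma is applied to \<open>f\<close> and then to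
  \<open>deriv f\<close>.\<close>

lemma real_on_reals_deriv:
  assumes f: "f holomorphic_on UNIV" and r: "\<And>x::real. f (of_real x) = of_real (r x)"
  shows "deriv f (of_real x) = of_real (Re (deriv f (of_real x)))"
    and "(r has_real_derivative Re (deriv f (of_real x))) (at x)"
proof -
  have "(f has_field_derivative deriv f (of_real x)) (at (of_real x))"
    using f by (intro holomorphic_derivI[of f UNIV]) auto
  then have v: "((\<lambda>x. f (of_real x)) has_vector_derivative deriv f (of_real x)) (at x)"
    by (rule has_vector_derivative_real_field)
  have "((\<lambda>x. Im (f (of_real x))) has_vector_derivative Im (deriv f (of_real x))) (at x)"
    using bounded_linear.has_vector_derivative[OF bounded_linear_Im v] .
  then have "((\<lambda>x. 0 :: real) has_vector_derivative Im (deriv f (of_real x))) (at x)"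
    by (simp add: r)
  then have "Im (deriv f (of_real x)) = 0"
    using vector_derivative_unique_at[of "\<lambda>x. 0 :: real" _ x 0] has_vector_derivative_const by blast
  then show "deriv f (of_real x) = of_real (Re (deriv f (of_real x)))" by (simp add: complex_eq_iff)
  have "((\<lambda>x. Re (f (of_real x))) has_vector_derivative Re (deriv f (of_real x))) (at x)"
    using bounded_linear.has_vector_derivative[OF bounded_linear_Re v] .
  then show "(r has_real_derivative Re (deriv f (of_real x))) (at x)"
    by (simp add: r has_real_derivative_iff_has_vector_derivative)
qed

text \<open>\<open>l2\<close> is the quotient of \<open>r'' r - r'\<^sup>2\<close> by
  \<open>r\<^sup>2\<close>. The last clause states it multiplied out, since the entire function
  \<open>f\<close> may have zeros off the real axis.\<close>

lemma ln_holomorphic_derivs: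
  assumes f: "f holomorphic_on UNIV" and r: "\<And>x::real. f (of_real x) = of_real (r x)"
    and pos: "\<And>x. 0 < r x"
  shows "\<exists>l1 l2. (\<forall>x. ((\<lambda>x. ln (r x)) has_real_derivative l1 x) (at x)) \<and>
    (\<forall>x. (l1 has_real_derivative l2 x) (at x)) \<and>
    (\<forall>x. of_real (l2 x * (r x)\<^sup>2)
      = deriv (deriv f) (of_real x) * f (of_real x) - (deriv f (of_real x))\<^sup>2)"
proof -
  define r1 where "r1 x = Re (deriv f (of_real x))" for x
  define r2 where "r2 x = Re (deriv (deriv f) (of_real x))" for x
  have f': "deriv f holomorphic_on UNIV" using f by (intro holomorphic_deriv) auto
  have d1: "deriv f (of_real x) = of_real (r1 x)" and r1: "(r has_real_derivative r1 x) (at x)" for x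
    using real_on_reals_deriv[OF f r] unfolding r1_def by auto
  have d2: "deriv (deriv f) (of_real x) = of_real (r2 x)" and r2: "(r1 has_real_derivative r2 x) (at x)" for x
    using real_on_reals_deriv[OF f' d1] unfolding r2_def by auto
  show ?thesis
  proof (intro exI conjI allI)
    show "((\<lambda>x. ln (r x)) has_real_derivative r1 x / r x) (at x)" for x
      using pos[of x] by (auto intro!: derivative_eq_intros r1 simp: field_simps)
    show "((\<lambda>x. r1 x / r x) has_real_derivative (r2 x * r x - (r1 x)\<^sup>2) / (r x)\<^sup>2) (at x)" for x
      using pos[of x] by (auto intro!: derivative_eq_intros r1 r2 simp: power2_eq_square)
    show "of_real ((r2 x * r x - (r1 x)\<^sup>2) / (r x)\<^sup>2 * (r x)\<^sup>2)
      = deriv (deriv f) (of_real x) * f (of_real x) - (deriv f (of_real x))\<^sup>2" for x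
    proof -
      have "(r x)\<^sup>2 \<noteq> 0" using pos[of x] by simp
      then have "(r2 x * r x - (r1 x)\<^sup>2) / (r x)\<^sup>2 * (r x)\<^sup>2 = r2 x * r x - (r1 x)\<^sup>2"
        by (subst times_divide_eq_left) (rule nonzero_mult_div_cancel_right)
      then show ?thesis by (simp only: d1 d2 r of_real_diff of_real_mult of_real_power)
    qed
  qed
qed

text \<open>After clearing denominators both sides are entire.\<close>
lemma ln_second_deriv_identity:
  assumes f: "f holomorphic_on UNIV" "\<And>x::real. f (of_real x) = of_real (r x)" "\<And>x. 0 < r x"
    and g: "g holomorphic_on UNIV" "\<And>x::real. g (of_real x) = of_real (s x)" "\<And>x. 0 < s x"
    and f2: "\<And>x. of_real (f2 x * (r x)\<^sup>2) = deriv (deriv f) (of_real x) * f (of_real x) - (deriv f (of_real x))\<^sup>2"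
    and g2: "\<And>x. of_real (g2 x * (s x)\<^sup>2) = deriv (deriv g) (of_real x) * g (of_real x) - (deriv g (of_real x))\<^sup>2"
    and eq: "\<And>x. 0 < x \<Longrightarrow> f2 x = g2 x"
  shows "f2 x = g2 x"
proof -
  \<comment> \<open>On the real axis this is \<open>f2 - g2\<close> times positive factors. It
    vanishes on the positive half line, which accumulates at 1, and hence everywhere.\<close>
  define E where "E z = (deriv (deriv f) z * f z - (deriv f z)\<^sup>2) * (g z)\<^sup>2
    - (deriv (deriv g) z * g z - (deriv g z)\<^sup>2) * (f z)\<^sup>2" for z
  have E: "E (of_real x) = of_real ((f2 x - g2 x) * (r x)\<^sup>2 * (s x)\<^sup>2)" for x
    unfolding E_def f2[symmetric] g2[symmetric] by (simp add: f(2) g(2) algebra_simps)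
  have "E holomorphic_on UNIV"
    unfolding E_def using f(1) g(1) by (intro holomorphic_intros) auto
  moreover have "(1 :: complex) islimpt of_real ` {0::real<..}"
    unfolding islimpt_approachable
  proof (intro allI impI)
    fix e :: real assume "0 < e"
    moreover have "complex_of_real (1 + e / 2) - 1 = complex_of_real (e / 2)" by simp
    ultimately have "dist (complex_of_real (1 + e / 2)) 1 < e"
      unfolding dist_norm by (simp only: norm_of_real)
    then show "\<exists>x'\<in>complex_of_real ` {0<..}. x' \<noteq> 1 \<and> dist x' 1 < e"
      using \<open>0 < e\<close> by (intro bexI[of _ "complex_of_real (1 + e / 2)"] conjI imageI) (auto simp: complex_eq_iff)
  qed
  moreover have "E z = 0" if "z \<in> of_real ` {0::real<..}" for z
    using that E eq by auto
  ultimately have "E (of_real x) = 0"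
    using analytic_continuation[of E UNIV "of_real ` {0<..}" 1 "of_real x"] by auto
  then show ?thesis unfolding E using f(3)[of x] g(3)[of x] by simp
qed

text \<open>A point \<open>x > 0\<close> is interior to the half line. There the one-sided
  derivatives of \<open>psi\<close> are ordinary ones and see only values of \<open>G\<close> on
  \<open>{0..}\<close>.\<close>

lemma deriv_within_Ici_iterate:
  fixes F F1 F2 G :: "real \<Rightarrow> real"
  assumes F: "\<And>x. (F has_real_derivative F1 x) (at x)" "\<And>x. (F1 has_real_derivative F2 x) (at x)"
    and G: "\<And>x. 0 \<le> x \<Longrightarrow> G x = F x" and x: "0 < x"
  shows "(deriv_within {0..} ^^ 2) G x = F2 x"
proof -
  have at: "at y within {0..} = at y" if "0 < y" for y :: real
    using that by (intro at_within_interior) simp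
  have G1: "deriv_within {0..} G y = F1 y" if "0 < y" for y
  proof -
    have "(F has_vector_derivative F1 y) (at y)"
      using F(1) by (simp add: has_real_derivative_iff_has_vector_derivative)
    then have "(G has_vector_derivative F1 y) (at y)"
      by (rule has_vector_derivative_transform_within_open[OF _ open_greaterThan[of 0]]) (use that G in auto)
    then show ?thesis unfolding deriv_within_def at[OF that] by (rule vector_derivative_at)
  qed
  have "(F1 has_vector_derivative F2 x) (at x)"
    using F(2) by (simp add: has_real_derivative_iff_has_vector_derivative)
  then have "(deriv_within {0..} G has_vector_derivative F2 x) (at x)"
    by (rule has_vector_derivative_transform_within_open[OF _ open_greaterThan[of 0]]) (use x G1 in auto)
  then show ?thesis unfolding numeral_2_eq_2 funpow.simps comp_def id_def
    unfolding deriv_within_def[of _ "deriv_within _ _"] at[OF x] by (rule vector_derivative_at)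
qed

section \<open>Tau functions of reflectionless potentials\<close>

definition tau :: "(real \<times> real) list \<Rightarrow> 'b::{real_normed_field,banach} \<Rightarrow> 'b" where
  "tau s z = Determinant.det (Matrix.mat (length s) (length s) (\<lambda>(i,j). (if i = j then 1 else 0)
     + of_real (sqrt (snd (s ! i) * snd (s ! j)) / (fst (s ! i) + fst (s ! j)))
       * exp (- of_real (fst (s ! i) + fst (s ! j)) * z)))"

lemma tau_eq: "Determinant.det (1\<^sub>m (length s) + G_mat s x) = tau s x"
  unfolding tau_def G_mat_def
  by (intro arg_cong[where f = Determinant.det] eq_matI) auto

lemma tau_of_real: "tau s (complex_of_real x) = complex_of_real (tau s x)"
proof -
  have "exp (- complex_of_real b * complex_of_real x) = complex_of_real (exp (- b * x))" for b
    by (metis exp_of_real of_real_minus of_real_mult)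
  then have e: "(if i = j then 1 else 0) + complex_of_real a * exp (- complex_of_real b * complex_of_real x)
      = complex_of_real ((if i = j then 1 else 0) + a * exp (- b * x))" for a b and i j :: nat
    by simp
  show ?thesis
    unfolding tau_def of_real_hom.hom_det[symmetric]
    by (intro arg_cong[where f = Determinant.det] eq_matI)
      (simp_all only: index_mat index_map_mat dim_row_mat dim_col_mat split e of_real_eq_id id_apply)
qed

lemma holomorphic_on_tau: "tau s holomorphic_on UNIV"
proof -
  have "(\<lambda>z. tau s z) holomorphic_on UNIV"
    unfolding tau_def by (intro holomorphic_on_det holomorphic_intros)
  then show ?thesis .
qed

text \<open>\<open>- d/dx\<close> of the quadratic form of \<open>G\<close> is a square, and the form vanishes at infinity.\<close>
lemma tau_pos:
  assumes s: "s \<in> scattering_data"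
  shows "0 < tau s (x::real)"
proof -
  define n where "n = length s"
  define \<eta> where "\<eta> i = fst (s ! i)" for i
  define m where "m i = snd (s ! i)" for i
  have pos: "0 < \<eta> i" "0 < m i" if "i < n" for i
    using s that nth_mem[of i s] unfolding scattering_data_def n_def \<eta>_def m_def by fastforce+
  define Q where "Q x i j = sqrt (m i * m j) / (\<eta> i + \<eta> j) * exp (- (\<eta> i + \<eta> j) * x)" for x i j
  have psd: "0 \<le> quad n (Q x) z" for x z
  proof -
    define \<phi> where "\<phi> y = quad n (Q y) z" for y
    have d: "(\<phi> has_real_derivative - (\<Sum>i<n. sqrt (m i) * exp (- \<eta> i * y) * z i)\<^sup>2) (at y)" for y
    proof -
      have "((\<lambda>y. Q y i j * z i * z j) has_real_derivative
          - ((sqrt (m i) * exp (- \<eta> i * y) * z i) * (sqrt (m j) * exp (- \<eta> j * y) * z j))) (at y)"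
        if "i < n" "j < n" for i j
      proof -
        have d: "((\<lambda>y. w / a * exp (- a * y) * u * v) has_real_derivative - (w * exp (- a * y) * u * v)) (at y)"
          if "0 < a" for w a u v :: real
          using that by (auto intro!: derivative_eq_intros)
        have "0 < \<eta> i + \<eta> j" using pos \<open>i < n\<close> \<open>j < n\<close> by (simp add: add_pos_pos)
        note d[OF this, of "sqrt (m i * m j)" "z i" "z j"]
        moreover have "exp (- (\<eta> i + \<eta> j) * y) = exp (- \<eta> i * y) * exp (- \<eta> j * y)"
          by (simp add: exp_add[symmetric] algebra_simps)
        ultimately show ?thesis unfolding Q_def by (simp only: real_sqrt_mult mult_ac)
      qed
      then have "(\<phi> has_real_derivative (\<Sum>i<n. \<Sum>j<n.
          - ((sqrt (m i) * exp (- \<eta> i * y) * z i) * (sqrt (m j) * exp (- \<eta> j * y) * z j)))) (at y)"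
        unfolding \<phi>_def quad_def by (intro DERIV_sum) auto
      then show ?thesis by (simp add: power2_eq_square sum_product sum_negf)
    qed
    have "(\<phi> \<longlongrightarrow> (\<Sum>i<n. \<Sum>j<n. 0)) at_top"
      unfolding \<phi>_def quad_def
    proof (intro tendsto_sum)
      fix i j assume "i \<in> {..<n}" "j \<in> {..<n}"
      then have "0 < \<eta> i + \<eta> j" using pos by (simp add: add_pos_pos)
      then have "((\<lambda>y. exp (- (\<eta> i + \<eta> j) * y)) \<longlongrightarrow> 0) at_top"
        by (intro filterlim_compose[OF exp_at_bot] filterlim_tendsto_neg_mult_at_bot[OF tendsto_const] filterlim_ident) simp
      then have "((\<lambda>y. sqrt (m i * m j) / (\<eta> i + \<eta> j) * exp (- (\<eta> i + \<eta> j) * y) * z i * z j)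
          \<longlongrightarrow> sqrt (m i * m j) / (\<eta> i + \<eta> j) * 0 * z i * z j) at_top"
        by (intro tendsto_intros)
      then show "((\<lambda>y. Q y i j * z i * z j) \<longlongrightarrow> 0) at_top" unfolding Q_def by simp
    qed
    then have "(\<phi> \<longlongrightarrow> 0) at_top" by simp
    moreover have "\<phi> y \<le> \<phi> x" if "x \<le> y" for y
      using that d by (intro DERIV_nonpos_imp_nonincreasing[of x y \<phi>]) (auto intro!: exI)
    then have "eventually (\<lambda>y. \<phi> y \<le> \<phi> x) at_top"
      by (rule eventually_mono[OF eventually_ge_at_top[of x]])
    ultimately have "0 \<le> \<phi> x" by (rule tendsto_upperbound) simp
    then show ?thesis by (simp add: \<phi>_def)
  qed
  have sym: "Q x i j = Q x j i" for x i j by (simp add: Q_def mult.commute add.commute)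
  \<comment> \<open>The Gaussian integral is reused for its by-product: the identity plus a positive
    semidefinite matrix has determinant at least 1.\<close>
  have "1 \<le> Determinant.det (Matrix.mat n n (\<lambda>(i,j). (if i = j then 1 else 0) + Q x i j))"
    by (rule gauss_prod_integral_exp_quad[of n "Q x", OF sym psd, THEN conjunct1])
  also have "\<dots> = tau s x"
    unfolding tau_def Q_def n_def \<eta>_def m_def of_real_eq_id id_apply ..
  finally show ?thesis by simp
qed

section \<open>The Laplace transforms on the real line\<close>

lemma (in brownian) ito_process_laplace:
  fixes c p :: "real ^ 'n"
  assumes J: "is_ito_process M B (\<lambda>y \<omega>. matrix_exp (- y *\<^sub>R diagonal_matrix p)) J"
    and X: "\<And>t \<omega>. 0 \<le> t \<Longrightarrow> X t \<omega> = c \<bullet> (matrix_exp (t *\<^sub>R diagonal_matrix p) *v J t \<omega>)"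
    and x: "0 < x"
  shows "0 < (LINT \<omega>|M. exp (- (1 / 2) * (LBINT y:{0..x}. (X y \<omega>)\<^sup>2)))"
    and "(\<lambda>N. disc_det c p N x) \<longlonglongrightarrow> 1 / (LINT \<omega>|M. exp (- (1 / 2) * (LBINT y:{0..x}. (X y \<omega>)\<^sup>2)))\<^sup>2"
proof -
  have X': "X t \<omega> = (\<Sum>j\<in>UNIV. c $ j * (exp (t * p $ j) * J t \<omega> $ j))" if "0 \<le> t" for t \<omega>
    by (simp add: X that matrix_exp_scaleR_diagonal_matrix diagonal_matrix_mult_vec inner_vec_def)
  have m: "X t \<in> borel_measurable M" if "0 \<le> t" for t
  proof -
    have "J t \<in> borel_measurable M"
      using J that by (simp add: is_ito_process_def is_ito_integral_def)
    then have "(\<lambda>\<omega>. J t \<omega> $ j) \<in> borel_measurable M" for j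
      by (rule measurable_compose) (rule borel_measurable_vec_nth)
    then show ?thesis unfolding X'[OF that, abs_def]
      by (intro borel_measurable_sum borel_measurable_times borel_measurable_const)
  qed
  have cont: "continuous_on {0..} (\<lambda>t. X t \<omega>)" if "\<omega> \<in> space M" for \<omega>
  proof -
    have "continuous_on {0..} (\<lambda>t. J t \<omega>)" using J that by (simp add: is_ito_process_def)
    then have "continuous_on {0..} (\<lambda>t. \<Sum>j\<in>UNIV. c $ j * (exp (t * p $ j) * J t \<omega> $ j))"
      by (intro continuous_intros)
    then show ?thesis by (rule continuous_on_eq) (simp add: X')
  qed
  note * = disc_det_tendsto_laplace[OF x m cont ito_process_char[OF J X x]]
  show "0 < (LINT \<omega>|M. exp (- (1 / 2) * (LBINT y:{0..x}. (X y \<omega>)\<^sup>2)))"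
    by (rule *(1))
  show "(\<lambda>N. disc_det c p N x) \<longlonglongrightarrow> 1 / (LINT \<omega>|M. exp (- (1 / 2) * (LBINT y:{0..x}. (X y \<omega>)\<^sup>2)))\<^sup>2"
    by (rule *(2))
qed

lemma is_P_laplace:
  assumes P: "is_P (atomic_measure c p) P" and x: "0 < x"
  shows "0 < (LINT \<omega>|P. exp (- (1 / 2) * (LBINT y:{0..x}. (coord y \<omega>)\<^sup>2)))"
    and "(\<lambda>N. disc_det c p N x) \<longlonglongrightarrow> 1 / (LINT \<omega>|P. exp (- (1 / 2) * (LBINT y:{0..x}. (coord y \<omega>)\<^sup>2)))\<^sup>2"
proof -
  have G: "centered_gaussian_process P {0..} coord (R_cov (atomic_measure c p))"
    and "sets P = sets path_borel" and "prob_space P"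
    using P by (auto simp: is_P_def)
  interpret prob_space P by fact
  have "space P = path_space"
    using sets_eq_imp_space_eq[OF \<open>sets P = sets path_borel\<close>]
    by (simp add: path_borel_def space_measure_of_conv)
  then have cont: "continuous_on {0..} (\<lambda>t. coord t \<omega>)" if "\<omega> \<in> space P" for \<omega>
    using that by (simp add: coord_def path_space_def)
  have m: "coord t \<in> borel_measurable P" if "0 \<le> t" for t
  proof -
    have "gaussian_process P {0..} coord"
      using G unfolding centered_gaussian_process_def by (rule conjunct1)
    then have "\<forall>J a. finite J \<and> J \<subseteq> {0..} \<longrightarrow> gaussian_rv P (\<lambda>\<omega>. \<Sum>t\<in>J. a t * coord t \<omega>)"
      unfolding gaussian_process_def by (rule conjunct2)
    from this[rule_format, of "{t}" "\<lambda>_. 1"] show ?thesis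
      using that by (simp add: gaussian_rv_def)
  qed
  have ch: "(LINT \<omega>|P. cos (\<Sum>k<N. \<theta> k * coord (x * real k / real N) \<omega>))
      = exp (- quad N (\<lambda>k l. \<Sum>j\<in>UNIV. (c $ j)\<^sup>2 * cov_kernel (x * real k / real N) (x * real l / real N) (p $ j)) \<theta> / 2)" for N \<theta>
  proof -
    \<comment> \<open>For \<open>N > 0\<close> distinctness comes from \<open>x > 0\<close>; for
      \<open>N = 0\<close> the index set is empty.\<close>
    have inj: "inj_on (\<lambda>k. x * real k / real N) {..<N}" using x by (auto simp: inj_on_def)
    have mem: "x * real k / real N \<in> {0..}" for k using x by simp
    show ?thesis
      using centered_gaussian_process_char[OF G inj mem] unfolding R_cov_atomic_measure .
  qed
  note * = disc_det_tendsto_laplace[OF x m cont ch]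
  show "0 < (LINT \<omega>|P. exp (- (1 / 2) * (LBINT y:{0..x}. (coord y \<omega>)\<^sup>2)))"
    by (rule *(1))
  show "(\<lambda>N. disc_det c p N x) \<longlonglongrightarrow> 1 / (LINT \<omega>|P. exp (- (1 / 2) * (LBINT y:{0..x}. (coord y \<omega>)\<^sup>2)))\<^sup>2"
    by (rule *(2))
qed

lemma set_integral_lborel_singleton: "(LBINT y:{a}. f y) = 0"
  for f :: "real \<Rightarrow> real"
proof -
  have "AE x in lborel. indicator {a} x *\<^sub>R f x = 0"
    using AE_lborel_singleton[of a] by eventually_elim auto
  then show ?thesis unfolding set_lebesgue_integral_def by (rule integral_eq_zero_AE)
qed

text \<open>The value at the point where the half lines meet; it matches the Laplace transform of an
  integral over a single point.\<close>

lemma disc_det_0: "disc_det c p N (0::real) = 1"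
proof -
  have "Matrix.mat N N (\<lambda>(k,l). (if k = l then 1 else 0)
      + scaled_cov c p (real k / real N) (real l / real N) 0 / real N) = 1\<^sub>m N"
    by (intro eq_matI) (auto simp: scaled_cov_def scaled_kernel_def)
  then show ?thesis by (simp add: disc_det_def)
qed

text \<open>\<open>deriv\<close> is total, so the two differentiability claims are what makes
  \<open>deriv ^^ 2\<close> a genuine second derivative. The identification of \<open>psi P\<close>
  with an element of \<open>Xi0\<close> is expressed by \<open>u_in\<close> and
  \<open>u_psi\<close>.\<close>

theorem corollary2:
  fixes c p :: "real ^ 'n"
    and P :: "(real \<Rightarrow> real) measure"
    and u :: "real \<Rightarrow> real"
    and M :: "'a measure"
    and B J \<xi> :: "real \<Rightarrow> 'a \<Rightarrow> real ^ 'n"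
    and X :: "real \<Rightarrow> 'a \<Rightarrow> real"
  assumes c_pos: "\<And>j. 0 < c $ j"
    and p_distinct: "\<And>i j. i \<noteq> j \<Longrightarrow> p $ i \<noteq> p $ j"
    and P: "is_P (atomic_measure c p) P"
    and u_in: "u \<in> Xi0"
    and u_psi: "\<And>x. x \<ge> 0 \<Longrightarrow> u x = psi P x"
    and BM: "brownian_motion M B"
    and J: "is_two_sided_ito_process M B (\<lambda>z \<omega>. matrix_exp (- z *\<^sub>R diagonal_matrix p)) J"
    and \<xi>: "\<And>y \<omega>. \<xi> y \<omega> = matrix_exp (y *\<^sub>R diagonal_matrix p) *v J y \<omega>"
    and X: "\<And>y \<omega>. X y \<omega> = c \<bullet> \<xi> y \<omega>"
  shows "\<forall>x. (\<lambda>z. log_laplace M X (min 0 z) (max 0 z)) differentiable at x \<and>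
             deriv (\<lambda>z. log_laplace M X (min 0 z) (max 0 z)) differentiable at x \<and>
             u x = 4 * (deriv ^^ 2) (\<lambda>z. log_laplace M X (min 0 z) (max 0 z)) x"
proof -
  interpret brownian M B
    using BM by (simp add: brownian_def brownian_axioms_def brownian_motion_def)
  define L where "L x = (LINT \<omega>|M. exp (- (1 / 2) * (LBINT y:{min 0 x..max 0 x}. (X y \<omega>)\<^sup>2)))" for x
  have L: "0 < L x \<and> (\<lambda>N. disc_det c p N x) \<longlonglongrightarrow> 1 / (L x)\<^sup>2" for x
  proof (cases x "0 :: real" rule: linorder_cases)
    case greater
    have "is_ito_process M B (\<lambda>y \<omega>. matrix_exp (- y *\<^sub>R diagonal_matrix p)) J"
      using J by (simp add: is_two_sided_ito_process_def)
    then show ?thesis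
      using ito_process_laplace[of p J X c x] greater by (simp add: L_def X \<xi>)
  next
    case equal
    have "L 0 = 1" by (simp add: L_def prob_space set_integral_lborel_singleton)
    then show ?thesis using equal by (simp add: disc_det_0)
  next
    case less
    \<comment> \<open>Reflection of time changes the sign of \<open>p\<close>:
      \<open>J (- t)\<close> is the integral process for \<open>- p\<close>, and
      \<open>X (- t)\<close> is built from it in the same way. \<open>disc_det_uminus\<close> then
      returns to the determinants of \<open>p\<close> at \<open>x\<close>.\<close>
    have neg: "y *\<^sub>R diagonal_matrix (- p) = (- y) *\<^sub>R diagonal_matrix p" for y
      by (simp add: diagonal_matrix_def Finite_Cartesian_Product.vec_eq_iff)
    have J': "is_ito_process M B (\<lambda>y \<omega>. matrix_exp (- y *\<^sub>R diagonal_matrix (- p))) (\<lambda>t. J (- t))"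
      using J unfolding is_two_sided_ito_process_def neg by simp
    have X': "X (- t) \<omega> = c \<bullet> (matrix_exp (t *\<^sub>R diagonal_matrix (- p)) *v J (- t) \<omega>)" for t \<omega>
      unfolding neg X \<xi> by simp
    have "(LBINT y:{x..0}. (X y \<omega>)\<^sup>2) = (LBINT y:{0..- x}. (X (- y) \<omega>)\<^sup>2)" for \<omega>
    proof -
      have "{y. - y \<in> {x..0}} = {0..- x}" by auto
      then show ?thesis using set_integral_reflect[of "{x..0}" "\<lambda>y. (X y \<omega>)\<^sup>2"] by simp
    qed
    then have "L x = (LINT \<omega>|M. exp (- (1 / 2) * (LBINT y:{0..- x}. (X (- y) \<omega>)\<^sup>2)))"
      using less by (simp add: L_def)
    then show ?thesis
      using ito_process_laplace[of "- p" "\<lambda>t. J (- t)" "\<lambda>t. X (- t)" c "- x", OF J' X'] less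
      by (simp add: disc_det_uminus)
  qed
  define r where "r x = 1 / (L x)\<^sup>2" for x
  have r_pos: "0 < r x" for x using L[of x] by (simp add: r_def)
  have ln_r: "ln (L x) = - (1 / 2) * ln (r x)" for x
    using L[of x] by (simp add: r_def ln_div ln_realpow)
  obtain d where d_hol: "d holomorphic_on UNIV"
    and d_lim: "\<forall>x L. (\<lambda>N. disc_det c p N (x::real)) \<longlonglongrightarrow> L \<longrightarrow> d (of_real x) = of_real L"
    using disc_det_entire_limit[of c p] by (elim exE conjE)
  have d_real: "d (of_real x) = of_real (r x)" for x
    unfolding r_def using d_lim[rule_format, OF conjunct2[OF L]] .
  note d = d_hol d_real
  obtain s where s: "s \<in> scattering_data" "u = potential s"
    using u_in by (auto simp: Xi0_def)
  obtain l1 l2 where l: "\<forall>x. ((\<lambda>x. ln (r x)) has_real_derivative l1 x) (at x)"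
    "\<forall>x. (l1 has_real_derivative l2 x) (at x)"
    "\<forall>x. of_real (l2 x * (r x)\<^sup>2) = deriv (deriv d) (of_real x) * d (of_real x) - (deriv d (of_real x))\<^sup>2"
    using ln_holomorphic_derivs[OF d r_pos] by (elim exE conjE)
  note l = l[rule_format]
  obtain k1 k2 where k: "\<forall>x. ((\<lambda>x. ln (tau s x)) has_real_derivative k1 x) (at x)"
    "\<forall>x. (k1 has_real_derivative k2 x) (at x)"
    "\<forall>x. complex_of_real (k2 x * (tau s x)\<^sup>2)
      = deriv (deriv (tau s)) (of_real x) * tau s (of_real x) - (deriv (tau s) (of_real x))\<^sup>2"
    using ln_holomorphic_derivs[OF holomorphic_on_tau tau_of_real tau_pos[OF s(1)]] by (elim exE conjE)
  note k = k[rule_format]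
  have u: "u x = - 2 * k2 x" for x
  proof -
    have "deriv (\<lambda>x. ln (tau s x)) = k1" using k(1) by (intro ext DERIV_imp_deriv)
    then have "(deriv ^^ 2) (\<lambda>x. ln (tau s x)) x = k2 x"
      using DERIV_imp_deriv[OF k(2)] by (simp add: numeral_2_eq_2)
    then show ?thesis by (simp add: s(2) potential_def tau_eq)
  qed
  define F where "F = (\<lambda>z. log_laplace M X (min 0 z) (max 0 z))"
  have F_eq: "F = (\<lambda>x. - (1 / 2) * ln (r x))"
    unfolding F_def log_laplace_def L_def[symmetric] ln_r ..
  have F1: "(F has_real_derivative - (1 / 2) * l1 x) (at x)" for x
    unfolding F_eq by (rule DERIV_cmult[OF l(1)])
  have F2: "((\<lambda>x. - (1 / 2) * l1 x) has_real_derivative - (1 / 2) * l2 x) (at x)" for x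
    by (rule DERIV_cmult[OF l(2)])
  have PF: "log_laplace P coord 0 x = F x" if "0 \<le> x" for x
  proof (cases "x = 0")
    case True
    have "prob_space P" using P by (simp add: is_P_def)
    then show ?thesis using True
      by (simp add: F_def log_laplace_def prob_space prob_space.prob_space set_integral_lborel_singleton)
  next
    case False
    then have x: "0 < x" using that by simp
    let ?E = "LINT \<omega>|P. exp (- (1 / 2) * (LBINT y:{0..x}. (coord y \<omega>)\<^sup>2))"
    \<comment> \<open>Both Laplace transforms are tied to the limit of the same determinants;
      positivity allows the square root to be taken.\<close>
    have "1 / ?E\<^sup>2 = 1 / (L x)\<^sup>2"
      by (rule LIMSEQ_unique[OF is_P_laplace(2)[OF P x] conjunct2[OF L]])
    then have "?E\<^sup>2 = (L x)\<^sup>2" by simp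
    then have "?E = L x"
      by (rule power2_eq_imp_eq)
        (rule less_imp_le[OF is_P_laplace(1)[OF P x]], rule less_imp_le[OF conjunct1[OF L]])
    then show ?thesis using x by (simp add: F_def log_laplace_def L_def)
  qed
  \<comment> \<open>Since \<open>4 * (- 1 / 2) = - 2\<close>, both descriptions of \<open>u\<close>
    are \<open>- 2\<close> times a second logarithmic derivative, one of \<open>tau s\<close> and
    one of \<open>d\<close>. They agree for \<open>x > 0\<close> through \<open>psi\<close>, and the
    identity theorem extends this to the whole line.\<close>
  have "k2 x = l2 x" for x
  proof (rule ln_second_deriv_identity[OF holomorphic_on_tau tau_of_real tau_pos[OF s(1)] d r_pos k(3) l(3)])
    fix x :: real assume x: "0 < x"
    have "u x = 4 * (- (1 / 2) * l2 x)"
      using u_psi[of x] deriv_within_Ici_iterate[OF F1 F2 PF x] x by (simp add: psi_def)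
    then show "k2 x = l2 x" using u by simp
  qed
  then have "u x = 4 * (- (1 / 2) * l2 x)" for x using u by simp
  moreover have dF: "deriv F = (\<lambda>x. - (1 / 2) * l1 x)" using F1 by (intro ext DERIV_imp_deriv)
  moreover have "(deriv ^^ 2) F x = - (1 / 2) * l2 x" for x
    using DERIV_imp_deriv[OF F2] by (simp add: numeral_2_eq_2 dF)
  moreover have "F differentiable at x" "(\<lambda>x. - (1 / 2) * l1 x) differentiable at x" for x
    using F1 F2 by (auto simp: real_differentiable_def)
  ultimately show ?thesis unfolding F_def[symmetric] by simp
qed

end
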